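(* Let $M$ be a manifold with a Hermitian star product $\star$, and let $E\to M$ be a complex vector bundle of fiber dimension $k$ with Hermitian fiber metric. Let $\{\mathcal{U}_\alpha\}_{\alpha=1}^m$ be a finite open cover of $M$ such that each $E|_{\mathcal{U}_\alpha}$ is trivial, with local frames $\{e_\alpha\}$ and transition matrices $\phi_{\alpha\beta}$, and let $\boldsymbol{\Phi}_{\alpha\beta}=\phi_{\alpha\beta}+\sum_{r\ge1}\lambda^r\boldsymbol{\Phi}^{(r)}_{\alpha\beta}\in M_k(C^\infty(\mathcal{U}_\alpha\cap\mathcal{U}_\beta))[[\lambda]]$ be deformed transition matrices satisfying $$\boldsymbol{\Phi}_{\alpha\beta}\star\boldsymbol{\Phi}_{\beta\alpha}=1,\qquad\boldsymbol{\Phi}_{\alpha\beta}\star\boldsymbol{\Phi}_{\beta\gamma}\star\boldsymbol{\Phi}_{\gamma\alpha}=1,\qquad\boldsymbol{\Phi}_{\alpha\beta}^*=\boldsymbol{\Phi}_{\beta\alpha}$$ on the corresponding non-empty intersections. Let $\bullet$ be the right $(C^\infty(M)[[\lambda]],\star)$-module structure on $\Gamma^\infty(E)[[\lambda]]$ determined by $(s\bullet f)_\alpha=\boldsymbol{s}_\alpha\star f$, where $s\mapsto\{\boldsymbol{s}_\alpha\}$ is the bijection given by $\boldsymbol{s}_\alpha=\sum_\beta\boldsymbol{\Phi}_{\alpha\beta}\star\chi_\beta\star s_\beta$. Then $(\Gamma^\infty(E)[[\lambda]],\bullet)$ is a finitely generated projective right module over $(C^\infty(M)[[\lambda]],\s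tar)$.
   Context: A star product on a Poisson manifold $M$ is an associative $\mathbb{C}[[\lambda]]$-bilinear product $f\star g=\sum_{r\ge0}\lambda^rC_r(f,g)$ on $C^\infty(M)[[\lambda]]$ with bidifferential operators $C_r$, $C_0(f,g)=fg$, $C_1(f,g)-C_1(g,f)=\mathrm{i}\{f,g\}$, $1\star f=f=f\star1$. It is Hermitian if $\overline{f\star g}=\overline{g}\star\overline{f}$ with $\overline\lambda=\lambda$. $\star$ restricts to open subsets and extends to matrices and column vectors of functions. $\boldsymbol{\Phi}^*$ denotes the conjugate transpose. Local frames: $e_\alpha=(e_{\alpha,1},\dots,e_{\alpha,k})$ is a frame of $E|_{\mathcal{U}_\alpha}$, $e_\beta=e_\alpha\phi_{\alpha\beta}$ on overlaps, and a section $s\in\Gamma^\infty(E)[[\lambda]]$ is written classically as $s=e_\beta s_\beta$ on $\mathcal{U}_\beta$ with $s_\beta\in C^\infty(\mathcal{U}_\beta)^k[[\lambda]]$. $\{\chi_\alpha\}$ is a fixed partition of unity subordinate to $\{\mathcal{U}_\alpha\}$. The map $s\mapsto\{\boldsymbol{s}_\alpha\}$, with $\boldsymbol{s}_\alpha\in C^\infty(\mathcal{U}_\alpha)^k[[\lambda]]$, is a $\mathbb{C}[[\lambda]]$-linear bijection of $\Gamma^\infty(E)[[\lambda]]$ onto the set of all collections $\{\boldsymbol{s}_\alpha\}$ satisfying $\boldsymbol{\Phi}_{\alpha\beta}\star\boldsymbol{s}_\beta=\boldsymbol{s}_\alpha$; the formula $(s\bullet f)_\alpha=\boldsymbol{s}_\alpha\star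 f$ means that $s\bullet f$ is the section corresponding to the collection $\{\boldsymbol{s}_\alpha\star f\}$ under this bijection. *)

theory Defs
  imports "HOL-Analysis.Analysis" "HOL-Algebra.Module"
begin

section \<open>Smooth manifolds and smooth functions\<close>

text \<open>
  The model space is \<^const>\<open>Euclidean_space\<close> \<open>n\<close>, i.e. the \<open>y :: nat \<Rightarrow> real\<close> with
  \<open>y i = 0\<close> for \<open>i \<ge> n\<close>; coordinates are indexed by \<open>i < n\<close>, and \<open>n = 0\<close> is allowed.
\<close>

definition partial_deriv ::
    "nat \<Rightarrow> ((nat \<Rightarrow> real) \<Rightarrow> 'b::real_normed_vector) \<Rightarrow> (nat \<Rightarrow> real) \<Rightarrow> 'b" where
  "partial_deriv i f y = vector_derivative (\<lambda>t. f (y(i := t))) (at (y i))"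

definition iter_partial ::
    "nat list \<Rightarrow> ((nat \<Rightarrow> real) \<Rightarrow> 'b::real_normed_vector) \<Rightarrow> (nat \<Rightarrow> real) \<Rightarrow> 'b" where
  "iter_partial I f = foldr partial_deriv I f"

text \<open>All iterated partial derivatives exist and are continuous on the open set \<open>W\<close>.\<close>

definition smooth_on_Rn ::
    "nat \<Rightarrow> (nat \<Rightarrow> real) set \<Rightarrow> ((nat \<Rightarrow> real) \<Rightarrow> 'b::real_normed_vector) \<Rightarrow> bool" where
  "smooth_on_Rn n W f \<longleftrightarrow>
     (\<forall>I\<in>lists {..<n}. continuous_on W (iter_partial I f) \<and>
        (\<forall>i<n. \<forall>y\<in>W. (\<lambda>t. iter_partial I f (y(i := t))) differentiable (at (y i))))"

type_synonym 'm chart = "'m set \<times> ('m \<Rightarrow> nat \<Rightarrow> real)"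

definition smooth_atlas :: "nat \<Rightarrow> 'm::topological_space chart set \<Rightarrow> bool" where
  "smooth_atlas n A \<longleftrightarrow>
     (\<Union>(U, \<phi>)\<in>A. U) = UNIV \<and>
     (\<forall>(U, \<phi>)\<in>A. open U \<and> openin (Euclidean_space n) (\<phi> ` U) \<and>
        homeomorphic_map (top_of_set U) (subtopology (Euclidean_space n) (\<phi> ` U)) \<phi>) \<and>
     (\<forall>(U, \<phi>)\<in>A. \<forall>(V, \<psi>)\<in>A. \<forall>j<n.
        smooth_on_Rn n (\<phi> ` (U \<inter> V)) (\<lambda>y. \<psi> (inv_into U \<phi> y) j))"

text \<open>Smoothness on an open set \<open>W\<close>; the values of \<open>f\<close> outside \<open>W\<close> are irrelevant.\<close>

definition smooth_fun ::
    "nat \<Rightarrow> 'm chart set \<Rightarrow> 'm set \<Rightarrow> ('m \<Rightarrow> 'b::real_normed_vector) \<Rightarrow> bool" where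
  "smooth_fun n A W f \<longleftrightarrow>
     (\<forall>(U, \<phi>)\<in>A. smooth_on_Rn n (\<phi> ` (U \<inter> W)) (\<lambda>y. f (inv_into U \<phi> y)))"

definition chart_partial :: "'m chart \<Rightarrow> nat list \<Rightarrow> ('m \<Rightarrow> complex) \<Rightarrow> 'm \<Rightarrow> complex" where
  "chart_partial c I f x = iter_partial I (\<lambda>y. f (inv_into (fst c) (snd c) y)) (snd c x)"


section \<open>Poisson structures and star products\<close>

definition poisson_bracket ::
    "nat \<Rightarrow> 'm chart set \<Rightarrow> (('m \<Rightarrow> complex) \<Rightarrow> ('m \<Rightarrow> complex) \<Rightarrow> 'm \<Rightarrow> complex) \<Rightarrow> bool" where
  "poisson_bracket n A P \<longleftrightarrow> (let S = {f. smooth_fun n A UNIV f} in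
     (\<forall>f\<in>S. \<forall>g\<in>S. P f g \<in> S) \<and>
     (\<forall>f\<in>S. \<forall>g\<in>S. \<forall>h\<in>S. \<forall>a b. P (\<lambda>x. a * f x + b * g x) h = (\<lambda>x. a * P f h x + b * P g h x)) \<and>
     (\<forall>f\<in>S. \<forall>g\<in>S. P f g = (\<lambda>x. - P g f x)) \<and>
     (\<forall>f\<in>S. \<forall>g\<in>S. \<forall>h\<in>S. P f (\<lambda>x. g x * h x) = (\<lambda>x. P f g x * h x + g x * P f h x)) \<and>
     (\<forall>f\<in>S. \<forall>g\<in>S. \<forall>h\<in>S. \<forall>x. P f (P g h) x + P g (P h f) x + P h (P f g) x = 0) \<and>
     (\<forall>f\<in>S. \<forall>g\<in>S. P (\<lambda>x. cnj (f x)) (\<lambda>x. cnj (g x)) = (\<lambda>x. cnj (P f g x))))"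

text \<open>
  A bidifferential operator is, in every chart, a finite sum of terms
  \<open>a\<^bsub>IJ\<^esub> \<cdot> \<partial>\<^sub>I f \<cdot> \<partial>\<^sub>J g\<close> with smooth coefficients. Derivatives are indexed by lists of coordinate
  indices rather than multi-indices; the redundancy is harmless since partial derivatives commute.
  The value \<open>D f g x\<close> is prescribed as soon as \<open>f\<close> and \<open>g\<close> are smooth on some neighbourhood \<open>W\<close> of \<open>x\<close>.
  Thus \<open>D\<close> stands at once for the operator on the globally defined smooth functions and for its
  restrictions to all open subsets.
\<close>

definition bidifferential ::
    "nat \<Rightarrow> 'm::topological_space chart set \<Rightarrow>
      (('m \<Rightarrow> complex) \<Rightarrow> ('m \<Rightarrow> complex) \<Rightarrow> 'm \<Rightarrow> complex) \<Rightarrow> bool" where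
  "bidifferential n A D \<longleftrightarrow> (\<forall>(U, \<phi>)\<in>A. \<exists>N. \<exists>a.
     (\<forall>I J. smooth_fun n A U (a I J)) \<and>
     (\<forall>W f g. open W \<and> W \<subseteq> U \<and> smooth_fun n A W f \<and> smooth_fun n A W g \<longrightarrow>
        (\<forall>x\<in>W. D f g x =
           (\<Sum>I\<in>{I \<in> lists {..<n}. length I \<le> N}. \<Sum>J\<in>{J \<in> lists {..<n}. length J \<le> N}.
              a I J x * chart_partial (U, \<phi>) I f x * chart_partial (U, \<phi>) J g x))))"

text \<open>A formal power series \<open>f = \<Sum>\<^sub>r \<lambda>\<^sup>r f\<^sub>r\<close> of functions is its sequence of coefficients.\<close>

type_synonym 'm fseries = "nat \<Rightarrow> 'm \<Rightarrow> complex"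

definition formal_functions :: "nat \<Rightarrow> 'm chart set \<Rightarrow> 'm set \<Rightarrow> 'm fseries set" where
  "formal_functions n A W = {f. \<forall>r. smooth_fun n A W (f r)}"

definition const_series :: "('m \<Rightarrow> complex) \<Rightarrow> 'm fseries" where
  "const_series f = (\<lambda>r. if r = 0 then f else (\<lambda>_. 0))"

definition conj_series :: "'m fseries \<Rightarrow> 'm fseries" where
  "conj_series f = (\<lambda>r x. cnj (f r x))"

text \<open>The product \<open>f \<star> g = \<Sum>\<^sub>r \<lambda>\<^sup>r C\<^sub>r(f, g)\<close>, with the \<open>C\<^sub>r\<close> extended \<open>\<complex>[[\<lambda>]]\<close>-bilinearly.\<close>

definition star ::
    "(nat \<Rightarrow> ('m \<Rightarrow> complex) \<Rightarrow> ('m \<Rightarrow> complex) \<Rightarrow> 'm \<Rightarrow> complex) \<Rightarrow>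
      'm fseries \<Rightarrow> 'm fseries \<Rightarrow> 'm fseries" where
  "star C f g = (\<lambda>r x. \<Sum>p\<le>r. \<Sum>q\<le>r - p. C p (f q) (g (r - p - q)) x)"

definition star_product ::
    "nat \<Rightarrow> 'm::topological_space chart set \<Rightarrow>
      (('m \<Rightarrow> complex) \<Rightarrow> ('m \<Rightarrow> complex) \<Rightarrow> 'm \<Rightarrow> complex) \<Rightarrow>
      (nat \<Rightarrow> ('m \<Rightarrow> complex) \<Rightarrow> ('m \<Rightarrow> complex) \<Rightarrow> 'm \<Rightarrow> complex) \<Rightarrow> bool" where
  "star_product n A P C \<longleftrightarrow>
     (\<forall>r. bidifferential n A (C r)) \<and>
     (\<forall>f g. smooth_fun n A UNIV f \<and> smooth_fun n A UNIV g \<longrightarrow>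
        C 0 f g = (\<lambda>x. f x * g x) \<and>
        (\<forall>x. C 1 f g x - C 1 g f x = \<i> * P f g x)) \<and>
     (\<forall>f\<in>formal_functions n A UNIV. \<forall>g\<in>formal_functions n A UNIV. \<forall>h\<in>formal_functions n A UNIV.
        star C (star C f g) h = star C f (star C g h)) \<and>
     (\<forall>f\<in>formal_functions n A UNIV.
        star C (const_series (\<lambda>_. 1)) f = f \<and> star C f (const_series (\<lambda>_. 1)) = f)"

definition hermitian_star_product ::
    "nat \<Rightarrow> 'm::topological_space chart set \<Rightarrow>
      (('m \<Rightarrow> complex) \<Rightarrow> ('m \<Rightarrow> complex) \<Rightarrow> 'm \<Rightarrow> complex) \<Rightarrow>
      (nat \<Rightarrow> ('m \<Rightarrow> complex) \<Rightarrow> ('m \<Rightarrow> complex) \<Rightarrow> 'm \<Rightarrow> complex) \<Rightarrow> bool" where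
  "hermitian_star_product n A P C \<longleftrightarrow>
     star_product n A P C \<and>
     (\<forall>f\<in>formal_functions n A UNIV. \<forall>g\<in>formal_functions n A UNIV.
        conj_series (star C f g) = star C (conj_series g) (conj_series f))"

definition star_algebra ::
    "nat \<Rightarrow> 'm chart set \<Rightarrow>
      (nat \<Rightarrow> ('m \<Rightarrow> complex) \<Rightarrow> ('m \<Rightarrow> complex) \<Rightarrow> 'm \<Rightarrow> complex) \<Rightarrow> 'm fseries ring" where
  "star_algebra n A C =
     \<lparr>carrier = formal_functions n A UNIV, mult = star C, one = const_series (\<lambda>_. 1),
      zero = (\<lambda>r x. 0), add = (\<lambda>f g r x. f r x + g r x)\<rparr>"


section \<open>Complex vector bundles\<close>

text \<open>
  The fibre over \<open>x\<close> is a subspace \<open>E x\<close> of a complex vector space with scalar multiplication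
  \<open>scl\<close>. The ambient space carries no topology and fibres over different points need not be related
  in any way (it may be the direct sum of all fibres), so this is only a way of writing down a
  family of vector spaces; the total space is \<open>Sigma UNIV E\<close>. The smooth structure is given by a
  bundle atlas \<open>F\<close> of local frames, i.e. of local trivializations, with smooth changes of frame.
\<close>

definition frame_on ::
    "(complex \<Rightarrow> 'v::ab_group_add \<Rightarrow> 'v) \<Rightarrow> ('m \<Rightarrow> 'v set) \<Rightarrow> nat \<Rightarrow> 'm set \<Rightarrow>
      (nat \<Rightarrow> 'm \<Rightarrow> 'v) \<Rightarrow> bool" where
  "frame_on scl E k U e \<longleftrightarrow>
     (\<forall>x\<in>U. inj_on (\<lambda>i. e i x) {..<k} \<and>
        \<not> module.dependent scl ((\<lambda>i. e i x) ` {..<k}) \<and>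
        module.span scl ((\<lambda>i. e i x) ` {..<k}) = E x)"

definition frame_component ::
    "(complex \<Rightarrow> 'v::ab_group_add \<Rightarrow> 'v) \<Rightarrow> nat \<Rightarrow> (nat \<Rightarrow> 'm \<Rightarrow> 'v) \<Rightarrow>
      ('m \<Rightarrow> 'v) \<Rightarrow> nat \<Rightarrow> 'm \<Rightarrow> complex" where
  "frame_component scl k e s i x =
     module.representation scl ((\<lambda>j. e j x) ` {..<k}) (s x) (e i x)"

definition vector_bundle ::
    "nat \<Rightarrow> 'm::topological_space chart set \<Rightarrow> (complex \<Rightarrow> 'v::ab_group_add \<Rightarrow> 'v) \<Rightarrow>
      ('m \<Rightarrow> 'v set) \<Rightarrow> nat \<Rightarrow> ('m set \<times> (nat \<Rightarrow> 'm \<Rightarrow> 'v)) set \<Rightarrow> bool" where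
  "vector_bundle n A scl E k F \<longleftrightarrow>
     vector_space scl \<and>
     (\<Union>(U, e)\<in>F. U) = UNIV \<and>
     (\<forall>(U, e)\<in>F. open U \<and> frame_on scl E k U e) \<and>
     (\<forall>(U, e)\<in>F. \<forall>(V, e')\<in>F. \<forall>i<k. \<forall>j<k.
        smooth_fun n A (U \<inter> V) (frame_component scl k e (e' j) i))"

definition smooth_section ::
    "nat \<Rightarrow> 'm chart set \<Rightarrow> (complex \<Rightarrow> 'v::ab_group_add \<Rightarrow> 'v) \<Rightarrow>
      ('m \<Rightarrow> 'v set) \<Rightarrow> nat \<Rightarrow> ('m set \<times> (nat \<Rightarrow> 'm \<Rightarrow> 'v)) set \<Rightarrow> 'm set \<Rightarrow> ('m \<Rightarrow> 'v) \<Rightarrow> bool" where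
  "smooth_section n A scl E k F W s \<longleftrightarrow>
     (\<forall>x\<in>W. s x \<in> E x) \<and>
     (\<forall>(U, e)\<in>F. \<forall>i<k. smooth_fun n A (U \<inter> W) (frame_component scl k e s i))"

definition smooth_frame ::
    "nat \<Rightarrow> 'm chart set \<Rightarrow> (complex \<Rightarrow> 'v::ab_group_add \<Rightarrow> 'v) \<Rightarrow>
      ('m \<Rightarrow> 'v set) \<Rightarrow> nat \<Rightarrow> ('m set \<times> (nat \<Rightarrow> 'm \<Rightarrow> 'v)) set \<Rightarrow> 'm set \<Rightarrow>
      (nat \<Rightarrow> 'm \<Rightarrow> 'v) \<Rightarrow> bool" where
  "smooth_frame n A scl E k F U e \<longleftrightarrow>
     frame_on scl E k U e \<and> (\<forall>i<k. smooth_section n A scl E k F U (e i))"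

text \<open>Fibre metrics are linear in the second argument.\<close>

definition hermitian_metric ::
    "nat \<Rightarrow> 'm chart set \<Rightarrow> (complex \<Rightarrow> 'v::ab_group_add \<Rightarrow> 'v) \<Rightarrow>
      ('m \<Rightarrow> 'v set) \<Rightarrow> nat \<Rightarrow> ('m set \<times> (nat \<Rightarrow> 'm \<Rightarrow> 'v)) set \<Rightarrow>
      ('m \<Rightarrow> 'v \<Rightarrow> 'v \<Rightarrow> complex) \<Rightarrow> bool" where
  "hermitian_metric n A scl E k F h \<longleftrightarrow>
     (\<forall>x. \<forall>u\<in>E x. \<forall>v\<in>E x. \<forall>w\<in>E x. \<forall>a b.
        h x u (scl a v + scl b w) = a * h x u v + b * h x u w) \<and>
     (\<forall>x. \<forall>u\<in>E x. \<forall>v\<in>E x. h x u v = cnj (h x v u)) \<and>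
     (\<forall>x. \<forall>v\<in>E x. v \<noteq> 0 \<longrightarrow> 0 < Re (h x v v)) \<and>
     (\<forall>(U, e)\<in>F. \<forall>i<k. \<forall>j<k. smooth_fun n A U (\<lambda>x. h x (e i x) (e j x)))"

definition formal_sections ::
    "nat \<Rightarrow> 'm chart set \<Rightarrow> (complex \<Rightarrow> 'v::ab_group_add \<Rightarrow> 'v) \<Rightarrow>
      ('m \<Rightarrow> 'v set) \<Rightarrow> nat \<Rightarrow> ('m set \<times> (nat \<Rightarrow> 'm \<Rightarrow> 'v)) set \<Rightarrow> (nat \<Rightarrow> 'm \<Rightarrow> 'v) set" where
  "formal_sections n A scl E k F = {s. \<forall>r. smooth_section n A scl E k F UNIV (s r)}"


section \<open>Deformed transition matrices and the deformed module structure\<close>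

text \<open>Matrices and vectors of formal series; only the entries with indices below \<open>k\<close> matter.\<close>

definition mat_star ::
    "(nat \<Rightarrow> ('m \<Rightarrow> complex) \<Rightarrow> ('m \<Rightarrow> complex) \<Rightarrow> 'm \<Rightarrow> complex) \<Rightarrow> nat \<Rightarrow>
      (nat \<Rightarrow> nat \<Rightarrow> 'm fseries) \<Rightarrow> (nat \<Rightarrow> nat \<Rightarrow> 'm fseries) \<Rightarrow> nat \<Rightarrow> nat \<Rightarrow> 'm fseries" where
  "mat_star C k X Y = (\<lambda>i j r x. \<Sum>l<k. star C (X i l) (Y l j) r x)"

definition mat_vec_star ::
    "(nat \<Rightarrow> ('m \<Rightarrow> complex) \<Rightarrow> ('m \<Rightarrow> complex) \<Rightarrow> 'm \<Rightarrow> complex) \<Rightarrow> nat \<Rightarrow>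
      (nat \<Rightarrow> nat \<Rightarrow> 'm fseries) \<Rightarrow> (nat \<Rightarrow> 'm fseries) \<Rightarrow> nat \<Rightarrow> 'm fseries" where
  "mat_vec_star C k X v = (\<lambda>i r x. \<Sum>l<k. star C (X i l) (v l) r x)"

definition id_mat :: "nat \<Rightarrow> nat \<Rightarrow> 'm fseries" where
  "id_mat i j = const_series (\<lambda>_. if i = j then 1 else 0)"

definition mat_adjoint :: "(nat \<Rightarrow> nat \<Rightarrow> 'm fseries) \<Rightarrow> nat \<Rightarrow> nat \<Rightarrow> 'm fseries" where
  "mat_adjoint X = (\<lambda>i j. conj_series (X j i))"

definition mat_eq_on ::
    "nat \<Rightarrow> 'm set \<Rightarrow> (nat \<Rightarrow> nat \<Rightarrow> 'm fseries) \<Rightarrow> (nat \<Rightarrow> nat \<Rightarrow> 'm fseries) \<Rightarrow> bool" where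
  "mat_eq_on k W X Y \<longleftrightarrow> (\<forall>i<k. \<forall>j<k. \<forall>r. \<forall>x\<in>W. X i j r x = Y i j r x)"

definition transition_matrices ::
    "(complex \<Rightarrow> 'v::ab_group_add \<Rightarrow> 'v) \<Rightarrow> nat \<Rightarrow> nat \<Rightarrow> (nat \<Rightarrow> 'm set) \<Rightarrow>
      (nat \<Rightarrow> nat \<Rightarrow> 'm \<Rightarrow> 'v) \<Rightarrow> (nat \<Rightarrow> nat \<Rightarrow> nat \<Rightarrow> nat \<Rightarrow> 'm \<Rightarrow> complex) \<Rightarrow> bool" where
  "transition_matrices scl k m U e \<phi> \<longleftrightarrow>
     (\<forall>\<alpha>\<in>{1..m}. \<forall>\<beta>\<in>{1..m}. \<forall>x\<in>U \<alpha> \<inter> U \<beta>. \<forall>j<k.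
        e \<beta> j x = (\<Sum>i<k. scl (\<phi> \<alpha> \<beta> i j x) (e \<alpha> i x)))"

definition deformed_transition_matrices ::
    "nat \<Rightarrow> 'm chart set \<Rightarrow>
      (nat \<Rightarrow> ('m \<Rightarrow> complex) \<Rightarrow> ('m \<Rightarrow> complex) \<Rightarrow> 'm \<Rightarrow> complex) \<Rightarrow> nat \<Rightarrow> nat \<Rightarrow> (nat \<Rightarrow> 'm set) \<Rightarrow>
      (nat \<Rightarrow> nat \<Rightarrow> nat \<Rightarrow> nat \<Rightarrow> 'm \<Rightarrow> complex) \<Rightarrow>
      (nat \<Rightarrow> nat \<Rightarrow> nat \<Rightarrow> nat \<Rightarrow> 'm fseries) \<Rightarrow> bool" where
  "deformed_transition_matrices n A C k m U \<phi> \<Phi> \<longleftrightarrow>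
     (\<forall>\<alpha>\<in>{1..m}. \<forall>\<beta>\<in>{1..m}.
        (\<forall>i<k. \<forall>j<k. \<Phi> \<alpha> \<beta> i j \<in> formal_functions n A (U \<alpha> \<inter> U \<beta>) \<and>
           (\<forall>x\<in>U \<alpha> \<inter> U \<beta>. \<Phi> \<alpha> \<beta> i j 0 x = \<phi> \<alpha> \<beta> i j x)) \<and>
        mat_eq_on k (U \<alpha> \<inter> U \<beta>) (mat_star C k (\<Phi> \<alpha> \<beta>) (\<Phi> \<beta> \<alpha>)) id_mat \<and>
        mat_eq_on k (U \<alpha> \<inter> U \<beta>) (mat_adjoint (\<Phi> \<alpha> \<beta>)) (\<Phi> \<beta> \<alpha>)) \<and>
     (\<forall>\<alpha>\<in>{1..m}. \<forall>\<beta>\<in>{1..m}. \<forall>\<gamma>\<in>{1..m}.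
        mat_eq_on k (U \<alpha> \<inter> U \<beta> \<inter> U \<gamma>)
          (mat_star C k (mat_star C k (\<Phi> \<alpha> \<beta>) (\<Phi> \<beta> \<gamma>)) (\<Phi> \<gamma> \<alpha>)) id_mat)"

definition smooth_partition_of_unity ::
    "nat \<Rightarrow> 'm::topological_space chart set \<Rightarrow> nat \<Rightarrow> (nat \<Rightarrow> 'm set) \<Rightarrow> (nat \<Rightarrow> 'm \<Rightarrow> real) \<Rightarrow> bool" where
  "smooth_partition_of_unity n A m U \<rho> \<longleftrightarrow>
     (\<forall>\<alpha>\<in>{1..m}. smooth_fun n A UNIV (\<rho> \<alpha>) \<and> (\<forall>x. 0 \<le> \<rho> \<alpha> x) \<and>
        closure {x. \<rho> \<alpha> x \<noteq> 0} \<subseteq> U \<alpha>) \<and>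
     (\<forall>x. (\<Sum>\<alpha>\<in>{1..m}. \<rho> \<alpha> x) = 1)"

text \<open>
  \<open>\<^bold>s\<^sub>\<alpha> = \<Sum>\<^sub>\<beta> \<Phi>\<^sub>\<alpha>\<^sub>\<beta> \<star> \<rho>\<^sub>\<beta> \<star> s\<^sub>\<beta>\<close> on \<open>U \<alpha>\<close>. The summand \<open>\<beta>\<close> is defined on \<open>U \<alpha> \<inter> U \<beta>\<close> and is extended
  by zero to \<open>U \<alpha>\<close>, hence at \<open>x\<close> the sum runs over the \<open>\<beta>\<close> with \<open>x \<in> U \<beta>\<close>.
\<close>

definition deformed_component ::
    "(nat \<Rightarrow> ('m \<Rightarrow> complex) \<Rightarrow> ('m \<Rightarrow> complex) \<Rightarrow> 'm \<Rightarrow> complex) \<Rightarrow>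
      (complex \<Rightarrow> 'v::ab_group_add \<Rightarrow> 'v) \<Rightarrow> nat \<Rightarrow> nat \<Rightarrow> (nat \<Rightarrow> 'm set) \<Rightarrow>
      (nat \<Rightarrow> nat \<Rightarrow> 'm \<Rightarrow> 'v) \<Rightarrow> (nat \<Rightarrow> nat \<Rightarrow> nat \<Rightarrow> nat \<Rightarrow> 'm fseries) \<Rightarrow> (nat \<Rightarrow> 'm \<Rightarrow> real) \<Rightarrow>
      (nat \<Rightarrow> 'm \<Rightarrow> 'v) \<Rightarrow> nat \<Rightarrow> nat \<Rightarrow> 'm fseries" where
  "deformed_component C scl k m U e \<Phi> \<rho> s \<alpha> i = (\<lambda>r x.
     \<Sum>\<beta>\<in>{\<beta>\<in>{1..m}. x \<in> U \<beta>}.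
       mat_vec_star C k (\<Phi> \<alpha> \<beta>)
         (\<lambda>l. star C (const_series (\<lambda>x. complex_of_real (\<rho> \<beta> x)))
                (\<lambda>q. frame_component scl k (e \<beta>) (s q) l)) i r x)"

definition bullet ::
    "nat \<Rightarrow> 'm chart set \<Rightarrow> (nat \<Rightarrow> ('m \<Rightarrow> complex) \<Rightarrow> ('m \<Rightarrow> complex) \<Rightarrow> 'm \<Rightarrow> complex) \<Rightarrow>
      (complex \<Rightarrow> 'v::ab_group_add \<Rightarrow> 'v) \<Rightarrow> ('m \<Rightarrow> 'v set) \<Rightarrow> nat \<Rightarrow>
      ('m set \<times> (nat \<Rightarrow> 'm \<Rightarrow> 'v)) set \<Rightarrow> nat \<Rightarrow> (nat \<Rightarrow> 'm set) \<Rightarrow>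
      (nat \<Rightarrow> nat \<Rightarrow> 'm \<Rightarrow> 'v) \<Rightarrow> (nat \<Rightarrow> nat \<Rightarrow> nat \<Rightarrow> nat \<Rightarrow> 'm fseries) \<Rightarrow> (nat \<Rightarrow> 'm \<Rightarrow> real) \<Rightarrow>
      (nat \<Rightarrow> 'm \<Rightarrow> 'v) \<Rightarrow> 'm fseries \<Rightarrow> (nat \<Rightarrow> 'm \<Rightarrow> 'v)" where
  "bullet n A C scl E k F m U e \<Phi> \<rho> s f =
     (THE t. t \<in> formal_sections n A scl E k F \<and>
        (\<forall>\<alpha>\<in>{1..m}. \<forall>i<k. \<forall>r. \<forall>x\<in>U \<alpha>.
           deformed_component C scl k m U e \<Phi> \<rho> t \<alpha> i r x =
           star C (deformed_component C scl k m U e \<Phi> \<rho> s \<alpha> i) f r x))"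

text \<open>
  Right modules reuse the record type of left modules: \<open>smult M a x\<close> denotes \<open>x \<bullet> a\<close>.
  The fields \<open>mult\<close> and \<open>one\<close> of that record are not used.
\<close>

definition deformed_sections ::
    "nat \<Rightarrow> 'm chart set \<Rightarrow> (nat \<Rightarrow> ('m \<Rightarrow> complex) \<Rightarrow> ('m \<Rightarrow> complex) \<Rightarrow> 'm \<Rightarrow> complex) \<Rightarrow>
      (complex \<Rightarrow> 'v::ab_group_add \<Rightarrow> 'v) \<Rightarrow> ('m \<Rightarrow> 'v set) \<Rightarrow> nat \<Rightarrow>
      ('m set \<times> (nat \<Rightarrow> 'm \<Rightarrow> 'v)) set \<Rightarrow> nat \<Rightarrow> (nat \<Rightarrow> 'm set) \<Rightarrow>
      (nat \<Rightarrow> nat \<Rightarrow> 'm \<Rightarrow> 'v) \<Rightarrow> (nat \<Rightarrow> nat \<Rightarrow> nat \<Rightarrow> nat \<Rightarrow> 'm fseries) \<Rightarrow> (nat \<Rightarrow> 'm \<Rightarrow> real) \<Rightarrow>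
      ('m fseries, nat \<Rightarrow> 'm \<Rightarrow> 'v) module" where
  "deformed_sections n A C scl E k F m U e \<Phi> \<rho> =
     \<lparr>carrier = formal_sections n A scl E k F, mult = undefined, one = undefined,
      zero = (\<lambda>r x. 0), add = (\<lambda>s t r x. s r x + t r x),
      smult = (\<lambda>f s. bullet n A C scl E k F m U e \<Phi> \<rho> s f)\<rparr>"


section \<open>Finitely generated projective right modules\<close>

locale right_module = R?: ring R + M?: abelian_group M
  for R :: "('a, 'r) ring_scheme" and M :: "('a, 'b, 's) module_scheme" +
  assumes act_closed: "a \<in> carrier R \<Longrightarrow> x \<in> carrier M \<Longrightarrow> smult M a x \<in> carrier M"
    and act_add_scalar: "a \<in> carrier R \<Longrightarrow> b \<in> carrier R \<Longrightarrow> x \<in> carrier M \<Longrightarrow>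
      smult M (add R a b) x = add M (smult M a x) (smult M b x)"
    and act_add_vector: "a \<in> carrier R \<Longrightarrow> x \<in> carrier M \<Longrightarrow> y \<in> carrier M \<Longrightarrow>
      smult M a (add M x y) = add M (smult M a x) (smult M a y)"
    and act_assoc: "a \<in> carrier R \<Longrightarrow> b \<in> carrier R \<Longrightarrow> x \<in> carrier M \<Longrightarrow>
      smult M b (smult M a x) = smult M (mult R a b) x"
    and act_one: "x \<in> carrier M \<Longrightarrow> smult M (one R) x = x"

definition finitely_generated_module ::
    "('a, 'r) ring_scheme \<Rightarrow> ('a, 'b, 's) module_scheme \<Rightarrow> bool" where
  "finitely_generated_module R M \<longleftrightarrow>
     (\<exists>S. finite S \<and> S \<subseteq> carrier M \<and>
        (\<forall>x\<in>carrier M. \<exists>c\<in>S \<rightarrow> carrier R. x = finsum M (\<lambda>s. smult M (c s) s) S))"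

definition module_homs ::
    "('a, 'r) ring_scheme \<Rightarrow> ('a, 'b, 's) module_scheme \<Rightarrow> ('a, 'c, 't) module_scheme \<Rightarrow> ('b \<Rightarrow> 'c) set" where
  "module_homs R M N =
     {f \<in> carrier M \<rightarrow> carrier N.
        (\<forall>x\<in>carrier M. \<forall>y\<in>carrier M. f (add M x y) = add N (f x) (f y)) \<and>
        (\<forall>a\<in>carrier R. \<forall>x\<in>carrier M. f (smult M a x) = smult N a (f x))}"

text \<open>
  The lifting property: every homomorphism from \<open>M\<close> lifts along every epimorphism \<open>g : N \<rightarrow> L\<close>. The
  types of the elements of \<open>N\<close> and \<open>L\<close> are parameters, since HOL cannot quantify over types inside a
  definition; with free type variables a theorem asserts the property for all modules \<open>N\<close>, \<open>L\<close>.
\<close>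

definition projective_module ::
    "'x itself \<Rightarrow> 'y itself \<Rightarrow> ('a, 'r) ring_scheme \<Rightarrow> ('a, 'b, 's) module_scheme \<Rightarrow> bool" where
  "projective_module _ _ R M \<longleftrightarrow>
     (\<forall>(N :: ('a, 'x) module) (L :: ('a, 'y) module) g f.
        right_module R N \<and> right_module R L \<and>
        g \<in> module_homs R N L \<and> g ` carrier N = carrier L \<and> f \<in> module_homs R M L \<longrightarrow>
        (\<exists>h\<in>module_homs R M N. \<forall>x\<in>carrier M. g (h x) = f x))"

end

theory Submission
  imports Defs "Jordan_Normal_Form.Determinant"
begin

text \<open>
  Formal sections are compared with collections \<open>b = (b\<^sub>\<alpha>)\<close> satisfying \<open>\<Phi>\<^sub>\<alpha>\<^sub>\<beta> \<star> b\<^sub>\<beta> = b\<^sub>\<alpha>\<close>, on which the algebra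
  acts from the right by componentwise multiplication. The map \<open>s \<mapsto> (\<^bold>s\<^sub>\<alpha>)\<close> is linear over formal power
  series and reduces to the classical components in order zero. Every map with these properties is a
  bijection onto the compatible collections (\<open>deforms_components_inj\<close>, \<open>deforms_components_surj\<close>): the
  coefficient of order zero determines the classical section \<open>s 0\<close>, and after subtracting its image
  one can divide by the deformation parameter and continue. Hence \<open>\<bullet>\<close> is well defined, and the module
  laws for sections are the laws of \<open>\<star>\<close> (\<open>sections_right_module\<close>).

  For the other two claims it suffices to find a finite dual basis (locale \<open>dual_basis\<close>). The partition
  of unity yields functions \<open>u\<^sub>\<beta>\<close>, \<open>v\<^sub>\<beta>\<close> with support in \<open>U \<beta>\<close> and \<open>\<Sum>\<^sub>\<beta> u\<^sub>\<beta> v\<^sub>\<beta> = 1\<close> (\<open>rho_squares\<close>). The maps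
  \<open>b \<mapsto> (v\<^sub>\<beta> \<star> b\<^sub>\<beta>)\<close> into a free module of rank \<open>m k\<close> and \<open>(g\<^sub>\<beta>) \<mapsto> (\<Sum>\<^sub>\<beta> \<Phi>\<^sub>\<alpha>\<^sub>\<beta> \<star> u\<^sub>\<beta> \<star> g\<^sub>\<beta>)\<close> back to compatible
  collections are right linear. Their composition is the identity only in order zero, but that is
  enough: composed with \<open>s \<mapsto> (\<^bold>s\<^sub>\<alpha>)\<close> it again has the properties above
  (\<open>glue_cut_cut_deforms_components\<close>), so it is invertible, and the module of sections is a direct summand
  of the free module (\<open>sections_dual_basis\<close>).

  These arguments multiply functions that are only defined on the sets \<open>U \<alpha>\<close> and their intersections,
  whereas the laws of \<open>\<star>\<close> are laws for global functions. Bidifferential operators are local, and by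
  means of bump functions every function agrees near a given point with a global one
  (\<open>formal_functions_extend\<close>), which gives associativity and the unit law on open sets. Bump functions,
  and the smoothness of the components of a section in a given frame (\<open>comp_smooth\<close>), rest on closure
  properties of smooth functions that are proved in charts from the rules of differentiation.
\<close>


section \<open>Calculus of smooth functions on open sets of the model space\<close>

lemma eventually_fun_upd_mem:
  assumes "openin (Euclidean_space n) W" "y \<in> W" "i < n"
  shows "\<forall>\<^sub>F t in nhds (y i). y(i := t) \<in> W"
proof -
  obtain T where T: "open T" "W = T \<inter> {x. \<forall>i\<ge>n. x i = 0}"
    using assms(1) by (auto simp: Euclidean_space_def openin_subtopology
        euclidean_product_topology)
  have "continuous_on UNIV (\<lambda>t. y(i := t))"
  proof (rule continuous_on_coordinatewise_then_product)
    show "continuous_on UNIV (\<lambda>t. (y(i := t)) j)" for j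
      by (cases "j = i") auto
  qed
  then have "open ((\<lambda>t. y(i := t)) -` T)"
    using open_vimage[OF T(1)] by blast
  then have "\<forall>\<^sub>F t in nhds (y i). t \<in> (\<lambda>t. y(i := t)) -` T"
    by (rule eventually_nhds_in_open) (use assms T in auto)
  moreover have "(y(i := t)) j = 0" if "j \<ge> n" for t j
    using that assms T by auto
  ultimately show ?thesis
    by (elim eventually_mono) (auto simp: T(2) assms(3))
qed

definition has_partial ::
    "nat \<Rightarrow> ((nat \<Rightarrow> real) \<Rightarrow> 'b::real_normed_vector) \<Rightarrow> 'b \<Rightarrow> (nat \<Rightarrow> real) \<Rightarrow> bool" where
  "has_partial i f d y \<longleftrightarrow> ((\<lambda>t. f (y(i := t))) has_vector_derivative d) (at (y i))"

lemma has_partial_imp_partial_deriv: "has_partial i f d y \<Longrightarrow> partial_deriv i f y = d"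
  unfolding has_partial_def partial_deriv_def by (rule vector_derivative_at)

lemma has_partial_partial_deriv:
  "(\<lambda>t. f (y(i := t))) differentiable (at (y i)) \<Longrightarrow> has_partial i f (partial_deriv i f y) y"
  unfolding has_partial_def partial_deriv_def by (simp add: vector_derivative_works)

lemma has_partial_imp_differentiable:
  "has_partial i f d y \<Longrightarrow> (\<lambda>t. f (y(i := t))) differentiable (at (y i))"
  unfolding has_partial_def by (rule differentiableI_vector)

lemma has_partial_cong:
  assumes "openin (Euclidean_space n) W" "y \<in> W" "i < n" "\<And>z. z \<in> W \<Longrightarrow> f z = g z"
  shows "has_partial i f d y \<longleftrightarrow> has_partial i g d y"
  unfolding has_partial_def
proof (rule has_vector_derivative_cong_ev)
  show "\<forall>\<^sub>F t in nhds (y i). t \<in> UNIV \<longrightarrow> f (y(i := t)) = g (y(i := t))"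
    using eventually_fun_upd_mem[OF assms(1-3)] by (rule eventually_mono) (simp add: assms(4))
qed (simp add: assms(2,4))

lemma partial_deriv_cong:
  assumes "openin (Euclidean_space n) W" "y \<in> W" "i < n" "\<And>z. z \<in> W \<Longrightarrow> f z = g z"
  shows "partial_deriv i f y = partial_deriv i g y"
  using has_partial_cong[OF assms(1-3), of f g] assms(4)
  unfolding partial_deriv_def has_partial_def vector_derivative_def by simp

lemma iter_partial_Cons: "iter_partial (i # I) f = partial_deriv i (iter_partial I f)"
  by (simp add: iter_partial_def)

lemma iter_partial_Nil: "iter_partial [] f = f"
  by (simp add: iter_partial_def)

lemma iter_partial_cong:
  assumes "openin (Euclidean_space n) W" "I \<in> lists {..<n}" "\<And>z. z \<in> W \<Longrightarrow> f z = g z" "y \<in> W"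
  shows "iter_partial I f y = iter_partial I g y"
  using assms(2,4)
proof (induction I arbitrary: y)
  case (Cons i I)
  then show ?case
    unfolding iter_partial_Cons by (intro partial_deriv_cong[OF assms(1)]) auto
qed (simp add: iter_partial_Nil assms(3))

text \<open>
  \<open>N\<close> times continuously differentiable functions. Recursion on the order turns each rule of
  differentiation into a closure property by a short induction, which the description of
  smoothness by all iterated partial derivatives does not allow directly.
\<close>

primrec Ck ::
    "nat \<Rightarrow> nat \<Rightarrow> (nat \<Rightarrow> real) set \<Rightarrow> ((nat \<Rightarrow> real) \<Rightarrow> 'b::real_normed_vector) \<Rightarrow> bool" where
  "Ck 0 n W f \<longleftrightarrow> continuous_on W f"
| "Ck (Suc N) n W f \<longleftrightarrow> continuous_on W f \<and>
     (\<forall>i<n. (\<forall>y\<in>W. has_partial i f (partial_deriv i f y) y) \<and> Ck N n W (partial_deriv i f))"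

lemma Ck_iter_partial:
  "(\<And>N. Ck N n W f) \<Longrightarrow> I \<in> lists {..<n} \<Longrightarrow> Ck N n W (iter_partial I f)"
proof (induction I arbitrary: N)
  case (Cons i I)
  then have "Ck (Suc N) n W (iter_partial I f)"
    by simp
  then show ?case
    using Cons.prems by (simp add: iter_partial_Cons)
qed (simp add: iter_partial_Nil)

lemma smooth_on_Rn_iff_Ck: "smooth_on_Rn n W f \<longleftrightarrow> (\<forall>N. Ck N n W f)"
proof
  assume f: "smooth_on_Rn n W f"
  have "Ck N n W (iter_partial I f)" if "I \<in> lists {..<n}" for N I
    using that
  proof (induction N arbitrary: I)
    case 0
    then show ?case using f by (simp add: smooth_on_Rn_def)
  next
    case (Suc N)
    have "has_partial i (iter_partial I f) (partial_deriv i (iter_partial I f) y) y"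
      if "i < n" "y \<in> W" for i y
      using f Suc.prems that by (intro has_partial_partial_deriv) (auto simp: smooth_on_Rn_def)
    moreover have "Ck N n W (partial_deriv i (iter_partial I f))" if "i < n" for i
      using Suc.IH[of "i # I"] Suc.prems that by (simp add: iter_partial_Cons)
    ultimately show ?case
      using f Suc.prems by (auto simp: smooth_on_Rn_def)
  qed
  from this[of "[]"] show "\<forall>N. Ck N n W f"
    by (simp add: iter_partial_Nil)
next
  assume f: "\<forall>N. Ck N n W f"
  then have "Ck (Suc 0) n W (iter_partial I f)" if "I \<in> lists {..<n}" for I
    using Ck_iter_partial that by blast
  then show "smooth_on_Rn n W f"
    unfolding smooth_on_Rn_def by (auto dest: has_partial_imp_differentiable)
qed

lemma Ck_cong:
  assumes W: "openin (Euclidean_space n) W" and "\<And>z. z \<in> W \<Longrightarrow> f z = g z" and "Ck N n W f"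
  shows "Ck N n W g"
  using assms(2,3)
proof (induction N arbitrary: f g)
  case 0
  then show ?case using continuous_on_cong[of W W f g] by simp
next
  case (Suc N)
  have "partial_deriv i f y = partial_deriv i g y" if "y \<in> W" "i < n" for i y
    by (rule partial_deriv_cong[OF W that Suc.prems(1)])
  moreover have "has_partial i g d y" if "has_partial i f d y" "y \<in> W" "i < n" for i d y
    using has_partial_cong[OF W that(2,3), of f g d] Suc.prems(1) that(1) by blast
  ultimately show ?case
    using Suc.IH[of "partial_deriv i f" "partial_deriv i g" for i] Suc.prems
      continuous_on_cong[of W W f g] by auto
qed

lemma Ck_SucI:
  assumes "openin (Euclidean_space n) W" "continuous_on W f"
    and "\<And>i y. i < n \<Longrightarrow> y \<in> W \<Longrightarrow> has_partial i f (f' i y) y"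
    and "\<And>i. i < n \<Longrightarrow> Ck N n W (f' i)"
  shows "Ck (Suc N) n W f"
proof -
  have "partial_deriv i f y = f' i y" if "i < n" "y \<in> W" for i y
    by (rule has_partial_imp_partial_deriv) (rule assms(3)[OF that])
  then show ?thesis
    using assms Ck_cong[OF assms(1), of "f' i" "partial_deriv i f" for i] by auto
qed

lemma Ck_SucD: "Ck (Suc N) n W f \<Longrightarrow> Ck N n W f"
proof (induction N arbitrary: f)
  case (Suc N)
  have "Ck N n W (partial_deriv i f)" if "i < n" for i
    using Suc.prems that by (intro Suc.IH) simp
  then show ?case using Suc.prems by simp
qed simp

lemma Ck_const:
  assumes "openin (Euclidean_space n) W" shows "Ck N n W (\<lambda>_. c)"
proof (induction N arbitrary: c)
  case (Suc N)
  show ?case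
    by (rule Ck_SucI[OF assms, where f' = "\<lambda>_ _. 0"]) (auto simp: has_partial_def Suc)
qed simp

lemma Ck_add:
  assumes W: "openin (Euclidean_space n) W"
  shows "Ck N n W f \<Longrightarrow> Ck N n W g \<Longrightarrow> Ck N n W (\<lambda>y. f y + g y)"
proof (induction N arbitrary: f g)
  case (Suc N)
  then show ?case
    by (intro Ck_SucI[OF W, where f' = "\<lambda>i y. partial_deriv i f y + partial_deriv i g y"])
       (auto simp: has_partial_def intro: continuous_on_add has_vector_derivative_add)
qed (auto intro: continuous_on_add)

lemma Ck_mult:
  fixes f g :: "(nat \<Rightarrow> real) \<Rightarrow> 'b::real_normed_algebra"
  assumes W: "openin (Euclidean_space n) W"
  shows "Ck N n W f \<Longrightarrow> Ck N n W g \<Longrightarrow> Ck N n W (\<lambda>y. f y * g y)"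
proof (induction N arbitrary: f g)
  case (Suc N)
  have "has_partial i (\<lambda>y. f y * g y) (f y * partial_deriv i g y + partial_deriv i f y * g y) y"
    if "i < n" "y \<in> W" for i y
    using Suc.prems that has_vector_derivative_mult[of "\<lambda>t. f (y(i := t))" "partial_deriv i f y"
        "y i" UNIV "\<lambda>t. g (y(i := t))" "partial_deriv i g y"]
    by (simp add: has_partial_def)
  moreover have "Ck N n W (\<lambda>y. f y * partial_deriv i g y + partial_deriv i f y * g y)"
    if "i < n" for i
    using Suc.prems that Ck_SucD[OF Suc.prems(1)] Ck_SucD[OF Suc.prems(2)]
    by (intro Ck_add[OF W] Suc.IH) auto
  ultimately show ?case
    using Suc.prems
    by (intro Ck_SucI[OF W, where f' = "\<lambda>i y. f y * partial_deriv i g y + partial_deriv i f y * g y"])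
       (auto intro: continuous_on_mult)
qed (auto intro: continuous_on_mult)

lemma Ck_bounded_linear:
  assumes W: "openin (Euclidean_space n) W" and L: "bounded_linear L"
  shows "Ck N n W f \<Longrightarrow> Ck N n W (\<lambda>y. L (f y))"
proof (induction N arbitrary: f)
  case (Suc N)
  then show ?case
    by (intro Ck_SucI[OF W, where f' = "\<lambda>i y. L (partial_deriv i f y)"])
       (auto simp: has_partial_def
          intro: bounded_linear.continuous_on[OF L] bounded_linear.has_vector_derivative[OF L])
qed (auto intro: bounded_linear.continuous_on[OF L])

lemma Ck_inverse:
  fixes f :: "(nat \<Rightarrow> real) \<Rightarrow> 'b::real_normed_field"
  assumes W: "openin (Euclidean_space n) W" and nz: "\<And>y. y \<in> W \<Longrightarrow> f y \<noteq> 0"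
  shows "Ck N n W f \<Longrightarrow> Ck N n W (\<lambda>y. inverse (f y))"
proof (induction N)
  case 0
  then show ?case using nz by (auto intro: continuous_on_inverse)
next
  case (Suc N)
  let ?f' = "\<lambda>i y. (- 1) * (inverse (f y) * (partial_deriv i f y * inverse (f y)))"
  have "has_partial i (\<lambda>y. inverse (f y)) (?f' i y) y" if "i < n" "y \<in> W" for i y
  proof -
    have "((\<lambda>t. f (y(i := t))) has_derivative (\<lambda>t. t *\<^sub>R partial_deriv i f y)) (at (y i))"
      using Suc.prems that by (simp add: has_partial_def has_vector_derivative_def)
    from Deriv.has_derivative_inverse[OF _ this] nz[OF that(2)] show ?thesis
      by (simp add: has_partial_def has_vector_derivative_def algebra_simps)
  qed
  moreover have "Ck N n W (?f' i)" if "i < n" for i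
    using Suc that Ck_SucD[OF Suc.prems] by (intro Ck_mult[OF W] Ck_const[OF W]) auto
  ultimately show ?case
    using Suc.prems nz by (intro Ck_SucI[OF W, where f' = ?f']) (auto intro: continuous_on_inverse)
qed

text \<open>
  The outer function is given as the member \<open>D j\<close> of a sequence of successive derivatives, so that
  the induction can pass from \<open>D j\<close> to its derivative.
\<close>

lemma Ck_compose_real:
  fixes D :: "nat \<Rightarrow> real \<Rightarrow> real"
  assumes W: "openin (Euclidean_space n) W"
    and D: "\<And>j t. (D j has_real_derivative D (Suc j) t) (at t)"
  shows "Ck N n W f \<Longrightarrow> Ck N n W (\<lambda>y. D j (f y))"
proof (induction N arbitrary: j)
  have cont: "continuous_on UNIV (D j)" for j
    by (rule continuous_at_imp_continuous_on) (use D DERIV_isCont in blast)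
  have comp: "continuous_on W (\<lambda>y. D j (f y))" if "continuous_on W f" for j
    by (rule continuous_on_compose2[OF cont that]) auto
  {
    case 0
    then show ?case using comp by simp
  next
    case (Suc N)
    have "has_partial i (\<lambda>y. D j (f y)) (D (Suc j) (f y) * partial_deriv i f y) y"
      if "i < n" "y \<in> W" for i y
    proof -
      have "((\<lambda>t. f (y(i := t))) has_real_derivative partial_deriv i f y) (at (y i))"
        using Suc.prems that
        by (simp add: has_partial_def has_real_derivative_iff_has_vector_derivative)
      from DERIV_chain2[of "D j", OF _ this, of "D (Suc j) (f y)"] D[of j "f y"] show ?thesis
        by (simp add: has_partial_def has_real_derivative_iff_has_vector_derivative)
    qed
    moreover have "Ck N n W (\<lambda>y. D (Suc j) (f y) * partial_deriv i f y)" if "i < n" for i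
      using Suc that Ck_SucD[OF Suc.prems] by (intro Ck_mult[OF W]) auto
    ultimately show ?case
      using Suc.prems comp
      by (intro Ck_SucI[OF W, where f' = "\<lambda>i y. D (Suc j) (f y) * partial_deriv i f y"]) auto
  }
qed

lemma smooth_on_Rn_subset: "smooth_on_Rn n W f \<Longrightarrow> V \<subseteq> W \<Longrightarrow> smooth_on_Rn n V f"
  unfolding smooth_on_Rn_def by (blast intro: continuous_on_subset)

lemma smooth_on_Rn_Union:
  assumes "\<And>W. W \<in> \<W> \<Longrightarrow> openin (Euclidean_space n) W \<and> smooth_on_Rn n W f"
  shows "smooth_on_Rn n (\<Union>\<W>) f"
proof -
  have sub: "\<Union>\<W> \<subseteq> {x. \<forall>i\<ge>n. x i = 0}"
    using assms openin_subset[of "Euclidean_space n"] by (force simp: topspace_Euclidean_space)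
  have "continuous_on (\<Union>\<W>) g" if g: "\<And>W. W \<in> \<W> \<Longrightarrow> continuous_on W g" 
    for g :: "(nat \<Rightarrow> real) \<Rightarrow> 'a"
  proof -
    have "continuous (at y within \<Union>\<W>) g" if y: "y \<in> W" and WW: "W \<in> \<W>" for y W
    proof -
      obtain T where T: "open T" "W = T \<inter> {x. \<forall>i\<ge>n. x i = 0}"
        using assms[OF WW] by (auto simp: Euclidean_space_def openin_subtopology
            euclidean_product_topology)
      have "at y within \<Union>\<W> = at y within W"
        by (rule at_within_nhd[of y T]) (use T y WW sub in auto)
      then show ?thesis
        using g[OF WW] y by (simp add: continuous_on_eq_continuous_within)
    qed
    then show ?thesis
      by (auto simp: continuous_on_eq_continuous_within)
  qed
  then show ?thesis
    using assms unfolding smooth_on_Rn_def by blast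
qed

section \<open>Smooth functions on manifolds\<close>

locale smooth_manifold =
  fixes n :: nat and A :: "'m::t2_space chart set"
  assumes atlas: "smooth_atlas n A"
begin

lemma
  assumes c: "(U, \<phi>) \<in> A"
  shows chart_open: "open U"
    and chart_homeomorphic: "homeomorphic_map (top_of_set U) (subtopology (Euclidean_space n) (\<phi> ` U)) \<phi>"
    and chart_openin: "openin (Euclidean_space n) (\<phi> ` U)"
    and chart_transition: "(V, \<psi>) \<in> A \<Longrightarrow> j < n \<Longrightarrow>
      smooth_on_Rn n (\<phi> ` (U \<inter> V)) (\<lambda>y. \<psi> (inv_into U \<phi> y) j)"
proof -
  note 1 = atlas[unfolded smooth_atlas_def, THEN conjunct2, THEN conjunct1, THEN bspec, OF c]
  note 2 = atlas[unfolded smooth_atlas_def, THEN conjunct2, THEN conjunct2, THEN bspec, OF c]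
  show "open U" "openin (Euclidean_space n) (\<phi> ` U)"
    "homeomorphic_map (top_of_set U) (subtopology (Euclidean_space n) (\<phi> ` U)) \<phi>"
    using 1 unfolding prod.case by blast+
  show "smooth_on_Rn n (\<phi> ` (U \<inter> V)) (\<lambda>y. \<psi> (inv_into U \<phi> y) j)" if "(V, \<psi>) \<in> A" "j < n"
    using 2[unfolded prod.case, THEN bspec, OF that(1)] that(2) unfolding prod.case by blast
qed

lemma chart_exists: obtains U \<phi> where "(U, \<phi>) \<in> A" "x \<in> U"
proof -
  have "x \<in> (\<Union>(U, \<phi>)\<in>A. U)"
    using atlas[unfolded smooth_atlas_def, THEN conjunct1] by simp
  then show ?thesis using that by auto
qed

lemma chart_inj: "(U, \<phi>) \<in> A \<Longrightarrow> inj_on \<phi> U"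
  using homeomorphic_imp_injective_map[OF chart_homeomorphic] by simp

lemma chart_image_openin:
  assumes "(U, \<phi>) \<in> A" "open W"
  shows "openin (Euclidean_space n) (\<phi> ` (U \<inter> W))"
proof -
  have "openin (top_of_set U) (U \<inter> W)"
    using assms(2) by (simp add: openin_open_Int)
  then have "openin (subtopology (Euclidean_space n) (\<phi> ` U)) (\<phi> ` (U \<inter> W))"
    using homeomorphic_imp_open_map[OF chart_homeomorphic[OF assms(1)]]
    by (simp add: open_map_def)
  then show ?thesis
    using chart_openin[OF assms(1)] by (rule openin_trans_full)
qed

lemma chart_inv_into:
  "(U, \<phi>) \<in> A \<Longrightarrow> y \<in> \<phi> ` (U \<inter> W) \<Longrightarrow> inv_into U \<phi> y \<in> U \<inter> W"
  using chart_inj[of U \<phi>] by auto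

lemma smooth_fun_iff_Ck:
  "smooth_fun n A W f \<longleftrightarrow>
     (\<forall>(U, \<phi>)\<in>A. \<forall>N. Ck N n (\<phi> ` (U \<inter> W)) (\<lambda>y. f (inv_into U \<phi> y)))"
  by (simp add: smooth_fun_def smooth_on_Rn_iff_Ck)

lemma smooth_funI:
  "(\<And>U \<phi> N. (U, \<phi>) \<in> A \<Longrightarrow> Ck N n (\<phi> ` (U \<inter> W)) (\<lambda>y. f (inv_into U \<phi> y))) \<Longrightarrow>
    smooth_fun n A W f"
  by (simp add: smooth_fun_iff_Ck Ball_def)

lemma smooth_funD:
  "smooth_fun n A W f \<Longrightarrow> (U, \<phi>) \<in> A \<Longrightarrow> Ck N n (\<phi> ` (U \<inter> W)) (\<lambda>y. f (inv_into U \<phi> y))"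
  by (auto simp: smooth_fun_iff_Ck)

lemma smooth_fun_cong:
  assumes "open W" "smooth_fun n A W f" "\<And>x. x \<in> W \<Longrightarrow> f x = g x"
  shows "smooth_fun n A W g"
  unfolding smooth_fun_iff_Ck
proof (clarify)
  fix U \<phi> N assume c: "(U, \<phi>) \<in> A"
  show "Ck N n (\<phi> ` (U \<inter> W)) (\<lambda>y. g (inv_into U \<phi> y))"
  proof (rule Ck_cong[OF chart_image_openin[OF c assms(1)]])
    show "Ck N n (\<phi> ` (U \<inter> W)) (\<lambda>y. f (inv_into U \<phi> y))"
      using assms(2) c by (auto simp: smooth_fun_iff_Ck)
  next
    fix z assume "z \<in> \<phi> ` (U \<inter> W)"
    then show "f (inv_into U \<phi> z) = g (inv_into U \<phi> z)"
      using chart_inv_into[OF c] assms(3) by blast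
  qed
qed

lemma smooth_fun_subset: "smooth_fun n A W f \<Longrightarrow> V \<subseteq> W \<Longrightarrow> smooth_fun n A V f"
proof -
  assume f: "smooth_fun n A W f" and VW: "V \<subseteq> W"
  have "smooth_on_Rn n (\<phi> ` (U \<inter> V)) (\<lambda>y. f (inv_into U \<phi> y))" if "(U, \<phi>) \<in> A" for U \<phi>
    by (rule smooth_on_Rn_subset[of _ "\<phi> ` (U \<inter> W)"])
       (use f that VW in \<open>auto simp: smooth_fun_def\<close>)
  then show ?thesis by (auto simp: smooth_fun_def)
qed

lemma smooth_fun_Union:
  assumes "\<And>W. W \<in> \<W> \<Longrightarrow> open W \<and> smooth_fun n A W f"
  shows "smooth_fun n A (\<Union>\<W>) f"
  unfolding smooth_fun_def
proof (clarify)
  fix U \<phi> assume c: "(U, \<phi>) \<in> A"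
  have "smooth_on_Rn n (\<Union>((\<lambda>W. \<phi> ` (U \<inter> W)) ` \<W>)) (\<lambda>y. f (inv_into U \<phi> y))"
    by (rule smooth_on_Rn_Union) (use assms c chart_image_openin in \<open>auto simp: smooth_fun_def\<close>)
  moreover have "\<Union>((\<lambda>W. \<phi> ` (U \<inter> W)) ` \<W>) = \<phi> ` (U \<inter> \<Union>\<W>)"
    by auto
  ultimately show "smooth_on_Rn n (\<phi> ` (U \<inter> \<Union>\<W>)) (\<lambda>y. f (inv_into U \<phi> y))"
    by simp
qed

lemma smooth_fun_local:
  assumes "\<And>x. x \<in> W \<Longrightarrow> \<exists>V. open V \<and> x \<in> V \<and> V \<subseteq> W \<and> smooth_fun n A V f"
  shows "smooth_fun n A W f"
proof -
  have "smooth_fun n A (\<Union>{V. open V \<and> V \<subseteq> W \<and> smooth_fun n A V f}) f"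
    by (rule smooth_fun_Union) auto
  moreover have "\<Union>{V. open V \<and> V \<subseteq> W \<and> smooth_fun n A V f} = W"
  proof (rule antisym)
    show "W \<subseteq> \<Union>{V. open V \<and> V \<subseteq> W \<and> smooth_fun n A V f}"
      using assms by fast
  qed auto
  ultimately show ?thesis by simp
qed

lemma smooth_fun_const: "open W \<Longrightarrow> smooth_fun n A W (\<lambda>_. c)"
  by (rule smooth_funI, rule Ck_const, rule chart_image_openin)

lemma smooth_fun_add:
  "open W \<Longrightarrow> smooth_fun n A W f \<Longrightarrow> smooth_fun n A W g \<Longrightarrow> smooth_fun n A W (\<lambda>x. f x + g x)"
  by (rule smooth_funI, rule Ck_add, rule chart_image_openin) (erule (1) smooth_funD | assumption)+

lemma smooth_fun_mult:
  fixes f g :: "'m \<Rightarrow> 'b::real_normed_algebra"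
  shows "open W \<Longrightarrow> smooth_fun n A W f \<Longrightarrow> smooth_fun n A W g \<Longrightarrow> smooth_fun n A W (\<lambda>x. f x * g x)"
  by (rule smooth_funI, rule Ck_mult, rule chart_image_openin) (erule (1) smooth_funD | assumption)+

lemma smooth_fun_bounded_linear:
  "bounded_linear L \<Longrightarrow> open W \<Longrightarrow> smooth_fun n A W f \<Longrightarrow> smooth_fun n A W (\<lambda>x. L (f x))"
  by (rule smooth_funI, rule Ck_bounded_linear[where L = L], rule chart_image_openin)
     (erule (1) smooth_funD | assumption)+

lemma smooth_fun_minus: "open W \<Longrightarrow> smooth_fun n A W f \<Longrightarrow> smooth_fun n A W (\<lambda>x. - f x)"
  by (rule smooth_fun_bounded_linear[OF bounded_linear_minus[OF bounded_linear_ident]])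

lemma smooth_fun_diff:
  "open W \<Longrightarrow> smooth_fun n A W f \<Longrightarrow> smooth_fun n A W g \<Longrightarrow> smooth_fun n A W (\<lambda>x. f x - g x)"
  using smooth_fun_add[of W f "\<lambda>x. - g x"] smooth_fun_minus[of W g] by simp

lemma smooth_fun_of_real:
  "open W \<Longrightarrow> smooth_fun n A W f \<Longrightarrow>
    smooth_fun n A W (\<lambda>x. of_real (f x) :: 'b::{real_normed_algebra_1})"
  by (rule smooth_fun_bounded_linear[OF bounded_linear_of_real])

lemma smooth_fun_inverse:
  fixes f :: "'m \<Rightarrow> 'b::real_normed_field"
  assumes W: "open W" and f: "smooth_fun n A W f" and nz: "\<And>x. x \<in> W \<Longrightarrow> f x \<noteq> 0"
  shows "smooth_fun n A W (\<lambda>x. inverse (f x))"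
  unfolding smooth_fun_iff_Ck
proof (clarify)
  fix U \<phi> N assume c: "(U, \<phi>) \<in> A"
  show "Ck N n (\<phi> ` (U \<inter> W)) (\<lambda>y. inverse (f (inv_into U \<phi> y)))"
  proof (rule Ck_inverse[OF chart_image_openin[OF c W]])
    show "f (inv_into U \<phi> y) \<noteq> 0" if "y \<in> \<phi> ` (U \<inter> W)" for y
      using chart_inv_into[OF c that] nz by blast
    show "Ck N n (\<phi> ` (U \<inter> W)) (\<lambda>y. f (inv_into U \<phi> y))"
      using f c by (auto simp: smooth_fun_iff_Ck)
  qed
qed

lemma smooth_fun_compose_real:
  fixes D :: "nat \<Rightarrow> real \<Rightarrow> real"
  assumes "\<And>j t. (D j has_real_derivative D (Suc j) t) (at t)" "open W" "smooth_fun n A W f"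
  shows "smooth_fun n A W (\<lambda>x. D j (f x))"
  by (rule smooth_funI, rule Ck_compose_real[where D = D], rule chart_image_openin)
     (rule assms | rule smooth_funD[OF assms(3)] | assumption)+

lemma smooth_fun_sum:
  assumes "open W" "\<And>i. i \<in> I \<Longrightarrow> smooth_fun n A W (f i)"
  shows "smooth_fun n A W (\<lambda>x. \<Sum>i\<in>I. f i x)"
  using assms(2)
  by (induction I rule: infinite_finite_induct)
     (simp_all add: smooth_fun_const smooth_fun_add assms(1))

lemma smooth_fun_prod:
  fixes f :: "'i \<Rightarrow> 'm \<Rightarrow> 'b::real_normed_field"
  assumes "open W" "\<And>i. i \<in> I \<Longrightarrow> smooth_fun n A W (f i)"
  shows "smooth_fun n A W (\<lambda>x. \<Prod>i\<in>I. f i x)"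
  using assms(2)
  by (induction I rule: infinite_finite_induct)
     (simp_all add: smooth_fun_const smooth_fun_mult assms(1))

lemma smooth_fun_chart_coordinate:
  "(U, \<phi>) \<in> A \<Longrightarrow> j < n \<Longrightarrow> smooth_fun n A U (\<lambda>x. \<phi> x j)"
  using chart_transition by (auto simp: smooth_fun_def)

end


section \<open>Bump functions and extension of local functions\<close>

text \<open>
  \<open>flat_derivative j\<close> is the \<open>j\<close>-th derivative of the function \<open>exp (- 1 / t)\<close> continued by zero to
  \<open>t \<le> 0\<close>. Differentiating \<open>p (1 / t) exp (- 1 / t)\<close> with a polynomial \<open>p\<close> replaces \<open>p\<close> by
  \<open>X\<^sup>2 (p - p')\<close>.
\<close>

primrec flat_poly :: "nat \<Rightarrow> real poly" where
  "flat_poly 0 = 1"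
| "flat_poly (Suc j) = [:0, 0, 1:] * (flat_poly j - pderiv (flat_poly j))"

definition flat_derivative :: "nat \<Rightarrow> real \<Rightarrow> real" where
  "flat_derivative j t = (if t \<le> 0 then 0 else poly (flat_poly j) (1 / t) * exp (- (1 / t)))"

lemma poly_times_exp_tendsto_0: "((\<lambda>x::real. poly p x * exp (- x)) \<longlongrightarrow> 0) at_top"
proof -
  have "((\<lambda>x. \<Sum>i\<le>degree p. coeff p i * (x ^ i / exp x)) \<longlongrightarrow> (\<Sum>i\<le>degree p. coeff p i * 0)) at_top"
    by (intro tendsto_sum tendsto_mult tendsto_const tendsto_power_div_exp_0)
  then show ?thesis
    by (simp add: poly_altdef sum_distrib_right exp_minus divide_inverse mult.assoc)
qed

lemma flat_derivative_tendsto_0: 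
  "((\<lambda>h. poly p (1 / h) * exp (- (1 / h)) / h) \<longlongrightarrow> (0::real)) (at_right 0)"
proof -
  have "filterlim (\<lambda>h::real. 1 / h) at_top (at_right 0)"
    using filterlim_inverse_at_top_right by (simp add: inverse_eq_divide)
  from filterlim_compose[OF poly_times_exp_tendsto_0[of "pCons 0 p"] this]
  show ?thesis by (simp add: mult.commute)
qed

lemma flat_derivative_has_derivative:
  "(flat_derivative j has_real_derivative flat_derivative (Suc j) t) (at t)"
proof -
  let ?p = "flat_poly j"
  consider "t < 0" | "t = 0" | "t > 0" by linarith
  then show ?thesis
  proof cases
    case 1
    have "((\<lambda>_. 0) has_real_derivative 0) (at t)" by simp
    then have "(flat_derivative j has_real_derivative 0) (at t)"
      by (rule has_field_derivative_transform_within_open[where S = "{..<0}"])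
         (use 1 in \<open>auto simp: flat_derivative_def\<close>)
    then show ?thesis using 1 by (simp add: flat_derivative_def)
  next
    case 3
    have "((\<lambda>t. poly ?p (1 / t) * exp (- (1 / t))) has_real_derivative
        flat_derivative (Suc j) t) (at t)"
      using 3 
      by (auto intro!: derivative_eq_intros DERIV_chain2[OF poly_DERIV]
          simp: flat_derivative_def field_simps power2_eq_square)
    then show ?thesis
      by (rule has_field_derivative_transform_within_open[where S = "{0<..}"])
         (use 3 in \<open>auto simp: flat_derivative_def\<close>)
  next
    case 2
    have right: "((\<lambda>h. flat_derivative j h / h) \<longlongrightarrow> 0) (at_right 0)"
      by (rule Lim_transform_eventually[OF flat_derivative_tendsto_0[of ?p]])
         (auto simp: flat_derivative_def eventually_at_filter)
    have left: "((\<lambda>h. flat_derivative j h / h) \<longlongrightarrow> 0) (at_left 0)"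
      by (rule Lim_transform_eventually[OF tendsto_const])
         (auto simp: flat_derivative_def eventually_at_filter)
    have "((\<lambda>h. flat_derivative j h / h) \<longlongrightarrow> 0) (at 0)"
      using left right filterlim_split_at by blast
    then show ?thesis
      using 2 by (simp add: DERIV_def flat_derivative_def)
  qed
qed

lemma flat_derivative_0_pos: "t > 0 \<Longrightarrow> flat_derivative 0 t > 0"
  and flat_derivative_0_nonpos: "t \<le> 0 \<Longrightarrow> flat_derivative 0 t = 0"
  by (simp_all add: flat_derivative_def)

text \<open>
  Equal to \<open>1\<close> for \<open>\<bar>t\<bar> \<le> r / 2\<close> and to \<open>0\<close> for \<open>\<bar>t\<bar> \<ge> r\<close>; the two summands of the denominator never vanish
  together.
\<close>

definition bump_real :: "real \<Rightarrow> real \<Rightarrow> real" where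
  "bump_real r t = flat_derivative 0 (r\<^sup>2 - t\<^sup>2) *
     inverse (flat_derivative 0 (r\<^sup>2 - t\<^sup>2) + flat_derivative 0 (t\<^sup>2 - (r/2)\<^sup>2))"

lemma bump_real_denominator:
  assumes "r > 0"
  shows "flat_derivative 0 (r\<^sup>2 - t\<^sup>2) + flat_derivative 0 (t\<^sup>2 - (r/2)\<^sup>2) > 0"
proof -
  have ge: "flat_derivative 0 u \<ge> 0" for u
    by (simp add: flat_derivative_def)
  have "t\<^sup>2 < r\<^sup>2 \<or> (r/2)\<^sup>2 < t\<^sup>2"
    using assms by (auto simp: power_divide not_less) (smt (verit) zero_less_power)
  then show ?thesis
    using flat_derivative_0_pos[of "r\<^sup>2 - t\<^sup>2"] flat_derivative_0_pos[of "t\<^sup>2 - (r/2)\<^sup>2"]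
      ge[of "r\<^sup>2 - t\<^sup>2"] ge[of "t\<^sup>2 - (r/2)\<^sup>2"] by auto
qed

lemma bump_real_eq_1: "r > 0 \<Longrightarrow> \<bar>t\<bar> \<le> r / 2 \<Longrightarrow> bump_real r t = 1"
  using bump_real_denominator[of r t] abs_le_square_iff[of t "r/2"] flat_derivative_0_nonpos[of "t\<^sup>2 - (r/2)\<^sup>2"]
  by (simp add: bump_real_def)

lemma bump_real_eq_0: "r > 0 \<Longrightarrow> r \<le> \<bar>t\<bar> \<Longrightarrow> bump_real r t = 0"
  using abs_le_square_iff[of r t] flat_derivative_0_nonpos[of "r\<^sup>2 - t\<^sup>2"]
  by (simp add: bump_real_def)

context smooth_manifold
begin

lemma smooth_fun_bump_real:
  assumes "r > 0" "open W" "smooth_fun n A W f"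
  shows "smooth_fun n A W (\<lambda>x. bump_real r (f x))"
proof -
  have sq: "smooth_fun n A W (\<lambda>x. (f x)\<^sup>2)"
    unfolding power2_eq_square by (rule smooth_fun_mult[OF assms(2,3,3)])
  have flat: "smooth_fun n A W (\<lambda>x. flat_derivative 0 (g x))" if "smooth_fun n A W g" for g
    by (rule smooth_fun_compose_real[where D = flat_derivative,
          OF flat_derivative_has_derivative assms(2) that])
  have 1: "smooth_fun n A W (\<lambda>x. flat_derivative 0 (r\<^sup>2 - (f x)\<^sup>2))"
    by (rule flat, rule smooth_fun_diff[OF assms(2) smooth_fun_const[OF assms(2)] sq])
  have 2: "smooth_fun n A W (\<lambda>x. flat_derivative 0 ((f x)\<^sup>2 - (r/2)\<^sup>2))"
    by (rule flat, rule smooth_fun_diff[OF assms(2) sq smooth_fun_const[OF assms(2)]])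
  show ?thesis
    unfolding bump_real_def
    by (rule smooth_fun_mult[OF assms(2) 1 smooth_fun_inverse[OF assms(2)
            smooth_fun_add[OF assms(2) 1 2]]])
       (use bump_real_denominator[OF assms(1)] in \<open>simp add: less_imp_neq[symmetric]\<close>)
qed

text \<open>
  The coordinates of a chart are smooth functions, so that a product of one-variable bump functions
  of them is smooth in all charts without a chain rule in several variables. The extension by zero
  is smooth because a closed cube in the image of the chart is compact, and compact sets are closed
  in a Hausdorff space.
\<close>

lemma bump_function:
  assumes W: "open W" and x: "x \<in> W"
  obtains \<eta> :: "'m \<Rightarrow> real" and V K where "smooth_fun n A UNIV \<eta>" "open V" "x \<in> V" "V \<subseteq> W"
    "\<And>z. z \<in> V \<Longrightarrow> \<eta> z = 1" "closed K" "K \<subseteq> W" "\<And>z. z \<notin> K \<Longrightarrow> \<eta> z = 0"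
proof -
  obtain U \<phi> where c: "(U, \<phi>) \<in> A" and xU: "x \<in> U"
    by (rule chart_exists)
  define c where "c = \<phi> x"
  have U: "open U" by (rule chart_open[OF c])
  obtain T where T: "open T" "\<phi> ` (U \<inter> W) = T \<inter> {y. \<forall>i\<ge>n. y i = 0}"
    using chart_image_openin[OF c W]
    by (auto simp: Euclidean_space_def openin_subtopology euclidean_product_topology)
  have c_im: "c \<in> \<phi> ` (U \<inter> W)" using xU x by (auto simp: c_def)
  then have cT: "c \<in> T" and c0: "\<And>i. i \<ge> n \<Longrightarrow> c i = 0" using T(2) by auto
  have "openin (product_topology (\<lambda>_. euclidean) UNIV) T"
    using T(1) by (simp add: euclidean_product_topology)
  from product_topology_open_contains_basis[OF this cT] obtain X where
    X: "c \<in> (\<Pi>\<^sub>E i\<in>UNIV. X i)" "\<And>i. openin euclidean (X i)" "(\<Pi>\<^sub>E i\<in>UNIV. X i) \<subseteq> T"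
    by blast
  have "\<exists>e>0. cball (c i) e \<subseteq> X i" for i
    using X(1) X(2)[of i] by (auto simp: open_contains_cball PiE_iff)
  then obtain \<epsilon> where \<epsilon>: "\<And>i. \<epsilon> i > 0" "\<And>i. cball (c i) (\<epsilon> i) \<subseteq> X i" by metis
  define r where "r = Min (insert 1 (\<epsilon> ` {..<n}))"
  have r: "r > 0" using \<epsilon>(1) by (simp add: r_def)
  have r_le: "r \<le> \<epsilon> i" if "i < n" for i
    using that by (simp add: r_def)
  define Q where "Q = (\<Pi>\<^sub>E i\<in>UNIV. if i < n then {c i - r..c i + r} else {0::real})"
  have Q_iff: "y \<in> Q \<longleftrightarrow> (\<forall>i<n. \<bar>y i - c i\<bar> \<le> r) \<and> (\<forall>i\<ge>n. y i = 0)" for y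
  proof -
    have "y i \<in> (if i < n then {c i - r..c i + r} else {0}) \<longleftrightarrow>
        (if i < n then \<bar>y i - c i\<bar> \<le> r else y i = 0)" for i
      by (simp add: abs_le_iff) linarith
    then have "y \<in> Q \<longleftrightarrow> (\<forall>i. if i < n then \<bar>y i - c i\<bar> \<le> r else y i = 0)"
      by (simp only: Q_def PiE_UNIV_domain Pi_iff ball_UNIV)
    then show ?thesis
      by (metis not_less)
  qed
  have Q_sub: "Q \<subseteq> \<phi> ` (U \<inter> W)"
  proof
    fix y assume y: "y \<in> Q"
    have "y i \<in> X i" for i
    proof (cases "i < n")
      case True
      then have "y i \<in> cball (c i) (\<epsilon> i)"
        using y r_le[OF True] by (auto simp: Q_iff dist_real_def abs_minus_commute)
      then show ?thesis using \<epsilon>(2) by blast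
    next
      case False
      then show ?thesis using y c0[of i] X(1) by (auto simp: Q_iff PiE_iff) (metis UNIV_I)
    qed
    then have "y \<in> T" using X(3) by (auto simp: PiE_iff)
    then show "y \<in> \<phi> ` (U \<inter> W)" using y T(2) by (auto simp: Q_iff)
  qed
  define K where "K = {z \<in> U. \<phi> z \<in> Q}"
  have \<phi>K: "\<phi> ` K = Q" using Q_sub by (auto simp: K_def)
  have KW: "K \<subseteq> U \<inter> W"
  proof
    fix z assume z: "z \<in> K"
    then obtain w where "w \<in> U \<inter> W" "\<phi> w = \<phi> z"
      using Q_sub by (force simp: K_def)
    then show "z \<in> U \<inter> W"
      using z chart_inj[OF c] by (auto simp: K_def dest: inj_onD)
  qed
  have "compactin (powertop_real UNIV) Q"
    unfolding Q_def by (auto simp: compactin_PiE)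
  then have "compactin (Euclidean_space n) Q"
    by (auto simp: Euclidean_space_def compactin_subtopology Q_iff)
  then have "compactin (subtopology (Euclidean_space n) (\<phi> ` U)) (\<phi> ` K)"
    using Q_sub by (auto simp: compactin_subtopology \<phi>K)
  then have "compactin (top_of_set U) K"
    using homeomorphic_map_compactness[OF chart_homeomorphic[OF c], of K] by (auto simp: K_def)
  then have K: "closed K"
    by (simp add: compactin_subtopology compact_imp_closed)
  define \<eta> where "\<eta> z = (if z \<in> U then \<Prod>i<n. bump_real r (\<phi> z i - c i) else 0)" for z
  have \<eta>_0: "\<eta> z = 0" if "z \<notin> K" for z
  proof (cases "z \<in> U")
    case True
    then have "\<phi> z i = 0" if "i \<ge> n" for i
      using that openin_subset[OF chart_openin[OF c]] by (auto simp: topspace_Euclidean_space)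
    then obtain i where "i < n" "\<not> \<bar>\<phi> z i - c i\<bar> \<le> r"
      using \<open>z \<notin> K\<close> True by (auto simp: K_def Q_iff)
    then have "bump_real r (\<phi> z i - c i) = 0"
      by (intro bump_real_eq_0[OF r]) simp
    then show ?thesis
      using \<open>i < n\<close> by (auto simp: \<eta>_def)
  qed (simp add: \<eta>_def)
  have "smooth_fun n A U (\<lambda>z. \<Prod>i<n. bump_real r (\<phi> z i - c i))"
    by (intro smooth_fun_prod smooth_fun_bump_real smooth_fun_diff smooth_fun_const r U
        smooth_fun_chart_coordinate[OF c]) simp
  then have "smooth_fun n A U \<eta>"
    by (rule smooth_fun_cong[OF U]) (simp add: \<eta>_def)
  moreover have "smooth_fun n A (- K) \<eta>"
    by (rule smooth_fun_cong[OF _ smooth_fun_const[of "- K" 0]]) (use K \<eta>_0 in auto)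
  ultimately have "smooth_fun n A (\<Union>{U, - K}) \<eta>"
    by (intro smooth_fun_Union) (use U K in auto)
  moreover have "\<Union>{U, - K} = UNIV" using KW by auto
  ultimately have \<eta>: "smooth_fun n A UNIV \<eta>" by simp
  define V where "V = U \<inter> \<phi> -` {y. \<forall>i\<in>{..<n}. \<bar>y i - c i\<bar> < r / 2}"
  have "continuous_map (top_of_set U) euclidean \<phi>"
    using homeomorphic_imp_continuous_map[OF chart_homeomorphic[OF c]]
    by (simp add: Euclidean_space_def continuous_map_in_subtopology euclidean_product_topology)
  then have cont: "continuous_on U \<phi>" by simp
  have "open {y::nat \<Rightarrow> real. \<forall>i\<in>{..<n}. \<bar>y i - c i\<bar> < r / 2}"
  proof -
    have "open {y::nat \<Rightarrow> real. \<bar>y i - c i\<bar> < r / 2}" for i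
      by (intro open_Collect_less continuous_on_rabs continuous_on_diff continuous_on_const
          continuous_on_product_coordinates)
    then have "open (\<Inter>i\<in>{..<n}. {y::nat \<Rightarrow> real. \<bar>y i - c i\<bar> < r / 2})"
      by (intro open_INT) auto
    moreover have "(\<Inter>i\<in>{..<n}. {y::nat \<Rightarrow> real. \<bar>y i - c i\<bar> < r / 2}) =
        {y. \<forall>i\<in>{..<n}. \<bar>y i - c i\<bar> < r / 2}"
      by blast
    ultimately show ?thesis by simp
  qed
  then have "open V"
    unfolding V_def by (rule continuous_open_preimage[OF cont U])
  moreover have "x \<in> V" using xU r by (simp add: V_def c_def)
  moreover have "V \<subseteq> K"
  proof
    fix z assume z: "z \<in> V"
    then have "\<phi> z i = 0" if "i \<ge> n" for i
      using that openin_subset[OF chart_openin[OF c]]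
      by (auto simp: topspace_Euclidean_space V_def)
    moreover have "\<bar>\<phi> z i - c i\<bar> \<le> r" if "i < n" for i
      using z that r by (auto simp: V_def) (smt (verit) field_sum_of_halves lessThan_iff)
    ultimately show "z \<in> K"
      using z by (auto simp: V_def K_def Q_iff)
  qed
  moreover have "\<eta> z = 1" if "z \<in> V" for z
  proof -
    have "bump_real r (\<phi> z i - c i) = 1" if "i < n" for i
      using \<open>z \<in> V\<close> that by (intro bump_real_eq_1[OF r]) (auto simp: V_def intro: less_imp_le)
    then show ?thesis using that by (simp add: V_def \<eta>_def)
  qed
  ultimately show ?thesis
    using that[OF \<eta> _ _ _ _ K _ \<eta>_0] KW by auto
qed

text \<open>
  All coefficients of a formal series are multiplied by the same bump function, so that one
  neighbourhood of \<open>x\<close> serves for all orders.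
\<close>

lemma formal_functions_extend:
  assumes W: "open W" "x \<in> W" and f: "f \<in> formal_functions n A W"
  obtains V g where "open V" "x \<in> V" "V \<subseteq> W" "g \<in> formal_functions n A UNIV"
    "\<And>r z. z \<in> V \<Longrightarrow> g r z = f r z"
proof -
  obtain \<eta> :: "'m \<Rightarrow> real" and V K where \<eta>: "smooth_fun n A UNIV \<eta>" "open V" "x \<in> V" "V \<subseteq> W"
    "\<And>z. z \<in> V \<Longrightarrow> \<eta> z = 1" "closed K" "K \<subseteq> W" "\<And>z. z \<notin> K \<Longrightarrow> \<eta> z = 0"
    by (rule bump_function[OF W]) blast
  define g where "g r z = complex_of_real (\<eta> z) * f r z" for r z
  have "smooth_fun n A UNIV (g r)" for r
  proof -
    have "smooth_fun n A W (g r)"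
      unfolding g_def
      by (intro smooth_fun_mult smooth_fun_of_real W smooth_fun_subset[OF \<eta>(1)])
         (use f in \<open>auto simp: formal_functions_def\<close>)
    moreover have "smooth_fun n A (- K) (g r)"
      by (rule smooth_fun_cong[OF _ smooth_fun_const[of "- K" 0]])
         (use \<eta> in \<open>auto simp: g_def\<close>)
    ultimately have "smooth_fun n A (\<Union>{W, - K}) (g r)"
      by (intro smooth_fun_Union) (use W \<eta> in auto)
    moreover have "\<Union>{W, - K} = UNIV" using \<eta> by auto
    ultimately show ?thesis by simp
  qed
  then have "g \<in> formal_functions n A UNIV" by (simp add: formal_functions_def)
  then show ?thesis
    using that[OF \<eta>(2-4), of g] \<eta>(5) by (simp add: g_def)
qed

end

section \<open>Local properties of star products\<close>

abbreviation series_add ::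
    "(nat \<Rightarrow> 'm \<Rightarrow> 'b::plus) \<Rightarrow> (nat \<Rightarrow> 'm \<Rightarrow> 'b) \<Rightarrow> nat \<Rightarrow> 'm \<Rightarrow> 'b" (infixl "\<boxplus>" 65) where
  "f \<boxplus> g \<equiv> (\<lambda>r x. f r x + g r x)"

text \<open>
  Multiplication by the deformation parameter.
\<close>

definition formal_shift :: "(nat \<Rightarrow> 'm \<Rightarrow> 'b::zero) \<Rightarrow> nat \<Rightarrow> 'm \<Rightarrow> 'b" where
  "formal_shift f r = (case r of 0 \<Rightarrow> (\<lambda>_. 0) | Suc r' \<Rightarrow> f r')"

lemma formal_shift_simps [simp]:
  "formal_shift f 0 = (\<lambda>_. 0)" "formal_shift f (Suc r) = f r"
  by (simp_all add: formal_shift_def)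

lemma Ck_sum:
  assumes W: "openin (Euclidean_space n) W" and "\<And>i. i \<in> I \<Longrightarrow> Ck N n W (f i)"
  shows "Ck N n W (\<lambda>y. \<Sum>i\<in>I. f i y)"
  using assms(2)
  by (induction I rule: infinite_finite_induct) (simp_all add: Ck_const[OF W] Ck_add[OF W])

lemma iter_partial_add:
  assumes W: "openin (Euclidean_space n) W" and f: "smooth_on_Rn n W f" and g: "smooth_on_Rn n W g"
  shows "I \<in> lists {..<n} \<Longrightarrow> y \<in> W \<Longrightarrow>
    iter_partial I (\<lambda>z. f z + g z) y = iter_partial I f y + iter_partial I g y"
proof (induction I arbitrary: y)
  case (Cons i I)
  then have i: "i < n" and I: "I \<in> lists {..<n}" by auto
  have p: "has_partial i (iter_partial I h) (partial_deriv i (iter_partial I h) y) y"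
    if "smooth_on_Rn n W h" for h :: "(nat \<Rightarrow> real) \<Rightarrow> 'a"
    using that I i Cons.prems(2) unfolding smooth_on_Rn_def by (intro has_partial_partial_deriv) blast
  have "has_partial i (\<lambda>z. iter_partial I f z + iter_partial I g z)
     (partial_deriv i (iter_partial I f) y + partial_deriv i (iter_partial I g) y) y"
    using p[OF f] p[OF g] unfolding has_partial_def by (rule has_vector_derivative_add)
  then have "partial_deriv i (\<lambda>z. iter_partial I f z + iter_partial I g z) y =
     partial_deriv i (iter_partial I f) y + partial_deriv i (iter_partial I g) y"
    by (rule has_partial_imp_partial_deriv)
  moreover have "partial_deriv i (iter_partial I (\<lambda>z. f z + g z)) y =
      partial_deriv i (\<lambda>z. iter_partial I f z + iter_partial I g z) y"
    by (rule partial_deriv_cong[OF W Cons.prems(2) i Cons.IH[OF I]])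
  ultimately show ?case by (simp add: iter_partial_Cons)
qed (simp add: iter_partial_Nil)

context smooth_manifold
begin

lemma chart_partial_cong:
  assumes c: "(U, \<phi>) \<in> A" and W: "open W" and x: "x \<in> U \<inter> W" and I: "I \<in> lists {..<n}"
    and eq: "\<And>z. z \<in> W \<Longrightarrow> f z = g z"
  shows "chart_partial (U, \<phi>) I f x = chart_partial (U, \<phi>) I g x"
  unfolding chart_partial_def fst_conv snd_conv
proof (rule iter_partial_cong[OF chart_image_openin[OF c W] I])
  show "f (inv_into U \<phi> z) = g (inv_into U \<phi> z)" if "z \<in> \<phi> ` (U \<inter> W)" for z
    using chart_inv_into[OF c that] eq by simp
qed (use x in blast)

lemma chart_partial_add:
  assumes c: "(U, \<phi>) \<in> A" and W: "open W" and x: "x \<in> U \<inter> W" and I: "I \<in> lists {..<n}"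
    and f: "smooth_fun n A W f" and g: "smooth_fun n A W g"
  shows "chart_partial (U, \<phi>) I (\<lambda>z. f z + g z) x =
    chart_partial (U, \<phi>) I f x + chart_partial (U, \<phi>) I g x"
  unfolding chart_partial_def fst_conv snd_conv
  by (rule iter_partial_add[OF chart_image_openin[OF c W]])
     (use f g c I x in \<open>auto simp: smooth_fun_def\<close>)

lemma formal_functions_subset:
  "f \<in> formal_functions n A W \<Longrightarrow> V \<subseteq> W \<Longrightarrow> f \<in> formal_functions n A V"
  by (auto simp: formal_functions_def intro: smooth_fun_subset)

lemma formal_functions_cong:
  "open W \<Longrightarrow> f \<in> formal_functions n A W \<Longrightarrow> (\<And>r x. x \<in> W \<Longrightarrow> f r x = g r x) \<Longrightarrow>
    g \<in> formal_functions n A W"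
  by (auto simp: formal_functions_def intro: smooth_fun_cong[of W "f r" "g r" for r])

lemma formal_functions_add:
  "open W \<Longrightarrow> f \<in> formal_functions n A W \<Longrightarrow> g \<in> formal_functions n A W \<Longrightarrow>
    (f \<boxplus> g) \<in> formal_functions n A W"
  by (auto simp: formal_functions_def intro: smooth_fun_add)

lemma formal_functions_minus:
  "open W \<Longrightarrow> f \<in> formal_functions n A W \<Longrightarrow> (\<lambda>r x. - f r x) \<in> formal_functions n A W"
  by (auto simp: formal_functions_def intro: smooth_fun_minus)

lemma formal_functions_sum:
  "open W \<Longrightarrow> (\<And>i. i \<in> I \<Longrightarrow> f i \<in> formal_functions n A W) \<Longrightarrow>
    (\<lambda>r x. \<Sum>i\<in>I. f i r x) \<in> formal_functions n A W"
  by (auto simp: formal_functions_def intro: smooth_fun_sum)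

lemma formal_functions_zero: "open W \<Longrightarrow> (\<lambda>r x. 0) \<in> formal_functions n A W"
  by (auto simp: formal_functions_def intro: smooth_fun_const)

lemma formal_functions_const_series:
  "open W \<Longrightarrow> smooth_fun n A W f \<Longrightarrow> const_series f \<in> formal_functions n A W"
  by (auto simp: formal_functions_def const_series_def intro: smooth_fun_const)

lemma formal_functions_shift_iff:
  "open W \<Longrightarrow> formal_shift f \<in> formal_functions n A W \<longleftrightarrow> f \<in> formal_functions n A W"
  by (auto simp: formal_functions_def formal_shift_def smooth_fun_const split: nat.splits)

lemma formal_functions_local:
  assumes "\<And>x. x \<in> W \<Longrightarrow> \<exists>V. open V \<and> x \<in> V \<and> V \<subseteq> W \<and> f \<in> formal_functions n A V"
  shows "f \<in> formal_functions n A W"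
  unfolding formal_functions_def
proof (clarify)
  fix r
  show "smooth_fun n A W (f r)"
  proof (rule smooth_fun_local)
    fix x assume "x \<in> W"
    then show "\<exists>V. open V \<and> x \<in> V \<and> V \<subseteq> W \<and> smooth_fun n A V (f r)"
      using assms[of x] unfolding formal_functions_def by fast
  qed
qed

definition bidifferential_value ::
    "'m chart \<Rightarrow> nat \<Rightarrow> (nat list \<Rightarrow> nat list \<Rightarrow> 'm \<Rightarrow> complex) \<Rightarrow>
      ('m \<Rightarrow> complex) \<Rightarrow> ('m \<Rightarrow> complex) \<Rightarrow> 'm \<Rightarrow> complex" where
  "bidifferential_value c N a f g x =
     (\<Sum>I\<in>{I \<in> lists {..<n}. length I \<le> N}. \<Sum>J\<in>{J \<in> lists {..<n}. length J \<le> N}.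
        a I J x * chart_partial c I f x * chart_partial c J g x)"

end

locale star_manifold = smooth_manifold n A for n and A :: "'m::t2_space chart set" +
  fixes P :: "('m \<Rightarrow> complex) \<Rightarrow> ('m \<Rightarrow> complex) \<Rightarrow> 'm \<Rightarrow> complex"
    and C :: "nat \<Rightarrow> ('m \<Rightarrow> complex) \<Rightarrow> ('m \<Rightarrow> complex) \<Rightarrow> 'm \<Rightarrow> complex"
  assumes star_product: "star_product n A P C"
begin

lemma C_representation:
  assumes c: "(U, \<phi>) \<in> A"
  shows "\<exists>a N. (\<forall>I J. smooth_fun n A U (a I J)) \<and>
     (\<forall>W f g x. open W \<longrightarrow> W \<subseteq> U \<longrightarrow> smooth_fun n A W f \<longrightarrow> smooth_fun n A W g \<longrightarrow> x \<in> W \<longrightarrow>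
        C r f g x = bidifferential_value (U, \<phi>) N a f g x)"
proof -
  have "bidifferential n A (C r)"
    using star_product by (simp add: star_product_def)
  from this[unfolded bidifferential_def, THEN bspec, OF c, unfolded prod.case,
      folded bidifferential_value_def]
  obtain N a where a: "\<forall>I J. smooth_fun n A U (a I J)" and
    rep: "\<forall>W f g. open W \<and> W \<subseteq> U \<and> smooth_fun n A W f \<and> smooth_fun n A W g \<longrightarrow>
      (\<forall>x\<in>W. C r f g x = bidifferential_value (U, \<phi>) N a f g x)"
    by (elim exE conjE)
  show ?thesis
    by (intro exI[of _ a] exI[of _ N] conjI a) (use rep in simp)
qed

text \<open>
  The formula for \<open>C r f g\<close> in a chart is only used in that same chart, so that no change of
  coordinates is needed.
\<close>

lemma C_smooth:
  assumes W: "open W" and f: "smooth_fun n A W f" and g: "smooth_fun n A W g"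
  shows "smooth_fun n A W (C r f g)"
proof (rule smooth_funI)
  fix U \<phi> M assume c: "(U, \<phi>) \<in> A"
  obtain a N where a: "\<forall>I J. smooth_fun n A U (a I J)" and
    "\<forall>W f g x. open W \<longrightarrow> W \<subseteq> U \<longrightarrow> smooth_fun n A W f \<longrightarrow> smooth_fun n A W g \<longrightarrow> x \<in> W \<longrightarrow>
        C r f g x = bidifferential_value (U, \<phi>) N a f g x"
    using C_representation[OF c, of r] by (elim exE conjE)
  note rep = this(2)[rule_format, unfolded bidifferential_value_def]
  let ?L = "{I \<in> lists {..<n}. length I \<le> N}" and ?S = "\<phi> ` (U \<inter> W)" and ?i = "inv_into U \<phi>"
  have S: "openin (Euclidean_space n) ?S" by (rule chart_image_openin[OF c W])
  have a': "Ck M n ?S (\<lambda>y. a I J (?i y))" for I J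
    using smooth_fun_subset[OF a[rule_format], of "U \<inter> W"] smooth_funD[OF _ c, of "U \<inter> W" "a I J" M] by simp
  have h': "Ck M n ?S (iter_partial I (\<lambda>y. h (?i y)))"
    if "smooth_fun n A W h" "I \<in> ?L" for I and h :: "'m \<Rightarrow> complex"
    using that smooth_funD[OF that(1) c] by (intro Ck_iter_partial) auto
  show "Ck M n ?S (\<lambda>y. C r f g (?i y))"
  proof (rule Ck_cong[OF S])
    show "Ck M n ?S (\<lambda>y. \<Sum>I\<in>?L. \<Sum>J\<in>?L. a I J (?i y) *
        iter_partial I (\<lambda>y. f (?i y)) y * iter_partial J (\<lambda>y. g (?i y)) y)"
      by (rule Ck_sum[OF S])+ (rule Ck_mult[OF S] a' h' f g | assumption)+
  next
    fix y assume y: "y \<in> ?S"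
    have "\<phi> (?i y) = y" using y by (intro f_inv_into_f) auto
    moreover have "C r f g (?i y) = (\<Sum>I\<in>?L. \<Sum>J\<in>?L. a I J (?i y) *
         chart_partial (U, \<phi>) I f (?i y) * chart_partial (U, \<phi>) J g (?i y))"
      by (rule rep[of "U \<inter> W"])
         (use chart_open[OF c] W f g chart_inv_into[OF c y] in \<open>auto intro: smooth_fun_subset\<close>)
    ultimately show "(\<Sum>I\<in>?L. \<Sum>J\<in>?L. a I J (?i y) *
        iter_partial I (\<lambda>y. f (?i y)) y * iter_partial J (\<lambda>y. g (?i y)) y) = C r f g (?i y)"
      by (simp add: chart_partial_def)
  qed
qed

text \<open>
  A bidifferential operator is local; this is what allows restricting \<open>\<star>\<close> to open sets.
\<close>

lemma C_cong:
  assumes W: "open W" and x: "x \<in> W" and f: "smooth_fun n A W f" and g: "smooth_fun n A W g"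
    and ff: "\<And>z. z \<in> W \<Longrightarrow> f z = f' z" and gg: "\<And>z. z \<in> W \<Longrightarrow> g z = g' z"
  shows "C r f g x = C r f' g' x"
proof -
  obtain U \<phi> where c: "(U, \<phi>) \<in> A" and xU: "x \<in> U" by (rule chart_exists)
  obtain a N where a: "\<forall>I J. smooth_fun n A U (a I J)" and
    "\<forall>W f g x. open W \<longrightarrow> W \<subseteq> U \<longrightarrow> smooth_fun n A W f \<longrightarrow> smooth_fun n A W g \<longrightarrow> x \<in> W \<longrightarrow>
        C r f g x = bidifferential_value (U, \<phi>) N a f g x"
    using C_representation[OF c, of r] by (elim exE conjE)
  note rep = this(2)[rule_format, unfolded bidifferential_value_def]
  have UW: "open (U \<inter> W)" "U \<inter> W \<subseteq> U" "x \<in> U \<inter> W"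
    using chart_open[OF c] W xU x by auto
  have f': "smooth_fun n A W f'" and g': "smooth_fun n A W g'"
    using smooth_fun_cong[OF W f ff] smooth_fun_cong[OF W g gg] by auto
  have sub: "smooth_fun n A (U \<inter> W) h" if "smooth_fun n A W h" for h :: "'m \<Rightarrow> complex"
    by (rule smooth_fun_subset[OF that]) simp
  show ?thesis
    unfolding rep[OF UW(1,2) sub[OF f] sub[OF g] UW(3)] rep[OF UW(1,2) sub[OF f'] sub[OF g'] UW(3)]
    by (intro sum.cong refl arg_cong2[where f = "(*)"] chart_partial_cong[OF c W UW(3)] ff gg) auto
qed

lemma C_add:
  assumes W: "open W" and x: "x \<in> W" and f: "smooth_fun n A W f" and g: "smooth_fun n A W g"
    and h: "smooth_fun n A W h"
  shows C_add_left: "C r (\<lambda>z. f z + g z) h x = C r f h x + C r g h x"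
    and C_add_right: "C r h (\<lambda>z. f z + g z) x = C r h f x + C r h g x"
proof -
  obtain U \<phi> where c: "(U, \<phi>) \<in> A" and xU: "x \<in> U" by (rule chart_exists)
  obtain a N where a: "\<forall>I J. smooth_fun n A U (a I J)" and
    "\<forall>W f g x. open W \<longrightarrow> W \<subseteq> U \<longrightarrow> smooth_fun n A W f \<longrightarrow> smooth_fun n A W g \<longrightarrow> x \<in> W \<longrightarrow>
        C r f g x = bidifferential_value (U, \<phi>) N a f g x"
    using C_representation[OF c, of r] by (elim exE conjE)
  note rep = this(2)[rule_format, unfolded bidifferential_value_def]
  have UW: "open (U \<inter> W)" "U \<inter> W \<subseteq> U" "x \<in> U \<inter> W"
    using chart_open[OF c] W xU x by auto
  have sub: "smooth_fun n A (U \<inter> W) h" if "smooth_fun n A W h" for h :: "'m \<Rightarrow> complex"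
    by (rule smooth_fun_subset[OF that]) simp
  note rep' = rep[OF UW(1,2) _ _ UW(3)]
  have fg: "smooth_fun n A W (\<lambda>z. f z + g z)" by (rule smooth_fun_add[OF W f g])
  note add = chart_partial_add[OF c W UW(3) _ f g]
  show "C r (\<lambda>z. f z + g z) h x = C r f h x + C r g h x"
    unfolding rep'[OF sub[OF fg] sub[OF h]] rep'[OF sub[OF f] sub[OF h]] rep'[OF sub[OF g] sub[OF h]]
      sum.distrib[symmetric]
    by (intro sum.cong refl) (simp add: add algebra_simps)
  show "C r h (\<lambda>z. f z + g z) x = C r h f x + C r h g x"
    unfolding rep'[OF sub[OF h] sub[OF fg]] rep'[OF sub[OF h] sub[OF f]] rep'[OF sub[OF h] sub[OF g]]
      sum.distrib[symmetric]
    by (intro sum.cong refl) (simp add: add algebra_simps)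
qed

lemma C_zero_right:
  assumes "open W" "x \<in> W" "smooth_fun n A W f"
  shows "C r f (\<lambda>_. 0) x = 0"
  using C_add_right[OF assms(1,2) smooth_fun_const[OF assms(1), of 0] smooth_fun_const[OF assms(1), of 0]
      assms(3), of r] by simp

lemma C_zero_left:
  assumes "open W" "x \<in> W" "smooth_fun n A W f"
  shows "C r (\<lambda>_. 0) f x = 0"
  using C_add_left[OF assms(1,2) smooth_fun_const[OF assms(1), of 0] smooth_fun_const[OF assms(1), of 0]
      assms(3), of r] by simp

abbreviation FF :: "'m set \<Rightarrow> 'm fseries set" where
  "FF W \<equiv> formal_functions n A W"

abbreviation mul :: "'m fseries \<Rightarrow> 'm fseries \<Rightarrow> 'm fseries"  (infixl "\<star>" 70) where
  "f \<star> g \<equiv> star C f g"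

lemma FF_UNIV: "f \<in> FF UNIV \<Longrightarrow> f \<in> FF W"
  by (erule formal_functions_subset) simp

lemma FF_D: "f \<in> FF W \<Longrightarrow> smooth_fun n A W (f r)"
  by (simp add: formal_functions_def)

lemma star_closed: "open W \<Longrightarrow> f \<in> FF W \<Longrightarrow> g \<in> FF W \<Longrightarrow> f \<star> g \<in> FF W"
  unfolding formal_functions_def star_def
  by (intro CollectI allI smooth_fun_sum C_smooth) auto

lemma star_cong:
  assumes "open W" "x \<in> W" "f \<in> FF W" "g \<in> FF W"
    and "\<And>r z. z \<in> W \<Longrightarrow> f r z = f' r z" "\<And>r z. z \<in> W \<Longrightarrow> g r z = g' r z"
  shows "(f \<star> g) r x = (f' \<star> g') r x"
  unfolding star_def
  by (intro sum.cong refl C_cong[OF assms(1,2)]) (use assms in \<open>auto intro: FF_D\<close>)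

lemma star_add_left:
  assumes "open W" "x \<in> W" "f \<in> FF W" "g \<in> FF W" "h \<in> FF W"
  shows "((f \<boxplus> g) \<star> h) r x = (f \<star> h) r x + (g \<star> h) r x"
  unfolding star_def sum.distrib[symmetric]
  by (intro sum.cong refl C_add_left[OF assms(1,2)] FF_D assms(3-5))

lemma star_add_right:
  assumes "open W" "x \<in> W" "f \<in> FF W" "g \<in> FF W" "h \<in> FF W"
  shows "(h \<star> (f \<boxplus> g)) r x = (h \<star> f) r x + (h \<star> g) r x"
  unfolding star_def sum.distrib[symmetric]
  by (intro sum.cong refl C_add_right[OF assms(1,2)] FF_D assms(3-5))

lemma star_zero_left: 
  assumes "open W" "x \<in> W" "f \<in> FF W" shows "((\<lambda>_ _. 0) \<star> f) r x = 0"
  unfolding star_def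
  by (intro sum.neutral ballI C_zero_left[OF assms(1,2)] FF_D assms(3))

lemma star_zero_right: 
  assumes "open W" "x \<in> W" "f \<in> FF W" shows "(f \<star> (\<lambda>_ _. 0)) r x = 0"
  unfolding star_def
  by (intro sum.neutral ballI C_zero_right[OF assms(1,2)] FF_D assms(3))

lemma star_sum_left:
  assumes W: "open W" "x \<in> W" and h: "h \<in> FF W" and f: "\<And>i. i \<in> I \<Longrightarrow> f i \<in> FF W"
  shows "((\<lambda>r x. \<Sum>i\<in>I. f i r x) \<star> h) r x = (\<Sum>i\<in>I. (f i \<star> h) r x)"
  using f
proof (induction I rule: infinite_finite_induct)
  case (insert i I)
  then show ?case
    using star_add_left[OF W, of "f i" "\<lambda>r x. \<Sum>i\<in>I. f i r x" h r]
    by (simp add: h formal_functions_sum W(1))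
qed (simp_all add: star_zero_left[OF W h])

lemma star_sum_right:
  assumes W: "open W" "x \<in> W" and h: "h \<in> FF W" and f: "\<And>i. i \<in> I \<Longrightarrow> f i \<in> FF W"
  shows "(h \<star> (\<lambda>r x. \<Sum>i\<in>I. f i r x)) r x = (\<Sum>i\<in>I. (h \<star> f i) r x)"
  using f
proof (induction I rule: infinite_finite_induct)
  case (insert i I)
  then show ?case
    using star_add_right[OF W, of "f i" "\<lambda>r x. \<Sum>i\<in>I. f i r x" h r]
    by (simp add: h formal_functions_sum W(1))
qed (simp_all add: star_zero_right[OF W h])

lemma star_shift_right:
  assumes W: "open W" "x \<in> W" and f: "f \<in> FF W"
  shows "(f \<star> formal_shift g) r x = formal_shift (f \<star> g) r x"
proof (cases r)
  case 0
  then show ?thesis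
    by (simp add: star_def C_zero_right[OF W FF_D[OF f]])
next
  case (Suc r')
  have "(\<Sum>q\<le>Suc r' - p. C p (f q) (formal_shift g (Suc r' - p - q)) x) =
      (\<Sum>q\<le>r' - p. C p (f q) (g (r' - p - q)) x)" if "p \<le> r'" for p
  proof -
    have "(\<Sum>q\<le>r' - p. C p (f q) (formal_shift g (Suc (r' - p) - q)) x) =
        (\<Sum>q\<le>r' - p. C p (f q) (g (r' - p - q)) x)"
      by (intro sum.cong refl) (simp add: Suc_diff_le)
    then show ?thesis
      using that by (simp add: Suc_diff_le C_zero_right[OF W FF_D[OF f]])
  qed
  then show ?thesis
    unfolding Suc star_def by (simp add: C_zero_right[OF W FF_D[OF f]])
qed

text \<open>
  The axioms of a star product only speak of globally defined functions; they hold for functions on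
  an open set since these agree near any given point with global ones, and \<open>(f \<star> g) r x\<close> only
  depends on \<open>f\<close> and \<open>g\<close> near \<open>x\<close>.
\<close>

lemma C_0:
  assumes W: "open W" "x \<in> W" and f: "smooth_fun n A W f" and g: "smooth_fun n A W g"
  shows "C 0 f g x = f x * g x"
proof -
  have "const_series h \<in> FF W" if "smooth_fun n A W h" for h
    by (rule formal_functions_const_series[OF W(1) that])
  note * = formal_functions_extend[OF W this]
  obtain V f' where V: "open V" "x \<in> V" "V \<subseteq> W" "f' \<in> FF UNIV" "\<And>r z. z \<in> V \<Longrightarrow> f' r z = const_series f r z"
    using *[OF f] by blast
  obtain V' g' where V': "open V'" "x \<in> V'" "V' \<subseteq> W" "g' \<in> FF UNIV" "\<And>r z. z \<in> V' \<Longrightarrow> g' r z = const_series g r z"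
    using *[OF g] by blast
  have "C 0 f g x = C 0 (f' 0) (g' 0) x"
  proof (rule C_cong[of "V \<inter> V'"])
    show "f z = f' 0 z" "g z = g' 0 z" if "z \<in> V \<inter> V'" for z
      using V(5)[of z 0] V'(5)[of z 0] that by (auto simp: const_series_def)
  qed (use V V' f g in \<open>auto intro: smooth_fun_subset\<close>)
  also have "\<dots> = f' 0 x * g' 0 x"
    using star_product FF_D[OF V(4)] FF_D[OF V'(4)] by (simp add: star_product_def)
  finally show ?thesis
    using V(5)[OF V(2), of 0] V'(5)[OF V'(2), of 0] by (simp add: const_series_def)
qed

lemma star_coeff_0:
  assumes "open W" "x \<in> W" "f \<in> FF W" "g \<in> FF W"
  shows "(f \<star> g) 0 x = f 0 x * g 0 x"
  using C_0[OF assms(1,2) FF_D[OF assms(3)] FF_D[OF assms(4)]] by (simp add: star_def)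

lemma star_assoc:
  assumes W: "open W" "x \<in> W" and f: "f \<in> FF W" and g: "g \<in> FF W" and h: "h \<in> FF W"
  shows "(f \<star> g \<star> h) r x = (f \<star> (g \<star> h)) r x"
proof -
  obtain V1 f' where 1: "open V1" "x \<in> V1" "V1 \<subseteq> W" "f' \<in> FF UNIV" "\<And>r z. z \<in> V1 \<Longrightarrow> f' r z = f r z"
    using formal_functions_extend[OF W f] by blast
  obtain V2 g' where 2: "open V2" "x \<in> V2" "V2 \<subseteq> W" "g' \<in> FF UNIV" "\<And>r z. z \<in> V2 \<Longrightarrow> g' r z = g r z"
    using formal_functions_extend[OF W g] by blast
  obtain V3 h' where 3: "open V3" "x \<in> V3" "V3 \<subseteq> W" "h' \<in> FF UNIV" "\<And>r z. z \<in> V3 \<Longrightarrow> h' r z = h r z"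
    using formal_functions_extend[OF W h] by blast
  define V where "V = V1 \<inter> V2 \<inter> V3"
  have V: "open V" "x \<in> V" "V \<subseteq> W" using 1 2 3 by (auto simp: V_def)
  have eq: "f r z = f' r z" "g r z = g' r z" "h r z = h' r z" if "z \<in> V" for r z
    using that 1 2 3 by (auto simp: V_def)
  have F: "f \<in> FF V" "g \<in> FF V" "h \<in> FF V"
    using f g h V(3) by (auto intro: formal_functions_subset)
  have fg: "(f \<star> g) r z = (f' \<star> g') r z" and gh: "(g \<star> h) r z = (g' \<star> h') r z" if "z \<in> V" for r z
    using star_cong[OF V(1) that F(1,2) eq(1,2)] star_cong[OF V(1) that F(2,3) eq(2,3)] by auto
  have "(f \<star> g \<star> h) r x = (f' \<star> g' \<star> h') r x"
    by (rule star_cong[OF V(1,2) star_closed[OF V(1) F(1,2)] F(3) fg eq(3)])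
  also have "\<dots> = (f' \<star> (g' \<star> h')) r x"
    using star_product 1(4) 2(4) 3(4) by (simp add: star_product_def)
  also have "\<dots> = (f \<star> (g \<star> h)) r x"
    by (rule star_cong[OF V(1,2) F(1) star_closed[OF V(1) F(2,3)] eq(1) gh, symmetric])
  finally show ?thesis .
qed

lemma const_series_1: "open W \<Longrightarrow> const_series (\<lambda>_. c) \<in> FF W"
  by (rule formal_functions_const_series[OF _ smooth_fun_const])

lemma star_one:
  assumes W: "open W" "x \<in> W" and f: "f \<in> FF W"
  shows star_one_left: "(const_series (\<lambda>_. 1) \<star> f) r x = f r x"
    and star_one_right: "(f \<star> const_series (\<lambda>_. 1)) r x = f r x"
proof -
  let ?e = "const_series (\<lambda>_. 1)"
  obtain V f' where V: "open V" "x \<in> V" "V \<subseteq> W" "f' \<in> FF UNIV" "\<And>r z. z \<in> V \<Longrightarrow> f' r z = f r z"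
    using formal_functions_extend[OF W f] by blast
  have F: "f \<in> FF V" using f V(3) by (rule formal_functions_subset)
  have glob: "?e \<star> f' = f'" "f' \<star> ?e = f'"
    using star_product V(4) by (auto simp: star_product_def)
  have "(?e \<star> f) r x = (?e \<star> f') r x"
    by (rule star_cong[OF V(1,2) const_series_1[OF V(1)] F refl V(5)[symmetric]])
  then show "(?e \<star> f) r x = f r x" using V(2,5) glob by simp
  have "(f \<star> ?e) r x = (f' \<star> ?e) r x"
    by (rule star_cong[OF V(1,2) F const_series_1[OF V(1)] V(5)[symmetric] refl])
  then show "(f \<star> ?e) r x = f r x" using V(2,5) glob by simp
qed

lemma mat_vec_star_closed:
  assumes "open W" "\<And>l. l < k \<Longrightarrow> X i l \<in> FF W" "\<And>l. l < k \<Longrightarrow> v l \<in> FF W"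
  shows "mat_vec_star C k X v i \<in> FF W"
  unfolding mat_vec_star_def
  by (intro formal_functions_sum star_closed) (use assms in auto)

lemma mat_vec_star_cong:
  assumes "open W" "x \<in> W" "\<And>l. l < k \<Longrightarrow> X i l \<in> FF W" "\<And>l. l < k \<Longrightarrow> v l \<in> FF W"
    and "\<And>l r z. l < k \<Longrightarrow> z \<in> W \<Longrightarrow> X i l r z = Y i l r z"
    and "\<And>l r z. l < k \<Longrightarrow> z \<in> W \<Longrightarrow> v l r z = w l r z"
  shows "mat_vec_star C k X v i r x = mat_vec_star C k Y w i r x"
  unfolding mat_vec_star_def
  by (intro sum.cong refl star_cong[OF assms(1,2)]) (use assms in auto)

lemma mat_vec_star_sum:
  assumes "open W" "x \<in> W" "\<And>l. l < k \<Longrightarrow> X i l \<in> FF W"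
    and "\<And>l \<beta>. l < k \<Longrightarrow> \<beta> \<in> B \<Longrightarrow> v \<beta> l \<in> FF W"
  shows "mat_vec_star C k X (\<lambda>l r x. \<Sum>\<beta>\<in>B. v \<beta> l r x) i r x = (\<Sum>\<beta>\<in>B. mat_vec_star C k X (v \<beta>) i r x)"
proof -
  have "mat_vec_star C k X (\<lambda>l r x. \<Sum>\<beta>\<in>B. v \<beta> l r x) i r x =
      (\<Sum>l<k. \<Sum>\<beta>\<in>B. (X i l \<star> v \<beta> l) r x)"
    unfolding mat_vec_star_def
    by (intro sum.cong refl star_sum_right[OF assms(1,2)]) (use assms in auto)
  then show ?thesis
    unfolding mat_vec_star_def by (subst sum.swap) simp
qed

lemma mat_vec_star_add:
  assumes "open W" "x \<in> W" "\<And>l. l < k \<Longrightarrow> X i l \<in> FF W"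
    and "\<And>l. l < k \<Longrightarrow> v l \<in> FF W" "\<And>l. l < k \<Longrightarrow> w l \<in> FF W"
  shows "mat_vec_star C k X (\<lambda>l. v l \<boxplus> w l) i r x =
    mat_vec_star C k X v i r x + mat_vec_star C k X w i r x"
  unfolding mat_vec_star_def sum.distrib[symmetric]
  by (intro sum.cong refl star_add_right[OF assms(1,2)]) (use assms in auto)

lemma mat_vec_star_zero:
  assumes "open W" "x \<in> W" "\<And>l. l < k \<Longrightarrow> X i l \<in> FF W"
    and "\<And>l r z. l < k \<Longrightarrow> z \<in> W \<Longrightarrow> v l r z = 0"
  shows "mat_vec_star C k X v i r x = 0"
proof -
  have "mat_vec_star C k X v i r x = mat_vec_star C k X (\<lambda>_ _ _. 0) i r x"
    by (rule mat_vec_star_cong[where X = X and i = i, OF assms(1,2,3)])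
       (use assms formal_functions_cong[OF assms(1) formal_functions_zero[OF assms(1)]] in auto)
  also have "\<dots> = 0"
    unfolding mat_vec_star_def
    by (intro sum.neutral ballI star_zero_right[OF assms(1,2)]) (use assms in auto)
  finally show ?thesis .
qed

lemma mat_vec_star_shift:
  assumes "open W" "x \<in> W" "\<And>l. l < k \<Longrightarrow> X i l \<in> FF W"
  shows "mat_vec_star C k X (\<lambda>l. formal_shift (v l)) i r x = formal_shift (mat_vec_star C k X v i) r x"
proof -
  have "mat_vec_star C k X (\<lambda>l. formal_shift (v l)) i r x =
      (\<Sum>l<k. formal_shift (X i l \<star> v l) r x)"
    unfolding mat_vec_star_def
    by (intro sum.cong refl star_shift_right[OF assms(1,2)]) (use assms in auto)
  then show ?thesis
    by (cases r) (simp_all add: mat_vec_star_def)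
qed

lemma mat_vec_star_coeff_0:
  assumes "open W" "x \<in> W" "\<And>l. l < k \<Longrightarrow> X i l \<in> FF W" "\<And>l. l < k \<Longrightarrow> v l \<in> FF W"
  shows "mat_vec_star C k X v i 0 x = (\<Sum>l<k. X i l 0 x * v l 0 x)"
  unfolding mat_vec_star_def
  by (intro sum.cong refl star_coeff_0[OF assms(1,2)]) (use assms in auto)

lemma mat_vec_star_star:
  assumes "open W" "x \<in> W" "\<And>l. l < k \<Longrightarrow> X i l \<in> FF W" "\<And>l. l < k \<Longrightarrow> v l \<in> FF W" "f \<in> FF W"
  shows "mat_vec_star C k X (\<lambda>l. v l \<star> f) i r x = (mat_vec_star C k X v i \<star> f) r x"
proof -
  have "mat_vec_star C k X (\<lambda>l. v l \<star> f) i r x = (\<Sum>l<k. (X i l \<star> v l \<star> f) r x)"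
    unfolding mat_vec_star_def
    by (intro sum.cong refl star_assoc[OF assms(1,2), symmetric]) (use assms in auto)
  also have "\<dots> = (mat_vec_star C k X v i \<star> f) r x"
    unfolding mat_vec_star_def
    by (intro star_sum_left[OF assms(1,2), symmetric] star_closed) (use assms in auto)
  finally show ?thesis .
qed

lemma mat_star_eq_mat_vec_star: "mat_star C k X Y i j = mat_vec_star C k X (\<lambda>l. Y l j) i"
  by (simp add: mat_star_def mat_vec_star_def)

lemma mat_vec_star_assoc:
  assumes W: "open W" "x \<in> W" and X: "\<And>l. l < k \<Longrightarrow> X i l \<in> FF W"
    and Y: "\<And>l j. l < k \<Longrightarrow> j < k \<Longrightarrow> Y l j \<in> FF W" and v: "\<And>l. l < k \<Longrightarrow> v l \<in> FF W"
  shows "mat_vec_star C k X (mat_vec_star C k Y v) i r x = mat_vec_star C k (mat_star C k X Y) v i r x"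
proof -
  have "mat_vec_star C k X (mat_vec_star C k Y v) i r x =
      mat_vec_star C k X (\<lambda>l r x. \<Sum>j<k. (Y l j \<star> v j) r x) i r x"
    by (simp add: mat_vec_star_def)
  also have "\<dots> = (\<Sum>j<k. mat_vec_star C k X (\<lambda>l. Y l j \<star> v j) i r x)"
    by (rule mat_vec_star_sum[where X = X and i = i, OF W X]) (use Y v W in \<open>auto intro: star_closed\<close>)
  also have "\<dots> = (\<Sum>j<k. (mat_vec_star C k X (\<lambda>l. Y l j) i \<star> v j) r x)"
    by (intro sum.cong refl mat_vec_star_star[where X = X and i = i, OF W X]) (use Y v in auto)
  also have "\<dots> = mat_vec_star C k (mat_star C k X Y) v i r x"
    by (simp add: mat_vec_star_def[of C k "mat_star C k X Y"] mat_star_eq_mat_vec_star)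
  finally show ?thesis .
qed

lemma mat_vec_star_id:
  assumes W: "open W" "x \<in> W" and v: "\<And>l. l < k \<Longrightarrow> v l \<in> FF W" and i: "i < k"
  shows "mat_vec_star C k id_mat v i r x = v i r x"
proof -
  have 0: "const_series (\<lambda>_. 0) = (\<lambda>_ _. 0 :: complex)"
    by (auto simp: const_series_def)
  have "(id_mat i l \<star> v l) r x = (if l = i then v i r x else 0)" if "l < k" for l
    using that v star_one_left[OF W v[OF that]] star_zero_left[OF W v[OF that]]
    by (auto simp: id_mat_def 0)
  then show ?thesis
    using i by (simp add: mat_vec_star_def)
qed

end

section \<open>Frames and smooth sections\<close>

context smooth_manifold
begin

lemma smooth_fun_det:
  assumes W: "open W" and G: "\<And>i j. i < k \<Longrightarrow> j < k \<Longrightarrow> smooth_fun n A W (G i j)"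
  shows "smooth_fun n A W (\<lambda>x. Determinant.det (Matrix.mat k k (\<lambda>(i, j). G i j x)) :: complex)"
proof -
  have "smooth_fun n A W (\<lambda>x. \<Sum>p\<in>{p. p permutes {0..<k}}. signof p * (\<Prod>i=0..<k. G i (p i) x))"
  proof (intro smooth_fun_sum smooth_fun_mult smooth_fun_const smooth_fun_prod W G)
    show "p i < k" if "p \<in> {p. p permutes {0..<k}}" "i \<in> {0..<k}" for p i
      using that permutes_in_image[of p "{0..<k}" i] by auto
  qed auto
  then show ?thesis
  proof (rule smooth_fun_cong[OF W])
    fix x
    show "(\<Sum>p\<in>{p. p permutes {0..<k}}. signof p * (\<Prod>i=0..<k. G i (p i) x)) =
      Determinant.det (Matrix.mat k k (\<lambda>(i, j). G i j x))"
      unfolding det_def'[OF mat_carrier]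
      by (intro sum.cong refl arg_cong2[where f = "(*)"] prod.cong)
         (auto simp: permutes_in_image)
  qed
qed

lemma smooth_fun_cofactor:
  assumes W: "open W" and G: "\<And>i j. i < k \<Longrightarrow> j < k \<Longrightarrow> smooth_fun n A W (G i j)"
  shows "smooth_fun n A W (\<lambda>x. cofactor (Matrix.mat k k (\<lambda>(i, j). G i j x)) a b :: complex)"
proof -
  let ?s = "\<lambda>a i. if i < a then i else Suc i"
  have "mat_delete (Matrix.mat k k (\<lambda>(i, j). G i j x)) a b =
      Matrix.mat (k - 1) (k - 1) (\<lambda>(i, j). G (?s a i) (?s b j) x)" for x
    by (rule eq_matI) (auto simp: mat_delete_def)
  then show ?thesis
    unfolding cofactor_def
    by (simp only:) (intro smooth_fun_mult smooth_fun_const smooth_fun_det W G; auto)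
qed

text \<open>
  By Cramer's rule the entries of an inverse matrix are quotients of polynomials in the entries of
  the matrix, with the determinant as denominator.
\<close>

lemma smooth_fun_inverse_matrix:
  fixes G H :: "nat \<Rightarrow> nat \<Rightarrow> 'm \<Rightarrow> complex"
  assumes W: "open W" and G: "\<And>i j. i < k \<Longrightarrow> j < k \<Longrightarrow> smooth_fun n A W (G i j)"
    and HG: "\<And>i j x. i < k \<Longrightarrow> j < k \<Longrightarrow> x \<in> W \<Longrightarrow>
      (\<Sum>l<k. H i l x * G l j x) = (if i = j then 1 else 0)"
    and ij: "i < k" "j < k"
  shows "smooth_fun n A W (H i j)"
proof -
  define M where "M x = Matrix.mat k k (\<lambda>(i, j). G i j x)" for x
  define N where "N x = Matrix.mat k k (\<lambda>(i, j). H i j x)" for x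
  have c: "M x \<in> carrier_mat k k" "N x \<in> carrier_mat k k" for x
    by (simp_all add: M_def N_def)
  have NM: "N x * M x = 1\<^sub>m k" if "x \<in> W" for x
    by (rule eq_matI)
       (auto simp: M_def N_def scalar_prod_def HG[OF _ _ that] lessThan_atLeast0[symmetric])
  have det: "Determinant.det (M x) \<noteq> 0" if "x \<in> W" for x
    using arg_cong[OF NM[OF that], of Determinant.det] det_mult[OF c(2,1), of x x] by auto
  have eq: "cofactor (M x) j i * inverse (Determinant.det (M x)) = H i j x" if x: "x \<in> W" for x
  proof -
    have adj: "adj_mat (M x) \<in> carrier_mat k k" "M x * adj_mat (M x) = Determinant.det (M x) \<cdot>\<^sub>m 1\<^sub>m k"
      using adj_mat[OF c(1)[of x]] by auto
    have "adj_mat (M x) = N x * M x * adj_mat (M x)"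
      using NM[OF x] adj(1) by simp
    also have "\<dots> = N x * (Determinant.det (M x) \<cdot>\<^sub>m 1\<^sub>m k)"
      using assoc_mult_mat[OF c(2,1) adj(1)] adj(2) by simp
    also have "\<dots> = Determinant.det (M x) \<cdot>\<^sub>m N x"
      using c(2)[of x] by (simp add: mult_smult_distrib[OF c(2) one_carrier_mat])
    finally have "adj_mat (M x) $$ (i, j) = Determinant.det (M x) * H i j x"
      using ij by (simp add: N_def)
    then have "cofactor (M x) j i = Determinant.det (M x) * H i j x"
      using ij by (simp add: adj_mat_def M_def)
    then show ?thesis using det[OF x] by simp
  qed
  have "smooth_fun n A W (\<lambda>x. cofactor (M x) j i * inverse (Determinant.det (M x)))"
  proof (intro smooth_fun_mult smooth_fun_inverse W det)
    show "smooth_fun n A W (\<lambda>x. cofactor (M x) j i)"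
      unfolding M_def by (rule smooth_fun_cofactor[OF W G])
    show "smooth_fun n A W (\<lambda>x. Determinant.det (M x))"
      unfolding M_def by (rule smooth_fun_det[OF W G])
  qed
  then show ?thesis
    by (rule smooth_fun_cong[OF W]) (rule eq)
qed

end

lemma frame_expand:
  assumes vs: "vector_space scl" and fr: "frame_on scl E k U e" and x: "x \<in> U" and s: "s x \<in> E x"
  shows "s x = (\<Sum>i<k. scl (frame_component scl k e s i x) (e i x))"
proof -
  interpret vector_space scl by (rule vs)
  let ?B = "(\<lambda>i. e i x) ` {..<k}"
  have 1: "inj_on (\<lambda>i. e i x) {..<k}" "independent ?B" "s x \<in> span ?B"
    using fr x s by (auto simp: frame_on_def)
  have "(\<Sum>b\<in>?B. scl (representation ?B (s x) b) b) = s x"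
    by (rule sum_representation_eq[OF 1(2,3)]) auto
  then show ?thesis
    using sum.reindex[OF 1(1), of "\<lambda>b. scl (representation ?B (s x) b) b"]
    by (simp add: frame_component_def)
qed

lemma frame_in:
  assumes vs: "vector_space scl" and fr: "frame_on scl E k U e" and x: "x \<in> U"
  shows "(\<Sum>i<k. scl (c i) (e i x)) \<in> E x"
proof -
  interpret vector_space scl by (rule vs)
  have "(\<Sum>i<k. scl (c i) (e i x)) \<in> span ((\<lambda>i. e i x) ` {..<k})"
    by (intro span_sum span_scale span_base) auto
  then show ?thesis using fr x by (simp add: frame_on_def)
qed

lemma frame_component_eqI:
  assumes vs: "vector_space scl" and fr: "frame_on scl E k U e" and x: "x \<in> U"
    and s: "s x = (\<Sum>i<k. scl (c i) (e i x))" and i: "i < k"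
  shows "frame_component scl k e s i x = c i"
proof -
  interpret vector_space scl by (rule vs)
  let ?f = "\<lambda>i. e i x" and ?d = "\<lambda>i. frame_component scl k e s i x - c i"
  have 1: "inj_on ?f {..<k}" "independent (?f ` {..<k})"
    using fr x by (auto simp: frame_on_def)
  have "s x \<in> E x" unfolding s by (rule frame_in[OF vs fr x])
  from frame_expand[OF vs fr x, where s = s, OF this] have "(\<Sum>i<k. scl (?d i) (e i x)) = 0"
    using s by (simp add: scale_left_diff_distrib sum_subtractf)
  moreover have "(\<Sum>b\<in>?f ` {..<k}. scl (?d (inv_into {..<k} ?f b)) b) = (\<Sum>i<k. scl (?d i) (e i x))"
    by (subst sum.reindex[OF 1(1)]) (simp add: inv_into_f_f[OF 1(1)])
  ultimately have "?d (inv_into {..<k} ?f (e i x)) = 0"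
    by (intro independentD[OF 1(2), of "?f ` {..<k}" "\<lambda>b. ?d (inv_into {..<k} ?f b)"]) (use i in auto)
  then show ?thesis
    using inv_into_f_f[OF 1(1), of i] i by simp
qed

locale star_bundle = star_manifold n A P C
  for n and A :: "'m::t2_space chart set" and P C +
  fixes scl :: "complex \<Rightarrow> 'v::ab_group_add \<Rightarrow> 'v"
    and E :: "'m \<Rightarrow> 'v set" and k :: nat
    and F :: "('m set \<times> (nat \<Rightarrow> 'm \<Rightarrow> 'v)) set"
    and m :: nat and U :: "nat \<Rightarrow> 'm set" and e :: "nat \<Rightarrow> nat \<Rightarrow> 'm \<Rightarrow> 'v"
    and \<phi> :: "nat \<Rightarrow> nat \<Rightarrow> nat \<Rightarrow> nat \<Rightarrow> 'm \<Rightarrow> complex"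
    and \<Phi> :: "nat \<Rightarrow> nat \<Rightarrow> nat \<Rightarrow> nat \<Rightarrow> 'm fseries"
    and \<rho> :: "nat \<Rightarrow> 'm \<Rightarrow> real"
  assumes vbundle: "vector_bundle n A scl E k F"
    and open_U: "\<And>\<alpha>. \<alpha> \<in> {1..m} \<Longrightarrow> open (U \<alpha>)"
    and cover: "(\<Union>\<alpha>\<in>{1..m}. U \<alpha>) = UNIV"
    and frames: "\<And>\<alpha>. \<alpha> \<in> {1..m} \<Longrightarrow> smooth_frame n A scl E k F (U \<alpha>) (e \<alpha>)"
    and transition: "transition_matrices scl k m U e \<phi>"
    and deformed: "deformed_transition_matrices n A C k m U \<phi> \<Phi>"
    and partition: "smooth_partition_of_unity n A m U \<rho>"
begin

lemma vs: "vector_space scl"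
  using vbundle by (simp add: vector_bundle_def)

sublocale V: vector_space scl by (rule vs)

lemma bundle_frame:
  assumes "(V, e') \<in> F" shows "open V" "frame_on scl E k V e'"
  using vbundle[unfolded vector_bundle_def, THEN conjunct2, THEN conjunct2, THEN conjunct1, THEN bspec, OF assms]
  by auto

lemma bundle_frame_exists: obtains V e' where "(V, e') \<in> F" "x \<in> V"
proof -
  have "x \<in> (\<Union>(V, e')\<in>F. V)"
    using vbundle[unfolded vector_bundle_def, THEN conjunct2, THEN conjunct1] by simp
  then show ?thesis using that by auto
qed

lemma frame_U: "\<alpha> \<in> {1..m} \<Longrightarrow> frame_on scl E k (U \<alpha>) (e \<alpha>)"
  using frames by (simp add: smooth_frame_def)

lemma cover_exists: obtains \<alpha> where "\<alpha> \<in> {1..m}" "x \<in> U \<alpha>"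
  using cover by blast

abbreviation comp :: "nat \<Rightarrow> ('m \<Rightarrow> 'v) \<Rightarrow> nat \<Rightarrow> 'm \<Rightarrow> complex" where
  "comp \<alpha> s i \<equiv> frame_component scl k (e \<alpha>) s i"

abbreviation smooth_sec :: "('m \<Rightarrow> 'v) \<Rightarrow> bool" where
  "smooth_sec s \<equiv> smooth_section n A scl E k F UNIV s"

lemma smooth_sectionD:
  assumes "smooth_section n A scl E k F W s"
  shows "x \<in> W \<Longrightarrow> s x \<in> E x"
    and "(V, e') \<in> F \<Longrightarrow> i < k \<Longrightarrow> smooth_fun n A (V \<inter> W) (frame_component scl k e' s i)"
  using assms unfolding smooth_section_def by auto

lemma comp_add:
  assumes "\<alpha> \<in> {1..m}" "x \<in> U \<alpha>" "s x \<in> E x" "t x \<in> E x" "i < k"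
  shows "comp \<alpha> (\<lambda>x. s x + t x) i x = comp \<alpha> s i x + comp \<alpha> t i x"
proof (rule frame_component_eqI[OF vs frame_U[OF assms(1)] assms(2) _ assms(5)])
  show "s x + t x = (\<Sum>i<k. scl (comp \<alpha> s i x + comp \<alpha> t i x) (e \<alpha> i x))"
    using frame_expand[OF vs frame_U[OF assms(1)] assms(2), of s, OF assms(3)]
      frame_expand[OF vs frame_U[OF assms(1)] assms(2), of t, OF assms(4)]
    by (simp add: V.scale_left_distrib sum.distrib)
qed

lemma comp_eqI:
  assumes "\<And>\<alpha> i. \<alpha> \<in> {1..m} \<Longrightarrow> i < k \<Longrightarrow> x \<in> U \<alpha> \<Longrightarrow> comp \<alpha> s i x = comp \<alpha> t i x"
    and "s x \<in> E x" "t x \<in> E x"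
  shows "s x = t x"
proof -
  obtain \<alpha> where \<alpha>: "\<alpha> \<in> {1..m}" "x \<in> U \<alpha>" by (rule cover_exists)
  show ?thesis
    using frame_expand[OF vs frame_U[OF \<alpha>(1)] \<alpha>(2), of s, OF assms(2)]
      frame_expand[OF vs frame_U[OF \<alpha>(1)] \<alpha>(2), of t, OF assms(3)] assms(1)[OF \<alpha>(1) _ \<alpha>(2)]
    by simp
qed

text \<open>
  Smoothness of a section is tested in the frames of the bundle atlas. The components in the frame
  \<open>e \<alpha>\<close> arise from those by the inverse of the matrix which expresses \<open>e \<alpha>\<close> in a frame of the atlas,
  and only the latter matrix is smooth by assumption.
\<close>

lemma comp_smooth:
  assumes s: "smooth_sec s" and \<alpha>: "\<alpha> \<in> {1..m}" and i: "i < k"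
  shows "smooth_fun n A (U \<alpha>) (comp \<alpha> s i)"
proof (rule smooth_fun_local)
  fix x assume x: "x \<in> U \<alpha>"
  obtain V e' where V: "(V, e') \<in> F" "x \<in> V" by (rule bundle_frame_exists)
  note V' = bundle_frame[OF V(1)]
  let ?W = "V \<inter> U \<alpha>"
  have W: "open ?W" using V'(1) open_U[OF \<alpha>] by auto
  define G where "G i j = frame_component scl k e' (e \<alpha> j) i" for i j
  define H where "H i j = comp \<alpha> (e' j) i" for i j
  have sec: "smooth_section n A scl E k F (U \<alpha>) (e \<alpha> j)" if "j < k" for j
    using frames[OF \<alpha>] that by (simp add: smooth_frame_def)
  have G: "smooth_fun n A ?W (G i j)" if "i < k" "j < k" for i j
    unfolding G_def by (rule smooth_sectionD(2)[OF sec[OF that(2)] V(1) that(1)])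
  have e': "e' l z = (\<Sum>i<k. scl (H i l z) (e \<alpha> i z))" if "l < k" "z \<in> ?W" for l z
  proof -
    have "e' l z = (\<Sum>i<k. scl (if i = l then 1 else 0) (e' i z))"
      using that(1) by (simp add: if_distrib[of "\<lambda>c. scl c _"] cong: if_cong)
    then have "e' l z \<in> E z"
      using frame_in[OF vs V'(2), of z "\<lambda>i. if i = l then 1 else 0"] that(2) by simp
    then show ?thesis
      unfolding H_def using that by (intro frame_expand[OF vs frame_U[OF \<alpha>]]) auto
  qed
  have expand: "comp \<alpha> t i z = (\<Sum>l<k. H i l z * frame_component scl k e' t l z)"
    if "i < k" "z \<in> ?W" "t z \<in> E z" for t i z
  proof (rule frame_component_eqI[OF vs frame_U[OF \<alpha>] _ _ that(1)])
    have "t z = (\<Sum>l<k. scl (frame_component scl k e' t l z) (e' l z))"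
      using that by (intro frame_expand[OF vs V'(2)]) auto
    also have "\<dots> = (\<Sum>l<k. scl (frame_component scl k e' t l z) (\<Sum>i<k. scl (H i l z) (e \<alpha> i z)))"
      using that(2) by (intro sum.cong refl arg_cong[where f = "scl _"] e') auto
    also have "\<dots> = (\<Sum>i<k. \<Sum>l<k. scl (H i l z * frame_component scl k e' t l z) (e \<alpha> i z))"
      by (subst sum.swap) (simp add: V.scale_sum_right mult.commute)
    finally show "t z = (\<Sum>i<k. scl (\<Sum>l<k. H i l z * frame_component scl k e' t l z) (e \<alpha> i z))"
      by (simp add: V.scale_sum_left)
  qed (use that in auto)
  have HG: "(\<Sum>l<k. H i l z * G l j z) = (if i = j then 1 else 0)"
    if "i < k" "j < k" "z \<in> ?W" for i j z
  proof -
    have "e \<alpha> j z \<in> E z" using smooth_sectionD(1)[OF sec[OF that(2)]] that(3) by simp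
    from expand[of i z "e \<alpha> j", OF that(1,3) this]
    have "(\<Sum>l<k. H i l z * G l j z) = comp \<alpha> (e \<alpha> j) i z" by (simp add: G_def)
    also have "\<dots> = (if i = j then 1 else 0)"
      by (rule frame_component_eqI[OF vs frame_U[OF \<alpha>]])
         (use that in \<open>auto simp: if_distrib[of "\<lambda>c. scl c _"] cong: if_cong\<close>)
    finally show ?thesis .
  qed
  have H: "smooth_fun n A ?W (H i j)" if "i < k" "j < k" for i j
    by (rule smooth_fun_inverse_matrix[OF W G HG that])
  have "smooth_fun n A ?W (\<lambda>z. \<Sum>l<k. H i l z * frame_component scl k e' s l z)"
    by (intro smooth_fun_sum smooth_fun_mult W H i smooth_fun_subset[OF smooth_sectionD(2)[OF s V(1)]]) auto
  then have "smooth_fun n A ?W (comp \<alpha> s i)"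
    by (rule smooth_fun_cong[OF W]) (use expand[OF i] smooth_sectionD(1)[OF s] in auto)
  then show "\<exists>V. open V \<and> x \<in> V \<and> V \<subseteq> U \<alpha> \<and> smooth_fun n A V (comp \<alpha> s i)"
    using W V(2) x by (intro exI[of _ ?W]) auto
qed

lemma transitionD:
  assumes "\<alpha> \<in> {1..m}" "\<beta> \<in> {1..m}" "x \<in> U \<alpha>" "x \<in> U \<beta>" "j < k"
  shows "e \<beta> j x = (\<Sum>i<k. scl (\<phi> \<alpha> \<beta> i j x) (e \<alpha> i x))"
  using transition assms unfolding transition_matrices_def by blast

lemma frame_change:
  assumes "\<alpha> \<in> {1..m}" "\<beta> \<in> {1..m}" "x \<in> U \<alpha>" "x \<in> U \<beta>"
  shows "(\<Sum>j<k. scl (c j) (e \<beta> j x)) = (\<Sum>i<k. scl (\<Sum>j<k. \<phi> \<alpha> \<beta> i j x * c j) (e \<alpha> i x))"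
proof -
  have "(\<Sum>j<k. scl (c j) (e \<beta> j x)) = (\<Sum>j<k. \<Sum>i<k. scl (\<phi> \<alpha> \<beta> i j x * c j) (e \<alpha> i x))"
    using transitionD[OF assms] by (simp add: V.scale_sum_right mult.commute)
  also have "\<dots> = (\<Sum>i<k. scl (\<Sum>j<k. \<phi> \<alpha> \<beta> i j x * c j) (e \<alpha> i x))"
    by (subst sum.swap) (simp add: V.scale_sum_left)
  finally show ?thesis .
qed

lemma comp_change:
  assumes "\<alpha> \<in> {1..m}" "\<beta> \<in> {1..m}" "x \<in> U \<alpha>" "x \<in> U \<beta>" "s x \<in> E x" "i < k"
  shows "(\<Sum>j<k. \<phi> \<alpha> \<beta> i j x * comp \<beta> s j x) = comp \<alpha> s i x"
  by (rule frame_component_eqI[OF vs frame_U[OF assms(1)] assms(3) _ assms(6), symmetric])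
     (simp add: frame_change[OF assms(1-4), symmetric]
       frame_expand[OF vs frame_U[OF assms(2)] assms(4), of s, OF assms(5), symmetric])

lemma section_of_components:
  assumes c: "\<And>\<alpha> i. \<alpha> \<in> {1..m} \<Longrightarrow> i < k \<Longrightarrow> smooth_fun n A (U \<alpha>) (c \<alpha> i)"
    and compat: "\<And>\<alpha> \<beta> i x. \<alpha> \<in> {1..m} \<Longrightarrow> \<beta> \<in> {1..m} \<Longrightarrow> i < k \<Longrightarrow> x \<in> U \<alpha> \<Longrightarrow> x \<in> U \<beta> \<Longrightarrow>
      (\<Sum>j<k. \<phi> \<alpha> \<beta> i j x * c \<beta> j x) = c \<alpha> i x"
  shows "\<exists>s. smooth_sec s \<and> (\<forall>\<alpha>\<in>{1..m}. \<forall>i<k. \<forall>x\<in>U \<alpha>. comp \<alpha> s i x = c \<alpha> i x)"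
proof -
  define a where "a x = (SOME \<alpha>. \<alpha> \<in> {1..m} \<and> x \<in> U \<alpha>)" for x
  have a: "a x \<in> {1..m}" "x \<in> U (a x)" for x
  proof -
    obtain \<alpha> where "\<alpha> \<in> {1..m} \<and> x \<in> U \<alpha>" using cover_exists by blast
    then have "a x \<in> {1..m} \<and> x \<in> U (a x)" unfolding a_def by (rule someI)
    then show "a x \<in> {1..m}" "x \<in> U (a x)" by auto
  qed
  define s where "s x = (\<Sum>i<k. scl (c (a x) i x) (e (a x) i x))" for x
  have s: "s x = (\<Sum>i<k. scl (c \<alpha> i x) (e \<alpha> i x))" if "\<alpha> \<in> {1..m}" "x \<in> U \<alpha>" for \<alpha> x
    unfolding s_def frame_change[OF that(1) a(1) that(2) a(2)]
    by (intro sum.cong refl arg_cong2[where f = scl] compat that a) auto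
  have s_in: "s x \<in> E x" for x
    unfolding s_def by (rule frame_in[OF vs frame_U[OF a(1)] a(2)])
  have comp_s: "comp \<alpha> s i x = c \<alpha> i x" if "\<alpha> \<in> {1..m}" "i < k" "x \<in> U \<alpha>" for \<alpha> i x
    by (rule frame_component_eqI[OF vs frame_U[OF that(1)] that(3) _ that(2)]) (rule s[OF that(1,3)])
  have "smooth_fun n A V (frame_component scl k e' s i)" if V: "(V, e') \<in> F" and i: "i < k" for V e' i
  proof (rule smooth_fun_local)
    fix x assume x: "x \<in> V"
    note V' = bundle_frame[OF V]
    obtain \<alpha> where \<alpha>: "\<alpha> \<in> {1..m}" "x \<in> U \<alpha>" by (rule cover_exists)
    let ?W = "V \<inter> U \<alpha>"
    have W: "open ?W" using V'(1) open_U[OF \<alpha>(1)] by auto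
    have sec: "smooth_section n A scl E k F (U \<alpha>) (e \<alpha> j)" if "j < k" for j
      using frames[OF \<alpha>(1)] that by (simp add: smooth_frame_def)
    have "smooth_fun n A ?W (\<lambda>z. \<Sum>j<k. frame_component scl k e' (e \<alpha> j) i z * c \<alpha> j z)"
      by (intro smooth_fun_sum smooth_fun_mult W smooth_sectionD(2)[OF sec V i]
          smooth_fun_subset[OF c[OF \<alpha>(1)]]) auto
    then have "smooth_fun n A ?W (frame_component scl k e' s i)"
    proof (rule smooth_fun_cong[OF W])
      fix z assume z: "z \<in> ?W"
      have "e \<alpha> j z = (\<Sum>i<k. scl (frame_component scl k e' (e \<alpha> j) i z) (e' i z))" if "j < k" for j
        using z smooth_sectionD(1)[OF sec[OF that]] by (intro frame_expand[OF vs V'(2)]) auto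
      then have "s z = (\<Sum>j<k. \<Sum>i<k. scl (frame_component scl k e' (e \<alpha> j) i z * c \<alpha> j z) (e' i z))"
        using s[OF \<alpha>(1), of z] z by (simp add: V.scale_sum_right mult.commute)
      then have "s z = (\<Sum>i<k. scl (\<Sum>j<k. frame_component scl k e' (e \<alpha> j) i z * c \<alpha> j z) (e' i z))"
        by (subst (asm) sum.swap) (simp add: V.scale_sum_left)
      then show "(\<Sum>j<k. frame_component scl k e' (e \<alpha> j) i z * c \<alpha> j z) = frame_component scl k e' s i z"
        using z by (intro frame_component_eqI[OF vs V'(2) _ _ i, symmetric]) auto
    qed
    then show "\<exists>Va. open Va \<and> x \<in> Va \<and> Va \<subseteq> V \<and> smooth_fun n A Va (frame_component scl k e' s i)"
      using W \<alpha>(2) x by (intro exI[of _ ?W]) auto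
  qed
  then have "smooth_sec s"
    using s_in by (auto simp: smooth_section_def)
  then show ?thesis using comp_s by (intro exI[of _ s] conjI ballI allI impI)
qed

lemma smooth_section_zero: "smooth_sec (\<lambda>_. 0)"
proof -
  have "frame_component scl k e' (\<lambda>_. 0) i x = 0" if "(V, e') \<in> F" "i < k" "x \<in> V" for V e' i x
    by (rule frame_component_eqI[OF vs bundle_frame(2)[OF that(1)] that(3) _ that(2)]) simp
  then have "smooth_fun n A V (frame_component scl k e' (\<lambda>_. 0) i)" if "(V, e') \<in> F" "i < k" for V e' i
    using that smooth_fun_cong[OF bundle_frame(1)[OF that(1)] smooth_fun_const[of V 0]]
      bundle_frame(1)[OF that(1)] by metis
  moreover have "0 \<in> E x" for x
  proof -
    obtain \<alpha> where \<alpha>: "\<alpha> \<in> {1..m}" "x \<in> U \<alpha>" by (rule cover_exists)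
    then show ?thesis using frame_in[OF vs frame_U[OF \<alpha>(1)] \<alpha>(2), of "\<lambda>_. 0"] by simp
  qed
  ultimately show ?thesis by (auto simp: smooth_section_def)
qed

lemma smooth_section_add_scaled:
  assumes s: "smooth_sec s" and t: "smooth_sec t"
  shows "smooth_sec (\<lambda>x. s x + scl a (t x))"
proof -
  note st = smooth_sectionD(1)[OF s UNIV_I] smooth_sectionD(1)[OF t UNIV_I]
  have "smooth_fun n A V (frame_component scl k e' (\<lambda>x. s x + scl a (t x)) i)"
    if V: "(V, e') \<in> F" and i: "i < k" for V e' i
  proof (rule smooth_fun_cong[OF bundle_frame(1)[OF V]])
    show "smooth_fun n A V (\<lambda>x. frame_component scl k e' s i x + a * frame_component scl k e' t i x)"
      using smooth_sectionD(2)[OF s V i] smooth_sectionD(2)[OF t V i]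
      by (intro smooth_fun_add smooth_fun_mult smooth_fun_const bundle_frame(1)[OF V]) simp_all
    show "frame_component scl k e' s i x + a * frame_component scl k e' t i x =
        frame_component scl k e' (\<lambda>x. s x + scl a (t x)) i x" if x: "x \<in> V" for x
    proof (rule frame_component_eqI[OF vs bundle_frame(2)[OF V] x _ i, symmetric])
      note expand = frame_expand[OF vs bundle_frame(2)[OF V] x]
      have "scl a (t x) = (\<Sum>i<k. scl (a * frame_component scl k e' t i x) (e' i x))"
        using arg_cong[OF expand[of t, OF st(2)], of "scl a"] by (simp add: V.scale_sum_right)
      then show "s x + scl a (t x) = (\<Sum>i<k. scl (frame_component scl k e' s i x +
          a * frame_component scl k e' t i x) (e' i x))"
        using expand[of s, OF st(1)] by (simp add: V.scale_left_distrib sum.distrib)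
    qed
  qed
  moreover have "s x + scl a (t x) \<in> E x" for x
  proof -
    obtain \<alpha> where \<alpha>: "\<alpha> \<in> {1..m}" "x \<in> U \<alpha>" by (rule cover_exists)
    then have "E x = V.span ((\<lambda>i. e \<alpha> i x) ` {..<k})"
      using frame_U[OF \<alpha>(1)] by (simp add: frame_on_def)
    then show ?thesis using st[of x] V.span_add V.span_scale by metis
  qed
  ultimately show ?thesis by (auto simp: smooth_section_def)
qed

lemma smooth_section_add: "smooth_sec s \<Longrightarrow> smooth_sec t \<Longrightarrow> smooth_sec (\<lambda>x. s x + t x)"
  using smooth_section_add_scaled[of s t 1] by simp

lemma smooth_section_minus: "smooth_sec s \<Longrightarrow> smooth_sec (\<lambda>x. - s x)"
  using smooth_section_add_scaled[OF smooth_section_zero, of s "- 1"] by simp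

end

section \<open>Collections compatible with the deformed transition matrices\<close>

context star_bundle
begin

abbreviation mv :: "(nat \<Rightarrow> nat \<Rightarrow> 'm fseries) \<Rightarrow> (nat \<Rightarrow> 'm fseries) \<Rightarrow> nat \<Rightarrow> 'm fseries" where
  "mv \<equiv> mat_vec_star C k"

lemma deformedD:
  assumes "\<alpha> \<in> {1..m}" "\<beta> \<in> {1..m}"
  shows "i < k \<Longrightarrow> j < k \<Longrightarrow> \<Phi> \<alpha> \<beta> i j \<in> FF (U \<alpha> \<inter> U \<beta>)"
    and "i < k \<Longrightarrow> j < k \<Longrightarrow> x \<in> U \<alpha> \<Longrightarrow> x \<in> U \<beta> \<Longrightarrow> \<Phi> \<alpha> \<beta> i j 0 x = \<phi> \<alpha> \<beta> i j x"
    and "i < k \<Longrightarrow> j < k \<Longrightarrow> x \<in> U \<alpha> \<Longrightarrow> x \<in> U \<beta> \<Longrightarrow>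
      mat_star C k (\<Phi> \<alpha> \<beta>) (\<Phi> \<beta> \<alpha>) i j r x = id_mat i j r x"
    and "\<gamma> \<in> {1..m} \<Longrightarrow> i < k \<Longrightarrow> j < k \<Longrightarrow> x \<in> U \<alpha> \<Longrightarrow> x \<in> U \<beta> \<Longrightarrow> x \<in> U \<gamma> \<Longrightarrow>
      mat_star C k (mat_star C k (\<Phi> \<alpha> \<beta>) (\<Phi> \<beta> \<gamma>)) (\<Phi> \<gamma> \<alpha>) i j r x = id_mat i j r x"
proof -
  note d = deformed[unfolded deformed_transition_matrices_def mat_eq_on_def]
  note 1 = d[THEN conjunct1, THEN bspec, OF assms(1), THEN bspec, OF assms(2)]
    and 2 = d[THEN conjunct2, THEN bspec, OF assms(1), THEN bspec, OF assms(2), THEN bspec]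
  show "\<Phi> \<alpha> \<beta> i j \<in> FF (U \<alpha> \<inter> U \<beta>)" if "i < k" "j < k"
    using 1[THEN conjunct1, rule_format, OF that] by (rule conjunct1)
  show "\<Phi> \<alpha> \<beta> i j 0 x = \<phi> \<alpha> \<beta> i j x" if "i < k" "j < k" "x \<in> U \<alpha>" "x \<in> U \<beta>"
    using 1[THEN conjunct1, rule_format, OF that(1,2), THEN conjunct2] that(3,4) by (simp only: Int_iff)
  show "mat_star C k (\<Phi> \<alpha> \<beta>) (\<Phi> \<beta> \<alpha>) i j r x = id_mat i j r x"
    if "i < k" "j < k" "x \<in> U \<alpha>" "x \<in> U \<beta>"
    using 1[THEN conjunct2, THEN conjunct1, rule_format, OF that(1,2)] that(3,4) by (simp only: Int_iff)
  show "mat_star C k (mat_star C k (\<Phi> \<alpha> \<beta>) (\<Phi> \<beta> \<gamma>)) (\<Phi> \<gamma> \<alpha>) i j r x = id_mat i j r x"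
    if "\<gamma> \<in> {1..m}" "i < k" "j < k" "x \<in> U \<alpha>" "x \<in> U \<beta>" "x \<in> U \<gamma>"
    using 2[OF that(1), rule_format, OF that(2,3)] that(4-6) by (simp only: Int_iff)
qed

lemma Phi_FF:
  assumes "\<alpha> \<in> {1..m}" "\<beta> \<in> {1..m}" "W \<subseteq> U \<alpha>" "W \<subseteq> U \<beta>" "i < k" "j < k"
  shows "\<Phi> \<alpha> \<beta> i j \<in> FF W"
  by (rule formal_functions_subset[OF deformedD(1)[OF assms(1,2,5,6)]]) (use assms in blast)

lemma mat_vec_star_id_column:
  assumes W: "open W" "x \<in> W" and X: "\<And>l. l < k \<Longrightarrow> X i l \<in> FF W" and j: "j < k"
  shows "mv X (\<lambda>l. id_mat l j) i r x = X i j r x"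
proof -
  have 0: "const_series (\<lambda>_. 0) = (\<lambda>_ _. 0 :: complex)"
    by (auto simp: const_series_def)
  have "(X i l \<star> id_mat l j) r x = (if l = j then X i j r x else 0)" if "l < k" for l
    using star_one_right[OF W X[OF that]] star_zero_right[OF W X[OF that]]
    by (auto simp: id_mat_def 0)
  then show ?thesis
    using j by (simp add: mat_vec_star_def)
qed

text \<open>
  The inverse of \<open>\<Phi>\<^sub>\<gamma>\<^sub>\<alpha>\<close> being \<open>\<Phi>\<^sub>\<alpha>\<^sub>\<gamma>\<close>, the two identities for the deformed transition matrices combine
  to the cocycle identity \<open>\<Phi>\<^sub>\<alpha>\<^sub>\<beta> \<star> \<Phi>\<^sub>\<beta>\<^sub>\<gamma> = \<Phi>\<^sub>\<alpha>\<^sub>\<gamma>\<close>.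
\<close>

lemma Phi_cocycle:
  assumes a: "\<alpha> \<in> {1..m}" and b: "\<beta> \<in> {1..m}" and c: "\<gamma> \<in> {1..m}"
    and x: "x \<in> U \<alpha>" "x \<in> U \<beta>" "x \<in> U \<gamma>" and ij: "i < k" "j < k"
  shows "mat_star C k (\<Phi> \<alpha> \<beta>) (\<Phi> \<beta> \<gamma>) i j r x = \<Phi> \<alpha> \<gamma> i j r x"
proof -
  let ?W = "U \<alpha> \<inter> U \<beta> \<inter> U \<gamma>" and ?Y = "mat_star C k (\<Phi> \<alpha> \<beta>) (\<Phi> \<beta> \<gamma>)"
  have W: "open ?W" "x \<in> ?W" using open_U a b c x by auto
  have FP: "\<Phi> \<alpha> \<beta> i j \<in> FF ?W" "\<Phi> \<beta> \<gamma> i j \<in> FF ?W" "\<Phi> \<gamma> \<alpha> i j \<in> FF ?W" "\<Phi> \<alpha> \<gamma> i j \<in> FF ?W"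
    if "i < k" "j < k" for i j
    by (rule Phi_FF[OF _ _ _ _ that]; use a b c in auto)+
  have FY: "?Y i j \<in> FF ?W" if "i < k" "j < k" for i j
    unfolding mat_star_eq_mat_vec_star
    by (rule mat_vec_star_closed[OF W(1)]) (use FP that in auto)
  define v where "v l = \<Phi> \<alpha> \<gamma> l j" for l
  have v: "v l \<in> FF ?W" if "l < k" for l
    using FP(4) that ij by (simp add: v_def)
  have FYG: "mat_star C k ?Y (\<Phi> \<gamma> \<alpha>) i l \<in> FF ?W" if "l < k" for l
    unfolding mat_star_eq_mat_vec_star[of _ ?Y]
    by (rule mat_vec_star_closed[OF W(1)]) (use FP FY ij that in auto)
  have Gv: "mv (\<Phi> \<gamma> \<alpha>) v l r z = id_mat l j r z" if "l < k" "z \<in> ?W" for l r z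
    using deformedD(3)[OF c a that(1) ij(2), of z r] that(2)
    by (simp add: mat_star_eq_mat_vec_star v_def[abs_def])
  have "v i r x = mv id_mat v i r x"
    by (rule mat_vec_star_id[OF W v ij(1), symmetric])
  also have "\<dots> = mv (mat_star C k ?Y (\<Phi> \<gamma> \<alpha>)) v i r x"
    by (rule mat_vec_star_cong[where X = "mat_star C k ?Y (\<Phi> \<gamma> \<alpha>)" and i = i, OF W FYG v, symmetric])
       (use deformedD(4)[OF a b c ij(1)] in auto)
  also have "\<dots> = mv ?Y (mv (\<Phi> \<gamma> \<alpha>) v) i r x"
    by (rule mat_vec_star_assoc[OF W, symmetric]) (use FY FP v ij in auto)
  also have "\<dots> = mv ?Y (\<lambda>l. id_mat l j) i r x"
    by (rule mat_vec_star_cong[OF W])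
       (use FY FP v ij Gv in \<open>auto intro: mat_vec_star_closed[OF W(1)]\<close>)
  also have "\<dots> = ?Y i j r x"
    by (rule mat_vec_star_id_column[where X = ?Y and i = i, OF W FY[OF ij(1)] ij(2)])
  finally show ?thesis by (simp add: v_def)
qed

lemma Phi_Phi:
  assumes a: "\<alpha> \<in> {1..m}" and b: "\<beta> \<in> {1..m}" and c: "\<gamma> \<in> {1..m}"
    and W: "open W" "x \<in> W" "W \<subseteq> U \<alpha>" "W \<subseteq> U \<beta>" "W \<subseteq> U \<gamma>"
    and v: "\<And>l. l < k \<Longrightarrow> v l \<in> FF W" and i: "i < k"
  shows "mv (\<Phi> \<alpha> \<beta>) (mv (\<Phi> \<beta> \<gamma>) v) i r x = mv (\<Phi> \<alpha> \<gamma>) v i r x"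
proof -
  have FP: "\<Phi> \<alpha> \<beta> i j \<in> FF W" "\<Phi> \<beta> \<gamma> i j \<in> FF W" "\<Phi> \<alpha> \<gamma> i j \<in> FF W" if "i < k" "j < k" for i j
    by (rule Phi_FF[OF _ _ _ _ that]; use a b c W in auto)+
  have "mv (\<Phi> \<alpha> \<beta>) (mv (\<Phi> \<beta> \<gamma>) v) i r x = mv (mat_star C k (\<Phi> \<alpha> \<beta>) (\<Phi> \<beta> \<gamma>)) v i r x"
    by (rule mat_vec_star_assoc[OF W(1,2)]) (use FP v i in auto)
  also have "\<dots> = mv (\<Phi> \<alpha> \<gamma>) v i r x"
  proof (rule mat_vec_star_cong[OF W(1,2)])
    show "mat_star C k (\<Phi> \<alpha> \<beta>) (\<Phi> \<beta> \<gamma>) i l \<in> FF W" if "l < k" for l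
      unfolding mat_star_eq_mat_vec_star
      by (rule mat_vec_star_closed[OF W(1)]) (use FP i that in auto)
    show "mat_star C k (\<Phi> \<alpha> \<beta>) (\<Phi> \<beta> \<gamma>) i l r z = \<Phi> \<alpha> \<gamma> i l r z" if "l < k" "z \<in> W" for l r z
      using W that by (intro Phi_cocycle[OF a b c _ _ _ i]) auto
  qed (use v in auto)
  finally show ?thesis .
qed

text \<open>
  The collections which are to correspond to formal sections. The product with \<open>f\<close> from the right
  preserves the transition law, because the matrices act from the left.
\<close>

definition compatible :: "(nat \<Rightarrow> nat \<Rightarrow> 'm fseries) \<Rightarrow> bool" where
  "compatible b \<longleftrightarrow>
     (\<forall>\<alpha>\<in>{1..m}. \<forall>i<k. b \<alpha> i \<in> FF (U \<alpha>)) \<and>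
     (\<forall>\<alpha>\<in>{1..m}. \<forall>\<beta>\<in>{1..m}. \<forall>i<k. \<forall>r. \<forall>x\<in>U \<alpha> \<inter> U \<beta>. mv (\<Phi> \<alpha> \<beta>) (b \<beta>) i r x = b \<alpha> i r x)"

text \<open>Only the values on the sets \<open>U \<alpha>\<close> carry meaning.\<close>

definition coll_eq :: "(nat \<Rightarrow> nat \<Rightarrow> 'm fseries) \<Rightarrow> (nat \<Rightarrow> nat \<Rightarrow> 'm fseries) \<Rightarrow> bool"
    (infix "\<cong>\<^sub>U" 50) where
  "b \<cong>\<^sub>U b' \<longleftrightarrow> (\<forall>\<alpha>\<in>{1..m}. \<forall>i<k. \<forall>r. \<forall>x\<in>U \<alpha>. b \<alpha> i r x = b' \<alpha> i r x)"

lemma coll_eqI: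
  "(\<And>\<alpha> i r x. \<alpha> \<in> {1..m} \<Longrightarrow> i < k \<Longrightarrow> x \<in> U \<alpha> \<Longrightarrow> b \<alpha> i r x = b' \<alpha> i r x) \<Longrightarrow> b \<cong>\<^sub>U b'"
  unfolding coll_eq_def by blast

lemma coll_eqD: "b \<cong>\<^sub>U b' \<Longrightarrow> \<alpha> \<in> {1..m} \<Longrightarrow> i < k \<Longrightarrow> x \<in> U \<alpha> \<Longrightarrow> b \<alpha> i r x = b' \<alpha> i r x"
  unfolding coll_eq_def by blast

lemma coll_eq_sym: "b \<cong>\<^sub>U b' \<Longrightarrow> b' \<cong>\<^sub>U b"
  and coll_eq_trans: "b \<cong>\<^sub>U b' \<Longrightarrow> b' \<cong>\<^sub>U b'' \<Longrightarrow> b \<cong>\<^sub>U b''"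
  unfolding coll_eq_def by auto

lemma compatible_FF: "compatible b \<Longrightarrow> \<alpha> \<in> {1..m} \<Longrightarrow> i < k \<Longrightarrow> b \<alpha> i \<in> FF (U \<alpha>)"
  and compatible_transition: "compatible b \<Longrightarrow> \<alpha> \<in> {1..m} \<Longrightarrow> \<beta> \<in> {1..m} \<Longrightarrow> i < k \<Longrightarrow>
     x \<in> U \<alpha> \<Longrightarrow> x \<in> U \<beta> \<Longrightarrow> mv (\<Phi> \<alpha> \<beta>) (b \<beta>) i r x = b \<alpha> i r x"
  unfolding compatible_def by blast+

lemma compatibleI:
  assumes "\<And>\<alpha> i. \<alpha> \<in> {1..m} \<Longrightarrow> i < k \<Longrightarrow> b \<alpha> i \<in> FF (U \<alpha>)"
    and "\<And>\<alpha> \<beta> i r x. \<alpha> \<in> {1..m} \<Longrightarrow> \<beta> \<in> {1..m} \<Longrightarrow> i < k \<Longrightarrow>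
     x \<in> U \<alpha> \<Longrightarrow> x \<in> U \<beta> \<Longrightarrow> mv (\<Phi> \<alpha> \<beta>) (b \<beta>) i r x = b \<alpha> i r x"
  shows "compatible b"
  unfolding compatible_def using assms by blast

lemma overlap:
  assumes "\<alpha> \<in> {1..m}" "\<beta> \<in> {1..m}"
  shows "open (U \<alpha> \<inter> U \<beta>)" "i < k \<Longrightarrow> j < k \<Longrightarrow> \<Phi> \<alpha> \<beta> i j \<in> FF (U \<alpha> \<inter> U \<beta>)"
  using open_U assms deformedD(1) by auto

lemma Phi_mv_cong:
  assumes "\<alpha> \<in> {1..m}" "\<beta> \<in> {1..m}" "i < k" "x \<in> U \<alpha>" "x \<in> U \<beta>"
    and "\<And>l. l < k \<Longrightarrow> v l \<in> FF (U \<beta>)"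
    and "\<And>l r z. l < k \<Longrightarrow> z \<in> U \<beta> \<Longrightarrow> v l r z = w l r z"
  shows "mv (\<Phi> \<alpha> \<beta>) v i r x = mv (\<Phi> \<alpha> \<beta>) w i r x"
proof (rule mat_vec_star_cong[OF overlap(1)[OF assms(1,2)]])
  show "v l \<in> FF (U \<alpha> \<inter> U \<beta>)" if "l < k" for l
    by (rule formal_functions_subset[OF assms(6)[OF that]]) simp
qed (use assms overlap in auto)

lemma compatible_add:
  assumes b: "compatible b" and b': "compatible b'"
  shows "compatible (\<lambda>\<alpha> i. b \<alpha> i \<boxplus> b' \<alpha> i)"
proof (rule compatibleI)
  show "(b \<alpha> i \<boxplus> b' \<alpha> i) \<in> FF (U \<alpha>)" if "\<alpha> \<in> {1..m}" "i < k" for \<alpha> i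
    by (intro formal_functions_add open_U compatible_FF b b' that)
  fix \<alpha> \<beta> i r x assume 1: "\<alpha> \<in> {1..m}" "\<beta> \<in> {1..m}" "i < k" "x \<in> U \<alpha>" "x \<in> U \<beta>"
  have "mv (\<Phi> \<alpha> \<beta>) (\<lambda>l. b \<beta> l \<boxplus> b' \<beta> l) i r x =
     mv (\<Phi> \<alpha> \<beta>) (b \<beta>) i r x + mv (\<Phi> \<alpha> \<beta>) (b' \<beta>) i r x"
    by (rule mat_vec_star_add[OF overlap(1)[OF 1(1,2)]])
       (use 1 overlap in \<open>auto intro: formal_functions_subset[OF compatible_FF[OF b 1(2)]]
          formal_functions_subset[OF compatible_FF[OF b' 1(2)]]\<close>)
  then show "mv (\<Phi> \<alpha> \<beta>) (\<lambda>l. b \<beta> l \<boxplus> b' \<beta> l) i r x = b \<alpha> i r x + b' \<alpha> i r x"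
    by (simp add: compatible_transition[OF b 1] compatible_transition[OF b' 1])
qed

lemma compatible_star:
  assumes b: "compatible b" and f: "f \<in> FF UNIV"
  shows "compatible (\<lambda>\<alpha> i. b \<alpha> i \<star> f)"
proof (rule compatibleI)
  note fU = FF_UNIV[OF f]
  show "b \<alpha> i \<star> f \<in> FF (U \<alpha>)" if "\<alpha> \<in> {1..m}" "i < k" for \<alpha> i
    by (intro star_closed open_U compatible_FF b fU that)
  fix \<alpha> \<beta> i r x assume 1: "\<alpha> \<in> {1..m}" "\<beta> \<in> {1..m}" "i < k" "x \<in> U \<alpha>" "x \<in> U \<beta>"
  note o = overlap(1)[OF 1(1,2)]
  have "mv (\<Phi> \<alpha> \<beta>) (\<lambda>l. b \<beta> l \<star> f) i r x = (mv (\<Phi> \<alpha> \<beta>) (b \<beta>) i \<star> f) r x"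
    by (rule mat_vec_star_star[OF o])
       (use 1 overlap fU in \<open>auto intro: formal_functions_subset[OF compatible_FF[OF b 1(2)]]\<close>)
  also have "\<dots> = (b \<alpha> i \<star> f) r x"
    by (rule star_cong[OF o, symmetric])
       (use 1 fU compatible_transition[OF b 1(1-3)]
         in \<open>auto intro: formal_functions_subset[OF compatible_FF[OF b 1(1)]]\<close>)
  finally show "mv (\<Phi> \<alpha> \<beta>) (\<lambda>l. b \<beta> l \<star> f) i r x = (b \<alpha> i \<star> f) r x" .
qed

lemma compatible_shiftD:
  assumes b: "compatible (\<lambda>\<alpha> i. formal_shift (b \<alpha> i))"
  shows "compatible b"
proof (rule compatibleI)
  show "b \<alpha> i \<in> FF (U \<alpha>)" if "\<alpha> \<in> {1..m}" "i < k" for \<alpha> i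
    using compatible_FF[OF b that] formal_functions_shift_iff[OF open_U[OF that(1)]] by blast
  fix \<alpha> \<beta> i r x assume 1: "\<alpha> \<in> {1..m}" "\<beta> \<in> {1..m}" "i < k" "x \<in> U \<alpha>" "x \<in> U \<beta>"
  have "mv (\<Phi> \<alpha> \<beta>) (\<lambda>l. formal_shift (b \<beta> l)) i (Suc r) x = formal_shift (mv (\<Phi> \<alpha> \<beta>) (b \<beta>) i) (Suc r) x"
    by (rule mat_vec_star_shift[OF overlap(1)[OF 1(1,2)]]) (use 1 overlap in auto)
  then show "mv (\<Phi> \<alpha> \<beta>) (b \<beta>) i r x = b \<alpha> i r x"
    using compatible_transition[OF b 1, of "Suc r"] by simp
qed

lemma compatible_cong:
  assumes b: "compatible b" and eq: "b \<cong>\<^sub>U b'"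
  shows "compatible b'"
proof (rule compatibleI)
  show "b' \<alpha> i \<in> FF (U \<alpha>)" if "\<alpha> \<in> {1..m}" "i < k" for \<alpha> i
    by (rule formal_functions_cong[OF open_U compatible_FF[OF b]])
       (use that coll_eqD[OF eq that] in auto)
  fix \<alpha> \<beta> i r x assume 1: "\<alpha> \<in> {1..m}" "\<beta> \<in> {1..m}" "i < k" "x \<in> U \<alpha>" "x \<in> U \<beta>"
  have "mv (\<Phi> \<alpha> \<beta>) (b \<beta>) i r x = mv (\<Phi> \<alpha> \<beta>) (b' \<beta>) i r x"
    by (rule Phi_mv_cong[OF 1 compatible_FF[OF b 1(2)] coll_eqD[OF eq 1(2)]])
  then show "mv (\<Phi> \<alpha> \<beta>) (b' \<beta>) i r x = b' \<alpha> i r x"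
    using compatible_transition[OF b 1] coll_eqD[OF eq 1(1,3,4)] by simp
qed

lemma compatible_minus:
  assumes b: "compatible b" shows "compatible (\<lambda>\<alpha> i r x. - b \<alpha> i r x)"
proof -
  have "compatible (\<lambda>\<alpha> i. b \<alpha> i \<star> const_series (\<lambda>_. - 1))"
    by (rule compatible_star[OF b]) (simp add: const_series_1)
  moreover have "(b \<alpha> i \<star> const_series (\<lambda>_. - 1)) r x = - b \<alpha> i r x"
    if "\<alpha> \<in> {1..m}" "i < k" "x \<in> U \<alpha>" for \<alpha> i r x
  proof -
    note W = open_U[OF that(1)] that(3) and bF = compatible_FF[OF b that(1,2)]
    have "(b \<alpha> i \<star> (\<lambda>r x. const_series (\<lambda>_. 1) r x + const_series (\<lambda>_. - 1) r x)) r x =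
      (b \<alpha> i \<star> const_series (\<lambda>_. 1)) r x + (b \<alpha> i \<star> const_series (\<lambda>_. - 1)) r x"
      by (rule star_add_right[OF W const_series_1[OF W(1)] const_series_1[OF W(1)] bF])
    moreover have "(\<lambda>r x. const_series (\<lambda>_. 1) r x + const_series (\<lambda>_. - 1) r x) = (\<lambda>r x::'m. 0::complex)"
      by (auto simp: const_series_def fun_eq_iff)
    note arg_cong[OF this, of "\<lambda>g. (b \<alpha> i \<star> g) r x"]
    ultimately show ?thesis
      using star_one_right[OF W bF, of r] star_zero_right[OF W bF, of r]
      by (simp add: eq_neg_iff_add_eq_0 add.commute)
  qed
  ultimately show ?thesis
    by (elim compatible_cong) (auto intro: coll_eqI)
qed


section \<open>Gluing with a partition of unity\<close>

definition supp :: "nat \<Rightarrow> 'm set" where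
  "supp \<beta> = closure {x. \<rho> \<beta> x \<noteq> 0}"

lemma supp_closed: "closed (supp \<beta>)"
  and supp_subset: "\<beta> \<in> {1..m} \<Longrightarrow> supp \<beta> \<subseteq> U \<beta>"
  and rho_0: "x \<notin> supp \<beta> \<Longrightarrow> \<rho> \<beta> x = 0"
  and rho_smooth: "\<beta> \<in> {1..m} \<Longrightarrow> smooth_fun n A UNIV (\<rho> \<beta>)"
  and rho_sum: "(\<Sum>\<beta>\<in>{1..m}. \<rho> \<beta> x) = 1"
  using partition closure_subset[of "{x. \<rho> \<beta> x \<noteq> 0}"]
  unfolding supp_def smooth_partition_of_unity_def by auto

definition supported :: "(nat \<Rightarrow> nat \<Rightarrow> 'm fseries) \<Rightarrow> bool" where
  "supported g \<longleftrightarrow> (\<forall>\<beta>\<in>{1..m}. \<forall>l<k. g \<beta> l \<in> FF (U \<beta>) \<and> (\<forall>r. \<forall>x\<in>U \<beta> - supp \<beta>. g \<beta> l r x = 0))"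

lemma supportedD:
  assumes "supported g" "\<beta> \<in> {1..m}" "l < k"
  shows "g \<beta> l \<in> FF (U \<beta>)" "x \<in> U \<beta> \<Longrightarrow> x \<notin> supp \<beta> \<Longrightarrow> g \<beta> l r x = 0"
  using assms unfolding supported_def by blast+

text \<open>
  \<open>\<Sum>\<^sub>\<beta> \<Phi>\<^sub>\<alpha>\<^sub>\<beta> \<star> g\<^sub>\<beta>\<close> for vectors \<open>g\<^sub>\<beta>\<close> on \<open>U \<beta>\<close> which vanish off the support of \<open>\<rho> \<beta>\<close>. Near a given point only
  the summands with \<open>U \<beta>\<close> containing that point contribute, which makes all its properties local.
\<close>

definition glue :: "(nat \<Rightarrow> nat \<Rightarrow> 'm fseries) \<Rightarrow> nat \<Rightarrow> nat \<Rightarrow> 'm fseries" where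
  "glue g \<alpha> i = (\<lambda>r x. \<Sum>\<beta>\<in>{\<beta>\<in>{1..m}. x \<in> U \<beta>}. mv (\<Phi> \<alpha> \<beta>) (g \<beta>) i r x)"

definition glue_nbhd :: "'m \<Rightarrow> 'm set" where
  "glue_nbhd x = (\<Inter>\<beta>\<in>{1..m}. if x \<in> U \<beta> then U \<beta> else - supp \<beta>)"

lemma glue_nbhd: 
  shows "open (glue_nbhd x)" "x \<in> glue_nbhd x"
    and "\<beta> \<in> {1..m} \<Longrightarrow> x \<in> U \<beta> \<Longrightarrow> glue_nbhd x \<subseteq> U \<beta>"
    and "\<beta> \<in> {1..m} \<Longrightarrow> x \<notin> U \<beta> \<Longrightarrow> glue_nbhd x \<inter> supp \<beta> = {}"
proof -
  have lower: "glue_nbhd x \<subseteq> (if x \<in> U \<beta> then U \<beta> else - supp \<beta>)" if "\<beta> \<in> {1..m}" for \<beta>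
    unfolding glue_nbhd_def by (rule INF_lower[OF that])
  show "open (glue_nbhd x)"
    unfolding glue_nbhd_def
  proof (rule open_INT)
    show "\<forall>\<beta>\<in>{1..m}. open (if x \<in> U \<beta> then U \<beta> else - supp \<beta>)"
      using open_U open_Compl[OF supp_closed] by (metis (full_types))
  qed simp
  have "x \<in> (if x \<in> U \<beta> then U \<beta> else - supp \<beta>)" if "\<beta> \<in> {1..m}" for \<beta>
    using supp_subset[OF that] by auto
  then show "x \<in> glue_nbhd x"
    unfolding glue_nbhd_def by blast
  show "glue_nbhd x \<subseteq> U \<beta>" if "\<beta> \<in> {1..m}" "x \<in> U \<beta>"
    using lower[OF that(1)] that(2) by simp
  show "glue_nbhd x \<inter> supp \<beta> = {}" if "\<beta> \<in> {1..m}" "x \<notin> U \<beta>"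
    using lower[OF that(1)] that(2) by auto
qed

lemma glue_near:
  assumes g: "supported g" and \<alpha>: "\<alpha> \<in> {1..m}" and i: "i < k" and z: "z \<in> glue_nbhd x" "z \<in> U \<alpha>"
  shows "glue g \<alpha> i r z = (\<Sum>\<beta>\<in>{\<beta>\<in>{1..m}. x \<in> U \<beta>}. mv (\<Phi> \<alpha> \<beta>) (g \<beta>) i r z)"
  unfolding glue_def
proof (rule sum.mono_neutral_right)
  show "{\<beta> \<in> {1..m}. x \<in> U \<beta>} \<subseteq> {\<beta> \<in> {1..m}. z \<in> U \<beta>}"
    using glue_nbhd(3) z(1) by blast
  show "\<forall>\<beta>\<in>{\<beta> \<in> {1..m}. z \<in> U \<beta>} - {\<beta> \<in> {1..m}. x \<in> U \<beta>}. mv (\<Phi> \<alpha> \<beta>) (g \<beta>) i r z = 0"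
  proof
    fix \<beta> assume "\<beta> \<in> {\<beta> \<in> {1..m}. z \<in> U \<beta>} - {\<beta> \<in> {1..m}. x \<in> U \<beta>}"
    then have \<beta>: "\<beta> \<in> {1..m}" "z \<in> U \<beta>" "x \<notin> U \<beta>" by auto
    let ?W = "U \<alpha> \<inter> U \<beta> \<inter> - supp \<beta>"
    show "mv (\<Phi> \<alpha> \<beta>) (g \<beta>) i r z = 0"
    proof (rule mat_vec_star_zero)
      show "open ?W" using open_U \<alpha> \<beta> supp_closed by auto
      show "z \<in> ?W" using z \<beta> glue_nbhd(4)[OF \<beta>(1,3)] by auto
      show "\<Phi> \<alpha> \<beta> i l \<in> FF ?W" if "l < k" for l
        by (rule Phi_FF[OF \<alpha> \<beta>(1) _ _ i that]) auto
      show "g \<beta> l r z = 0" if "l < k" "z \<in> ?W" for l r z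
        using supportedD(2)[OF g \<beta>(1) that(1)] that(2) by auto
    qed
  qed
qed simp

lemma glue_term_FF:
  assumes g: "supported g" and \<alpha>: "\<alpha> \<in> {1..m}" and \<beta>: "\<beta> \<in> {1..m}" and i: "i < k"
    and W: "open W" "W \<subseteq> U \<alpha>" "W \<subseteq> U \<beta>"
  shows "mv (\<Phi> \<alpha> \<beta>) (g \<beta>) i \<in> FF W"
  by (rule mat_vec_star_closed[where X = "\<Phi> \<alpha> \<beta>" and i = i, OF W(1) Phi_FF[OF \<alpha> \<beta> W(2,3) i]
        formal_functions_subset[OF supportedD(1)[OF g \<beta>] W(3)]])

lemma glue_FF:
  assumes g: "supported g" and \<alpha>: "\<alpha> \<in> {1..m}" and i: "i < k"
  shows "glue g \<alpha> i \<in> FF (U \<alpha>)"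
proof (rule formal_functions_local)
  fix x assume x: "x \<in> U \<alpha>"
  let ?W = "glue_nbhd x \<inter> U \<alpha>"
  have W: "open ?W" using glue_nbhd(1) open_U[OF \<alpha>] by blast
  have "(\<lambda>r z. \<Sum>\<beta>\<in>{\<beta>\<in>{1..m}. x \<in> U \<beta>}. mv (\<Phi> \<alpha> \<beta>) (g \<beta>) i r z) \<in> FF ?W"
    by (intro formal_functions_sum glue_term_FF g \<alpha> i W) (use glue_nbhd(3) in auto)
  then have "glue g \<alpha> i \<in> FF ?W"
    by (rule formal_functions_cong[OF W]) (use glue_near[OF g \<alpha> i] in auto)
  then show "\<exists>V. open V \<and> x \<in> V \<and> V \<subseteq> U \<alpha> \<and> glue g \<alpha> i \<in> FF V"
    using W x glue_nbhd(2) by (intro exI[of _ ?W]) auto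
qed

lemma glue_compatible:
  assumes g: "supported g" shows "compatible (glue g)"
proof (rule compatibleI)
  fix \<alpha> \<beta> i r x assume 1: "\<alpha> \<in> {1..m}" "\<beta> \<in> {1..m}" "i < k" "x \<in> U \<alpha>" "x \<in> U \<beta>"
  let ?W = "glue_nbhd x \<inter> U \<alpha> \<inter> U \<beta>" and ?B = "{\<gamma>\<in>{1..m}. x \<in> U \<gamma>}"
  have W: "open ?W" "x \<in> ?W" using glue_nbhd(1,2) open_U[OF 1(1)] open_U[OF 1(2)] 1 by auto
  have sub: "?W \<subseteq> U \<gamma>" if "\<gamma> \<in> ?B" for \<gamma> using glue_nbhd(3) that by blast
  have P: "\<Phi> \<alpha> \<beta> i l \<in> FF ?W" if "l < k" for l
    by (rule Phi_FF[OF 1(1,2) _ _ 1(3) that]) auto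
  have T: "mv (\<Phi> \<beta> \<gamma>) (g \<gamma>) l \<in> FF ?W" if "l < k" "\<gamma> \<in> ?B" for l \<gamma>
    using that sub by (intro glue_term_FF g 1 W) auto
  have "mv (\<Phi> \<alpha> \<beta>) (glue g \<beta>) i r x =
      mv (\<Phi> \<alpha> \<beta>) (\<lambda>l r z. \<Sum>\<gamma>\<in>?B. mv (\<Phi> \<beta> \<gamma>) (g \<gamma>) l r z) i r x"
  proof (rule mat_vec_star_cong[OF W])
    show "glue g \<beta> l \<in> FF ?W" if "l < k" for l
      by (rule formal_functions_subset[OF glue_FF[OF g 1(2) that]]) auto
  qed (use P glue_near[OF g 1(2)] in auto)
  also have "\<dots> = (\<Sum>\<gamma>\<in>?B. mv (\<Phi> \<alpha> \<beta>) (mv (\<Phi> \<beta> \<gamma>) (g \<gamma>)) i r x)"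
    by (rule mat_vec_star_sum[where X = "\<Phi> \<alpha> \<beta>" and i = i, OF W P T])
  also have "\<dots> = (\<Sum>\<gamma>\<in>?B. mv (\<Phi> \<alpha> \<gamma>) (g \<gamma>) i r x)"
  proof (intro sum.cong refl)
    fix \<gamma> assume \<gamma>: "\<gamma> \<in> ?B"
    show "mv (\<Phi> \<alpha> \<beta>) (mv (\<Phi> \<beta> \<gamma>) (g \<gamma>)) i r x = mv (\<Phi> \<alpha> \<gamma>) (g \<gamma>) i r x"
      by (rule Phi_Phi[OF 1(1,2) _ W _ _ sub[OF \<gamma>] formal_functions_subset[OF supportedD(1)[OF g] sub[OF \<gamma>]] 1(3)])
         (use \<gamma> in auto)
  qed
  finally show "mv (\<Phi> \<alpha> \<beta>) (glue g \<beta>) i r x = glue g \<alpha> i r x"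
    by (simp add: glue_def)
qed (rule glue_FF[OF g])

lemma glue_star:
  assumes g: "supported g" and f: "f \<in> FF UNIV"
  shows "glue (\<lambda>\<beta> l. g \<beta> l \<star> f) \<cong>\<^sub>U (\<lambda>\<alpha> i. glue g \<alpha> i \<star> f)"
proof (rule coll_eqI)
  fix \<alpha> i r x assume 1: "\<alpha> \<in> {1..m}" "i < k" "x \<in> U \<alpha>"
  let ?W = "glue_nbhd x \<inter> U \<alpha>" and ?B = "{\<gamma>\<in>{1..m}. x \<in> U \<gamma>}"
  have W: "open ?W" "x \<in> ?W" using glue_nbhd(1,2) open_U[OF 1(1)] 1 by auto
  have sub: "?W \<subseteq> U \<gamma>" if "\<gamma> \<in> ?B" for \<gamma> using glue_nbhd(3) that by blast
  note fW = FF_UNIV[OF f, of ?W]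
  have T: "mv (\<Phi> \<alpha> \<gamma>) (g \<gamma>) i \<in> FF ?W" if "\<gamma> \<in> ?B" for \<gamma>
    using that sub by (intro glue_term_FF g 1 W) auto
  have "glue (\<lambda>\<beta> l. g \<beta> l \<star> f) \<alpha> i r x = (\<Sum>\<beta>\<in>?B. (mv (\<Phi> \<alpha> \<beta>) (g \<beta>) i \<star> f) r x)"
    unfolding glue_def
  proof (intro sum.cong refl)
    fix \<beta> assume \<beta>: "\<beta> \<in> ?B"
    show "mv (\<Phi> \<alpha> \<beta>) (\<lambda>l. g \<beta> l \<star> f) i r x = (mv (\<Phi> \<alpha> \<beta>) (g \<beta>) i \<star> f) r x"
    proof (rule mat_vec_star_star[OF W _ _ fW])
      show "\<Phi> \<alpha> \<beta> i l \<in> FF ?W" if "l < k" for l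
        by (rule Phi_FF[OF 1(1) _ _ sub[OF \<beta>] 1(2) that]) (use \<beta> in auto)
      show "g \<beta> l \<in> FF ?W" if "l < k" for l
        by (rule formal_functions_subset[OF supportedD(1)[OF g] sub[OF \<beta>]]) (use \<beta> that in auto)
    qed
  qed
  also have "\<dots> = ((\<lambda>r z. \<Sum>\<beta>\<in>?B. mv (\<Phi> \<alpha> \<beta>) (g \<beta>) i r z) \<star> f) r x"
    by (rule star_sum_left[OF W fW T, symmetric])
  also have "\<dots> = (glue g \<alpha> i \<star> f) r x"
    by (rule star_cong[OF W _ fW glue_near[OF g 1(1,2), symmetric] refl])
       (use T W in \<open>auto intro!: formal_functions_sum\<close>)
  finally show "glue (\<lambda>\<beta> l. g \<beta> l \<star> f) \<alpha> i r x = (glue g \<alpha> i \<star> f) r x" .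
qed

lemma glue_cong:
  assumes g: "supported g" and eq: "g \<cong>\<^sub>U g'" shows "glue g \<cong>\<^sub>U glue g'"
proof (rule coll_eqI)
  fix \<alpha> i r x assume 1: "\<alpha> \<in> {1..m}" "i < k" "x \<in> U \<alpha>"
  show "glue g \<alpha> i r x = glue g' \<alpha> i r x"
    unfolding glue_def
  proof (intro sum.cong refl)
    fix \<beta> assume "\<beta> \<in> {\<gamma>\<in>{1..m}. x \<in> U \<gamma>}"
    then have \<beta>: "\<beta> \<in> {1..m}" "x \<in> U \<beta>" by auto
    show "mv (\<Phi> \<alpha> \<beta>) (g \<beta>) i r x = mv (\<Phi> \<alpha> \<beta>) (g' \<beta>) i r x"
      by (rule Phi_mv_cong[OF 1(1) \<beta>(1) 1(2,3) \<beta>(2) supportedD(1)[OF g \<beta>(1)] coll_eqD[OF eq \<beta>(1)]])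
  qed
qed

lemma glue_add:
  assumes g: "supported g" and g': "supported g'"
  shows "glue (\<lambda>\<beta> l. g \<beta> l \<boxplus> g' \<beta> l) \<cong>\<^sub>U (\<lambda>\<alpha> i. glue g \<alpha> i \<boxplus> glue g' \<alpha> i)"
proof (rule coll_eqI)
  fix \<alpha> i r x assume 1: "\<alpha> \<in> {1..m}" "i < k" "x \<in> U \<alpha>"
  show "glue (\<lambda>\<beta> l. g \<beta> l \<boxplus> g' \<beta> l) \<alpha> i r x = glue g \<alpha> i r x + glue g' \<alpha> i r x"
    unfolding glue_def sum.distrib[symmetric]
  proof (intro sum.cong refl)
    fix \<beta> assume "\<beta> \<in> {\<gamma>\<in>{1..m}. x \<in> U \<gamma>}"
    then have \<beta>: "\<beta> \<in> {1..m}" "x \<in> U \<beta>" by auto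
    show "mv (\<Phi> \<alpha> \<beta>) (\<lambda>l. g \<beta> l \<boxplus> g' \<beta> l) i r x =
       mv (\<Phi> \<alpha> \<beta>) (g \<beta>) i r x + mv (\<Phi> \<alpha> \<beta>) (g' \<beta>) i r x"
      by (rule mat_vec_star_add[OF overlap(1)[OF 1(1) \<beta>(1)]])
         (use 1 \<beta> overlap in \<open>auto intro: formal_functions_subset[OF supportedD(1)[OF g \<beta>(1)]]
            formal_functions_subset[OF supportedD(1)[OF g' \<beta>(1)]]\<close>)
  qed
qed

lemma glue_shift: 
  "glue (\<lambda>\<beta> l. formal_shift (g \<beta> l)) \<cong>\<^sub>U (\<lambda>\<alpha> i. formal_shift (glue g \<alpha> i))"
proof (rule coll_eqI)
  fix \<alpha> i r x assume 1: "\<alpha> \<in> {1..m}" "i < k" "x \<in> U \<alpha>"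
  have "glue (\<lambda>\<beta> l. formal_shift (g \<beta> l)) \<alpha> i r x =
     (\<Sum>\<beta>\<in>{\<gamma>\<in>{1..m}. x \<in> U \<gamma>}. formal_shift (mv (\<Phi> \<alpha> \<beta>) (g \<beta>) i) r x)"
    unfolding glue_def
  proof (intro sum.cong refl)
    fix \<beta> assume "\<beta> \<in> {\<gamma>\<in>{1..m}. x \<in> U \<gamma>}"
    then have \<beta>: "\<beta> \<in> {1..m}" "x \<in> U \<beta>" by auto
    show "mv (\<Phi> \<alpha> \<beta>) (\<lambda>l. formal_shift (g \<beta> l)) i r x = formal_shift (mv (\<Phi> \<alpha> \<beta>) (g \<beta>) i) r x"
      by (rule mat_vec_star_shift[OF overlap(1)[OF 1(1) \<beta>(1)]]) (use 1 \<beta> overlap in auto)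
  qed
  then show "glue (\<lambda>\<beta> l. formal_shift (g \<beta> l)) \<alpha> i r x = formal_shift (glue g \<alpha> i) r x"
    by (cases r) (simp_all add: glue_def)
qed

lemma glue_coeff_0:
  assumes g: "supported g" and 1: "\<alpha> \<in> {1..m}" "i < k" "x \<in> U \<alpha>"
  shows "glue g \<alpha> i 0 x = (\<Sum>\<beta>\<in>{\<beta>\<in>{1..m}. x \<in> U \<beta>}. \<Sum>l<k. \<phi> \<alpha> \<beta> i l x * g \<beta> l 0 x)"
  unfolding glue_def
proof (intro sum.cong refl)
  fix \<beta> assume "\<beta> \<in> {\<gamma>\<in>{1..m}. x \<in> U \<gamma>}"
  then have \<beta>: "\<beta> \<in> {1..m}" "x \<in> U \<beta>" by auto
  have "mv (\<Phi> \<alpha> \<beta>) (g \<beta>) i 0 x = (\<Sum>l<k. \<Phi> \<alpha> \<beta> i l 0 x * g \<beta> l 0 x)"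
    by (rule mat_vec_star_coeff_0[OF overlap(1)[OF 1(1) \<beta>(1)]])
       (use 1 \<beta> overlap in \<open>auto intro: formal_functions_subset[OF supportedD(1)[OF g \<beta>(1)]]\<close>)
  also have "\<dots> = (\<Sum>l<k. \<phi> \<alpha> \<beta> i l x * g \<beta> l 0 x)"
    by (intro sum.cong refl) (simp add: deformedD(2)[OF 1(1) \<beta>(1) 1(2) _ 1(3) \<beta>(2)])
  finally show "mv (\<Phi> \<alpha> \<beta>) (g \<beta>) i 0 x = (\<Sum>l<k. \<phi> \<alpha> \<beta> i l x * g \<beta> l 0 x)" .
qed

end

section \<open>Deformations of the classical components of a section\<close>

context star_bundle
begin

definition smooth_coll :: "(nat \<Rightarrow> nat \<Rightarrow> 'm fseries) \<Rightarrow> bool" where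
  "smooth_coll b \<longleftrightarrow> (\<forall>\<beta>\<in>{1..m}. \<forall>l<k. b \<beta> l \<in> FF (U \<beta>))"

lemma smooth_collD: "smooth_coll b \<Longrightarrow> \<beta> \<in> {1..m} \<Longrightarrow> l < k \<Longrightarrow> b \<beta> l \<in> FF (U \<beta>)"
  and smooth_collI: "(\<And>\<beta> l. \<beta> \<in> {1..m} \<Longrightarrow> l < k \<Longrightarrow> b \<beta> l \<in> FF (U \<beta>)) \<Longrightarrow> smooth_coll b"
  unfolding smooth_coll_def by blast+

lemma compatible_smooth_coll: "compatible b \<Longrightarrow> smooth_coll b"
  by (intro smooth_collI compatible_FF)

definition cutoff :: "(nat \<Rightarrow> 'm fseries) \<Rightarrow> bool" where
  "cutoff u \<longleftrightarrow> (\<forall>\<beta>\<in>{1..m}. u \<beta> \<in> FF UNIV \<and> (\<forall>r x. x \<notin> supp \<beta> \<longrightarrow> u \<beta> r x = 0))"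

lemma cutoffD:
  assumes "cutoff u" "\<beta> \<in> {1..m}"
  shows "u \<beta> \<in> FF W" "x \<notin> supp \<beta> \<Longrightarrow> u \<beta> r x = 0"
  using assms formal_functions_subset[of "u \<beta>" UNIV W] unfolding cutoff_def by auto

definition cut :: "(nat \<Rightarrow> 'm fseries) \<Rightarrow> (nat \<Rightarrow> nat \<Rightarrow> 'm fseries) \<Rightarrow> nat \<Rightarrow> nat \<Rightarrow> 'm fseries" where
  "cut u b = (\<lambda>\<beta> l. u \<beta> \<star> b \<beta> l)"

lemma cut_FF:
  assumes u: "cutoff u" and b: "b \<beta> l \<in> FF W" and \<beta>: "\<beta> \<in> {1..m}" and W: "open W"
  shows "cut u b \<beta> l \<in> FF W" and "x \<in> W \<Longrightarrow> x \<notin> supp \<beta> \<Longrightarrow> cut u b \<beta> l r x = 0"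
proof -
  show "cut u b \<beta> l \<in> FF W"
    unfolding cut_def by (rule star_closed[OF W cutoffD(1)[OF u \<beta>] b])
  show "cut u b \<beta> l r x = 0" if x: "x \<in> W" "x \<notin> supp \<beta>"
  proof -
    let ?W = "W - supp \<beta>"
    have W': "open ?W" "x \<in> ?W" using open_Diff[OF W supp_closed] x by auto
    have b': "b \<beta> l \<in> FF ?W" by (rule formal_functions_subset[OF b]) auto
    have "cut u b \<beta> l r x = ((\<lambda>_ _. 0) \<star> b \<beta> l) r x"
      unfolding cut_def by (rule star_cong[OF W' cutoffD(1)[OF u \<beta>] b']) (use cutoffD(2)[OF u \<beta>] in auto)
    also have "\<dots> = 0" by (rule star_zero_left[OF W' b'])
    finally show ?thesis .
  qed
qed

lemma cut_supported:
  assumes u: "cutoff u" and b: "smooth_coll b" shows "supported (cut u b)"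
  unfolding supported_def
proof (intro ballI allI impI conjI)
  fix \<beta> l assume \<beta>: "\<beta> \<in> {1..m}" and l: "l < k"
  note c = cut_FF[where b = b and \<beta> = \<beta> and l = l, OF u smooth_collD[OF b \<beta> l] \<beta> open_U[OF \<beta>]]
  show "cut u b \<beta> l \<in> FF (U \<beta>)" by (rule c(1))
  show "cut u b \<beta> l r x = 0" if "x \<in> U \<beta> - supp \<beta>" for r x
    using that by (intro c(2)) auto
qed

lemma cut_smooth_coll: "cutoff u \<Longrightarrow> smooth_coll b \<Longrightarrow> smooth_coll (cut u b)"
  by (rule smooth_collI, rule cut_FF(1)) (auto intro: smooth_collD open_U)

lemma cut_cong:
  assumes u: "cutoff u" and b: "smooth_coll b" and eq: "b \<cong>\<^sub>U b'"
  shows "cut u b \<cong>\<^sub>U cut u b'"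
  unfolding cut_def
  by (intro coll_eqI star_cong[OF open_U _ cutoffD(1)[OF u] smooth_collD[OF b] refl])
     (use coll_eqD[OF eq] in auto)

lemma cut_add:
  assumes u: "cutoff u" and b: "smooth_coll b" and b': "smooth_coll b'"
  shows "cut u (\<lambda>\<beta> l. b \<beta> l \<boxplus> b' \<beta> l) \<cong>\<^sub>U (\<lambda>\<beta> l. cut u b \<beta> l \<boxplus> cut u b' \<beta> l)"
  unfolding cut_def
  by (intro coll_eqI star_add_right[OF open_U _ smooth_collD[OF b] smooth_collD[OF b'] cutoffD(1)[OF u]])

lemma cut_shift:
  assumes u: "cutoff u"
  shows "cut u (\<lambda>\<beta> l. formal_shift (b \<beta> l)) \<cong>\<^sub>U (\<lambda>\<beta> l. formal_shift (cut u b \<beta> l))"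
  unfolding cut_def by (intro coll_eqI star_shift_right[OF open_U _ cutoffD(1)[OF u]])

lemma cut_star:
  assumes u: "cutoff u" and b: "smooth_coll b" and f: "f \<in> FF UNIV"
  shows "cut u (\<lambda>\<beta> l. b \<beta> l \<star> f) \<cong>\<^sub>U (\<lambda>\<beta> l. cut u b \<beta> l \<star> f)"
  unfolding cut_def
  by (intro coll_eqI star_assoc[OF open_U _ cutoffD(1)[OF u] smooth_collD[OF b]
        formal_functions_subset[OF f], symmetric]) auto

lemma cut_coeff_0:
  assumes u: "cutoff u" and b: "smooth_coll b" and "\<beta> \<in> {1..m}" "l < k" "x \<in> U \<beta>"
  shows "cut u b \<beta> l 0 x = u \<beta> 0 x * b \<beta> l 0 x"
  unfolding cut_def
  by (intro star_coeff_0[OF open_U _ cutoffD(1)[OF u] smooth_collD[OF b]] assms)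

definition glue_cut :: "(nat \<Rightarrow> 'm fseries) \<Rightarrow> (nat \<Rightarrow> nat \<Rightarrow> 'm fseries) \<Rightarrow> nat \<Rightarrow> nat \<Rightarrow> 'm fseries" where
  "glue_cut u b = glue (cut u b)"

lemma glue_cut_compatible: "cutoff u \<Longrightarrow> smooth_coll b \<Longrightarrow> compatible (glue_cut u b)"
  unfolding glue_cut_def by (intro glue_compatible cut_supported)

lemma glue_cut_cong:
  "cutoff u \<Longrightarrow> smooth_coll b \<Longrightarrow> b \<cong>\<^sub>U b' \<Longrightarrow> glue_cut u b \<cong>\<^sub>U glue_cut u b'"
  unfolding glue_cut_def by (intro glue_cong cut_supported cut_cong)

lemma smooth_coll_add:
  "smooth_coll b \<Longrightarrow> smooth_coll b' \<Longrightarrow> smooth_coll (\<lambda>\<beta> l. b \<beta> l \<boxplus> b' \<beta> l)"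
  by (rule smooth_collI, rule formal_functions_add) (auto intro: smooth_collD open_U)

lemma smooth_coll_shift: "smooth_coll b \<Longrightarrow> smooth_coll (\<lambda>\<beta> l. formal_shift (b \<beta> l))"
  using formal_functions_shift_iff open_U unfolding smooth_coll_def by blast

lemma smooth_coll_star: "smooth_coll b \<Longrightarrow> f \<in> FF UNIV \<Longrightarrow> smooth_coll (\<lambda>\<beta> l. b \<beta> l \<star> f)"
  by (rule smooth_collI, rule star_closed)
     (auto intro: smooth_collD open_U formal_functions_subset[of f UNIV])

lemma glue_cut_add:
  assumes u: "cutoff u" and b: "smooth_coll b" and b': "smooth_coll b'"
  shows "glue_cut u (\<lambda>\<beta> l. b \<beta> l \<boxplus> b' \<beta> l) \<cong>\<^sub>U
     (\<lambda>\<alpha> i r x. glue_cut u b \<alpha> i r x + glue_cut u b' \<alpha> i r x)"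
  unfolding glue_cut_def
  by (rule coll_eq_trans[OF glue_cong[OF cut_supported[OF u smooth_coll_add[OF b b']] cut_add[OF u b b']]
        glue_add[OF cut_supported[OF u b] cut_supported[OF u b']]])

lemma glue_cut_shift:
  assumes u: "cutoff u" and b: "smooth_coll b"
  shows "glue_cut u (\<lambda>\<beta> l. formal_shift (b \<beta> l)) \<cong>\<^sub>U (\<lambda>\<alpha> i. formal_shift (glue_cut u b \<alpha> i))"
  unfolding glue_cut_def
  by (rule coll_eq_trans[OF glue_cong[OF cut_supported[OF u smooth_coll_shift[OF b]] cut_shift[OF u]] glue_shift])

lemma glue_cut_star:
  assumes u: "cutoff u" and b: "smooth_coll b" and f: "f \<in> FF UNIV"
  shows "glue_cut u (\<lambda>\<beta> l. b \<beta> l \<star> f) \<cong>\<^sub>U (\<lambda>\<alpha> i. glue_cut u b \<alpha> i \<star> f)"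
  unfolding glue_cut_def
  by (rule coll_eq_trans[OF glue_cong[OF cut_supported[OF u smooth_coll_star[OF b f]] cut_star[OF u b f]]
        glue_star[OF cut_supported[OF u b] f]])

lemma glue_cut_coeff_0:
  assumes u: "cutoff u" and b: "smooth_coll b" and 1: "\<alpha> \<in> {1..m}" "i < k" "x \<in> U \<alpha>"
    and c: "\<And>\<beta>. \<beta> \<in> {1..m} \<Longrightarrow> x \<in> U \<beta> \<Longrightarrow> (\<Sum>l<k. \<phi> \<alpha> \<beta> i l x * b \<beta> l 0 x) = w \<beta> * c"
  shows "glue_cut u b \<alpha> i 0 x = (\<Sum>\<beta>\<in>{1..m}. u \<beta> 0 x * w \<beta>) * c"
proof -
  have "glue_cut u b \<alpha> i 0 x = (\<Sum>\<beta>\<in>{\<beta>\<in>{1..m}. x \<in> U \<beta>}. u \<beta> 0 x * w \<beta> * c)"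
    unfolding glue_cut_def glue_coeff_0[OF cut_supported[OF u b] 1]
  proof (intro sum.cong refl)
    fix \<beta> assume "\<beta> \<in> {\<beta>\<in>{1..m}. x \<in> U \<beta>}"
    then have \<beta>: "\<beta> \<in> {1..m}" "x \<in> U \<beta>" by auto
    have "(\<Sum>l<k. \<phi> \<alpha> \<beta> i l x * cut u b \<beta> l 0 x) = (\<Sum>l<k. u \<beta> 0 x * (\<phi> \<alpha> \<beta> i l x * b \<beta> l 0 x))"
      by (intro sum.cong refl) (simp add: cut_coeff_0[OF u b \<beta>(1) _ \<beta>(2)])
    also have "\<dots> = u \<beta> 0 x * w \<beta> * c"
      by (simp add: sum_distrib_left[symmetric] c[OF \<beta>])
    finally show "(\<Sum>l<k. \<phi> \<alpha> \<beta> i l x * cut u b \<beta> l 0 x) = u \<beta> 0 x * w \<beta> * c" .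
  qed
  also have "\<dots> = (\<Sum>\<beta>\<in>{1..m}. u \<beta> 0 x * w \<beta> * c)"
  proof (rule sum.mono_neutral_left)
    show "\<forall>\<beta>\<in>{1..m} - {\<beta>\<in>{1..m}. x \<in> U \<beta>}. u \<beta> 0 x * w \<beta> * c = 0"
      using supp_subset cutoffD(2)[OF u] by fastforce
  qed auto
  finally show ?thesis by (simp add: sum_distrib_right)
qed

abbreviation FS :: "(nat \<Rightarrow> 'm \<Rightarrow> 'v) set" where
  "FS \<equiv> formal_sections n A scl E k F"

lemma FS_iff: "s \<in> FS \<longleftrightarrow> (\<forall>r. smooth_sec (s r))"
  by (simp add: formal_sections_def)

lemma FS_add: "s \<in> FS \<Longrightarrow> t \<in> FS \<Longrightarrow> (s \<boxplus> t) \<in> FS"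
  and FS_minus: "s \<in> FS \<Longrightarrow> (\<lambda>r x. - s r x) \<in> FS"
  and FS_zero: "(\<lambda>r x. 0) \<in> FS"
  and FS_shift: "s \<in> FS \<Longrightarrow> formal_shift s \<in> FS"
  by (auto simp: FS_iff formal_shift_def smooth_section_add smooth_section_minus
      smooth_section_zero split: nat.split)

lemma FS_in: "s \<in> FS \<Longrightarrow> s r x \<in> E x"
  using smooth_sectionD(1)[of UNIV "s r" x] by (simp add: FS_iff)

definition const_section :: "('m \<Rightarrow> 'v) \<Rightarrow> nat \<Rightarrow> 'm \<Rightarrow> 'v" where
  "const_section s r = (if r = 0 then s else (\<lambda>_. 0))"

lemma FS_const: "smooth_sec s \<Longrightarrow> const_section s \<in> FS"
  by (simp add: FS_iff const_section_def smooth_section_zero)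

lemma FS_decompose: "s = (\<lambda>r x. const_section (s 0) r x + formal_shift (\<lambda>r. s (Suc r)) r x)"
proof (intro ext)
  show "s r x = const_section (s 0) r x + formal_shift (\<lambda>r. s (Suc r)) r x" for r x
    by (cases r) (simp_all add: const_section_def)
qed

text \<open>
  Maps from formal sections to compatible collections that are additive, commute with multiplication
  by the deformation parameter and reduce to the classical components in order zero. The deformed
  components are one such map; a second one yields projectivity.
\<close>

definition deforms_components ::
    "((nat \<Rightarrow> 'm \<Rightarrow> 'v) \<Rightarrow> nat \<Rightarrow> nat \<Rightarrow> 'm fseries) \<Rightarrow> bool" where
  "deforms_components L \<longleftrightarrow>
     (\<forall>s\<in>FS. compatible (L s)) \<and>
     (\<forall>s\<in>FS. \<forall>t\<in>FS. L (s \<boxplus> t) \<cong>\<^sub>U (\<lambda>\<alpha> i. L s \<alpha> i \<boxplus> L t \<alpha> i)) \<and>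
     (\<forall>s\<in>FS. L (formal_shift s) \<cong>\<^sub>U (\<lambda>\<alpha> i. formal_shift (L s \<alpha> i))) \<and>
     (\<forall>s\<in>FS. \<forall>\<alpha>\<in>{1..m}. \<forall>i<k. \<forall>x\<in>U \<alpha>. L s \<alpha> i 0 x = comp \<alpha> (s 0) i x)"

lemma deforms_componentsD:
  assumes "deforms_components L" "s \<in> FS"
  shows "compatible (L s)"
    and "t \<in> FS \<Longrightarrow> L (s \<boxplus> t) \<cong>\<^sub>U (\<lambda>\<alpha> i. L s \<alpha> i \<boxplus> L t \<alpha> i)"
    and "L (formal_shift s) \<cong>\<^sub>U (\<lambda>\<alpha> i. formal_shift (L s \<alpha> i))"
    and "\<alpha> \<in> {1..m} \<Longrightarrow> i < k \<Longrightarrow> x \<in> U \<alpha> \<Longrightarrow> L s \<alpha> i 0 x = comp \<alpha> (s 0) i x"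
  using assms unfolding deforms_components_def by blast+

lemma deforms_components_Suc:
  assumes L: "deforms_components L" and s: "s \<in> FS" and 1: "\<alpha> \<in> {1..m}" "i < k" "x \<in> U \<alpha>"
  shows "L s \<alpha> i (Suc r) x = L (const_section (s 0)) \<alpha> i (Suc r) x + L (\<lambda>r. s (Suc r)) \<alpha> i r x"
proof -
  have F: "const_section (s 0) \<in> FS" "(\<lambda>r. s (Suc r)) \<in> FS"
    using s FS_const by (auto simp: FS_iff)
  have "L s \<alpha> i (Suc r) x = L (\<lambda>r x. const_section (s 0) r x + formal_shift (\<lambda>r. s (Suc r)) r x) \<alpha> i (Suc r) x"
    using FS_decompose[of s] by simp
  also have "\<dots> = L (const_section (s 0)) \<alpha> i (Suc r) x + L (formal_shift (\<lambda>r. s (Suc r))) \<alpha> i (Suc r) x"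
    by (rule coll_eqD[OF deforms_componentsD(2)[OF L F(1) FS_shift[OF F(2)]] 1])
  also have "\<dots> = L (const_section (s 0)) \<alpha> i (Suc r) x + L (\<lambda>r. s (Suc r)) \<alpha> i r x"
    using coll_eqD[OF deforms_componentsD(3)[OF L F(2)] 1, of "Suc r"] by simp
  finally show ?thesis .
qed

text \<open>
  A section is recovered order by order: the coefficient of order zero determines \<open>s 0\<close>, and after
  removing its contribution one can divide by the deformation parameter.
\<close>

lemma deforms_components_inj:
  assumes L: "deforms_components L" and "s \<in> FS" "t \<in> FS" "L s \<cong>\<^sub>U L t"
  shows "s = t"
proof -
  have 0: "s 0 = t 0" if st: "s \<in> FS" "t \<in> FS" "L s \<cong>\<^sub>U L t" for s t
  proof
    fix x
    show "s 0 x = t 0 x"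
    proof (rule comp_eqI[OF _ FS_in[OF st(1)] FS_in[OF st(2)]])
      fix \<alpha> i assume 1: "\<alpha> \<in> {1..m}" "i < k" "x \<in> U \<alpha>"
      show "comp \<alpha> (s 0) i x = comp \<alpha> (t 0) i x"
        using deforms_componentsD(4)[OF L st(1) 1] deforms_componentsD(4)[OF L st(2) 1]
          coll_eqD[OF st(3) 1, of 0] by simp
    qed
  qed
  have "s r = t r" for r
    using assms(2-4)
  proof (induction r arbitrary: s t)
    case (Suc r s t)
    have "L (\<lambda>r. s (Suc r)) \<cong>\<^sub>U L (\<lambda>r. t (Suc r))"
    proof (rule coll_eqI)
      fix \<alpha> i r x assume 1: "\<alpha> \<in> {1..m}" "i < k" "x \<in> U \<alpha>"
      show "L (\<lambda>r. s (Suc r)) \<alpha> i r x = L (\<lambda>r. t (Suc r)) \<alpha> i r x"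
        using deforms_components_Suc[OF L Suc(2) 1, of r] deforms_components_Suc[OF L Suc(3) 1, of r]
          coll_eqD[OF Suc(4) 1, of "Suc r"] 0[OF Suc(2-4)] by simp
    qed
    from Suc.IH[OF _ _ this] show ?case
      using Suc.prems(1,2) by (simp add: FS_iff)
  qed (rule 0)
  then show ?thesis by blast
qed

lemma deforms_components_step:
  assumes L: "deforms_components L" and b: "compatible b"
  shows "\<exists>s0 b'. smooth_sec s0 \<and> compatible b' \<and>
    (\<forall>\<alpha>\<in>{1..m}. \<forall>i<k. \<forall>x\<in>U \<alpha>. b \<alpha> i 0 x = comp \<alpha> s0 i x \<and>
       (\<forall>r. b \<alpha> i (Suc r) x = L (const_section s0) \<alpha> i (Suc r) x + b' \<alpha> i r x))"
proof -
  have sm: "smooth_fun n A (U \<alpha>) (b \<alpha> i 0)" if "\<alpha> \<in> {1..m}" "i < k" for \<alpha> i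
    by (rule FF_D[OF compatible_FF[OF b that]])
  have compat: "(\<Sum>j<k. \<phi> \<alpha> \<beta> i j x * b \<beta> j 0 x) = b \<alpha> i 0 x"
    if 1: "\<alpha> \<in> {1..m}" "\<beta> \<in> {1..m}" "i < k" "x \<in> U \<alpha>" "x \<in> U \<beta>" for \<alpha> \<beta> i x
  proof -
    have "b \<alpha> i 0 x = mv (\<Phi> \<alpha> \<beta>) (b \<beta>) i 0 x"
      by (rule compatible_transition[OF b 1, symmetric])
    also have "\<dots> = (\<Sum>j<k. \<Phi> \<alpha> \<beta> i j 0 x * b \<beta> j 0 x)"
      by (rule mat_vec_star_coeff_0[OF overlap(1)[OF 1(1,2)]])
         (use 1 overlap in \<open>auto intro: formal_functions_subset[OF compatible_FF[OF b 1(2)]]\<close>)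
    finally show ?thesis
      using deformedD(2)[OF 1(1-3) _ 1(4,5)] by simp
  qed
  have "\<exists>s. smooth_sec s \<and> (\<forall>\<alpha>\<in>{1..m}. \<forall>i<k. \<forall>x\<in>U \<alpha>. comp \<alpha> s i x = b \<alpha> i 0 x)"
    by (rule section_of_components) (rule sm compat; assumption)+
  then obtain s0 where s0: "smooth_sec s0"
    and comp_s0: "\<forall>\<alpha>\<in>{1..m}. \<forall>i<k. \<forall>x\<in>U \<alpha>. comp \<alpha> s0 i x = b \<alpha> i 0 x"
    by (elim exE conjE)
  have comp_s0: "comp \<alpha> s0 i x = b \<alpha> i 0 x" if "\<alpha> \<in> {1..m}" "i < k" "x \<in> U \<alpha>" for \<alpha> i x
    using comp_s0[THEN bspec, OF that(1)] that(2,3) by simp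
  define d where "d \<alpha> i r x = b \<alpha> i r x + - L (const_section s0) \<alpha> i r x" for \<alpha> i r x
  have d: "compatible d"
    unfolding d_def
    by (intro compatible_add b compatible_minus deforms_componentsD(1)[OF L FS_const[OF s0]])
  have d0: "d \<alpha> i 0 x = 0" if "\<alpha> \<in> {1..m}" "i < k" "x \<in> U \<alpha>" for \<alpha> i x
    using deforms_componentsD(4)[OF L FS_const[OF s0] that] comp_s0[OF that]
    by (simp add: d_def const_section_def)
  have "d \<cong>\<^sub>U (\<lambda>\<alpha> i. formal_shift (\<lambda>r. d \<alpha> i (Suc r)))"
  proof (rule coll_eqI)
    fix \<alpha> i r x assume "\<alpha> \<in> {1..m}" "i < k" "x \<in> U \<alpha>"
    then show "d \<alpha> i r x = formal_shift (\<lambda>r. d \<alpha> i (Suc r)) r x"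
      using d0 by (cases r) auto
  qed
  from compatible_cong[OF d this] have "compatible (\<lambda>\<alpha> i r. d \<alpha> i (Suc r))"
    by (rule compatible_shiftD)
  then show ?thesis
    using s0 comp_s0 by (intro exI[of _ s0] exI[of _ "\<lambda>\<alpha> i r. d \<alpha> i (Suc r)"]) (auto simp: d_def)
qed

text \<open>
  Iterating the previous lemma splits off one classical section after the other. The remainder after
  \<open>j\<close> steps is the image of the tail \<open>s j, s (j + 1), \<dots>\<close>, and it is this statement, for all \<open>j\<close> at once,
  that can be proved by induction on the order.
\<close>

lemma deforms_components_surj:
  assumes L: "deforms_components L" and b: "compatible b"
  obtains s where "s \<in> FS" "L s \<cong>\<^sub>U b"
proof -
  obtain S B where SB: "\<And>b. compatible b \<Longrightarrow> smooth_sec (S b) \<and> compatible (B b) \<and>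
    (\<forall>\<alpha>\<in>{1..m}. \<forall>i<k. \<forall>x\<in>U \<alpha>. b \<alpha> i 0 x = comp \<alpha> (S b) i x \<and>
       (\<forall>r. b \<alpha> i (Suc r) x = L (const_section (S b)) \<alpha> i (Suc r) x + B b \<alpha> i r x))"
    using deforms_components_step[OF L] by metis
  define rest where "rest j = (B ^^ j) b" for j
  have rest: "compatible (rest j)" for j
    by (induction j) (use b SB in \<open>auto simp: rest_def\<close>)
  define s where "s j = S (rest j)" for j
  have s: "(\<lambda>r. s (j + r)) \<in> FS" for j
    using SB[OF rest] by (simp add: FS_iff s_def)
  have eq: "L (\<lambda>r. s (j + r)) \<alpha> i r x = rest j \<alpha> i r x"
    if 1: "\<alpha> \<in> {1..m}" "i < k" "x \<in> U \<alpha>" for \<alpha> i r x j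
  proof (induction r arbitrary: j)
    case 0
    show ?case
      using deforms_componentsD(4)[OF L s 1] SB[OF rest, of j] 1 by (simp add: s_def)
  next
    case (Suc r)
    have "rest j \<alpha> i (Suc r) x = L (const_section (s j)) \<alpha> i (Suc r) x + rest (Suc j) \<alpha> i r x"
      using SB[OF rest, of j] 1 by (simp add: s_def rest_def)
    then show ?case
      using deforms_components_Suc[OF L s 1, of j r] Suc.IH[of "Suc j"] by simp
  qed
  have "L s \<cong>\<^sub>U b"
  proof (rule coll_eqI)
    fix \<alpha> i r x assume 1: "\<alpha> \<in> {1..m}" "i < k" "x \<in> U \<alpha>"
    show "L s \<alpha> i r x = b \<alpha> i r x"
      using eq[where j = 0, OF 1] by (simp add: rest_def)
  qed
  then show ?thesis using s[of 0] that by simp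
qed

abbreviation components :: "(nat \<Rightarrow> 'm \<Rightarrow> 'v) \<Rightarrow> nat \<Rightarrow> nat \<Rightarrow> 'm fseries" where
  "components s \<equiv> \<lambda>\<beta> l q. comp \<beta> (s q) l"

abbreviation real_series :: "('m \<Rightarrow> real) \<Rightarrow> 'm fseries" where
  "real_series f \<equiv> const_series (\<lambda>x. complex_of_real (f x))"

lemma components_smooth: "s \<in> FS \<Longrightarrow> smooth_coll (components s)"
  using comp_smooth by (auto simp: smooth_coll_def formal_functions_def FS_iff)

lemma cutoff_real_series:
  assumes "\<And>\<beta>. \<beta> \<in> {1..m} \<Longrightarrow> smooth_fun n A UNIV (f \<beta>)"
    and "\<And>\<beta> x. \<beta> \<in> {1..m} \<Longrightarrow> x \<notin> supp \<beta> \<Longrightarrow> f \<beta> x = 0"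
  shows "cutoff (\<lambda>\<beta>. real_series (f \<beta>))"
  unfolding cutoff_def
  by (intro ballI conjI formal_functions_const_series smooth_fun_of_real assms)
     (use assms in \<open>auto simp: const_series_def\<close>)

lemma cutoff_rho: "cutoff (\<lambda>\<beta>. real_series (\<rho> \<beta>))"
  by (rule cutoff_real_series) (use rho_smooth rho_0 in auto)

abbreviation dc :: "(nat \<Rightarrow> 'm \<Rightarrow> 'v) \<Rightarrow> nat \<Rightarrow> nat \<Rightarrow> 'm fseries" where
  "dc \<equiv> deformed_component C scl k m U e \<Phi> \<rho>"

lemma dc_eq_glue_cut: "dc s = glue_cut (\<lambda>\<beta>. real_series (\<rho> \<beta>)) (components s)"
  unfolding deformed_component_def glue_cut_def glue_def cut_def by (rule refl)

lemma dc_deforms_components: "deforms_components dc"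
  unfolding deforms_components_def dc_eq_glue_cut
proof (intro conjI ballI allI impI)
  let ?u = "\<lambda>\<beta>. real_series (\<rho> \<beta>)"
  fix s assume s: "s \<in> FS"
  note cs = components_smooth[OF s]
  show "compatible (glue_cut ?u (components s))"
    by (rule glue_cut_compatible[OF cutoff_rho cs])
  show "glue_cut ?u (components (s \<boxplus> t)) \<cong>\<^sub>U
      (\<lambda>\<alpha> i r x. glue_cut ?u (components s) \<alpha> i r x + glue_cut ?u (components t) \<alpha> i r x)"
    if t: "t \<in> FS" for t
  proof (rule coll_eq_trans[OF glue_cut_cong glue_cut_add])
    show "components (s \<boxplus> t) \<cong>\<^sub>U (\<lambda>\<beta> l r x. comp \<beta> (s r) l x + comp \<beta> (t r) l x)"
      by (intro coll_eqI comp_add FS_in s t)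
  qed (intro cutoff_rho components_smooth FS_add s t)+
  show "glue_cut ?u (components (formal_shift s)) \<cong>\<^sub>U (\<lambda>\<alpha> i. formal_shift (glue_cut ?u (components s) \<alpha> i))"
  proof (rule coll_eq_trans[OF glue_cut_cong glue_cut_shift])
    show "components (formal_shift s) \<cong>\<^sub>U (\<lambda>\<beta> l. formal_shift (components s \<beta> l))"
    proof (rule coll_eqI)
      fix \<alpha> i r x assume 1: "\<alpha> \<in> {1..m}" "i < k" "x \<in> U \<alpha>"
      have "comp \<alpha> (\<lambda>_. 0) i x = 0"
        by (rule frame_component_eqI[OF vs frame_U[OF 1(1)] 1(3) _ 1(2)]) simp
      then show "components (formal_shift s) \<alpha> i r x = formal_shift (components s \<alpha> i) r x"
        by (cases r) simp_all
    qed
  qed (intro cutoff_rho components_smooth FS_shift s)+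
  fix \<alpha> i x assume 1: "\<alpha> \<in> {1..m}" "i < k" "x \<in> U \<alpha>"
  have "glue_cut ?u (components s) \<alpha> i 0 x = (\<Sum>\<beta>\<in>{1..m}. ?u \<beta> 0 x * 1) * comp \<alpha> (s 0) i x"
    by (rule glue_cut_coeff_0[OF cutoff_rho cs 1])
       (simp add: comp_change[OF 1(1) _ 1(3) _ _ 1(2), where s = "s 0"] FS_in[OF s])
  also have "(\<Sum>\<beta>\<in>{1..m}. ?u \<beta> 0 x * 1) = complex_of_real (\<Sum>\<beta>\<in>{1..m}. \<rho> \<beta> x)"
    by (simp add: const_series_def)
  also have "\<dots> = 1"
    by (simp only: rho_sum of_real_1)
  finally show "glue_cut ?u (components s) \<alpha> i 0 x = comp \<alpha> (s 0) i x"
    by simp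
qed

text \<open>
  Each summand of \<open>1 = \<Sum>\<^sub>\<beta> c\<^sub>\<beta> \<rho>\<^sub>\<beta>\<^sup>2\<close> is a product of two functions supported in \<open>U \<beta>\<close>: one is needed to make a
  vector on \<open>U \<beta>\<close> global, the other to cut off the matrices \<open>\<Phi>\<^sub>\<alpha>\<^sub>\<beta>\<close>.
  If \<open>1 = c x + y\<close>, then \<open>1 = (c x + y)\<^sup>2 = c\<^sup>2 x\<^sup>2 + (2 c x + y) y\<close>, so that in a combination of the \<open>\<rho> \<beta>\<close>
  representing \<open>1\<close> one function after the other can be replaced by its square.
\<close>

lemma rho_squares:
  obtains c where "\<And>\<beta>. smooth_fun n A UNIV (c \<beta> :: 'm \<Rightarrow> real)"
    "\<And>x. (\<Sum>\<beta>\<in>{1..m}. c \<beta> x * (\<rho> \<beta> x)\<^sup>2) = 1"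
proof -
  have "\<exists>c. (\<forall>\<beta>. smooth_fun n A UNIV (c \<beta> :: 'm \<Rightarrow> real)) \<and>
     (\<forall>x. (\<Sum>\<beta>\<in>{1..m}. c \<beta> x * (if \<beta> \<in> B then (\<rho> \<beta> x)\<^sup>2 else \<rho> \<beta> x)) = 1)"
    if "finite B" "B \<subseteq> {1..m}" for B
    using that
  proof (induction B rule: finite_induct)
    case empty
    show ?case
      by (intro exI[of _ "\<lambda>_ _. 1"]) (simp add: rho_sum smooth_fun_const del: One_nat_def)
  next
    case (insert \<gamma> B)
    then obtain c where c: "\<And>\<beta>. smooth_fun n A UNIV (c \<beta> :: 'm \<Rightarrow> real)"
      "\<And>x. (\<Sum>\<beta>\<in>{1..m}. c \<beta> x * (if \<beta> \<in> B then (\<rho> \<beta> x)\<^sup>2 else \<rho> \<beta> x)) = 1"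
      by auto
    let ?w = "\<lambda>\<beta> x. if \<beta> \<in> B then (\<rho> \<beta> x)\<^sup>2 else \<rho> \<beta> x"
    define y where "y x = (\<Sum>\<beta>\<in>{1..m} - {\<gamma>}. c \<beta> x * ?w \<beta> x)" for x
    define c' where "c' \<beta> x = (if \<beta> = \<gamma> then c \<gamma> x * c \<gamma> x
      else if \<beta> \<in> {1..m} then (2 * c \<gamma> x * \<rho> \<gamma> x + y x) * c \<beta> x else 0)" for \<beta> x
    have \<gamma>: "\<gamma> \<in> {1..m}" using insert by auto
    have w: "smooth_fun n A UNIV (?w \<beta>)" if "\<beta> \<in> {1..m}" for \<beta>
      using rho_smooth[OF that] smooth_fun_mult[OF open_UNIV rho_smooth[OF that] rho_smooth[OF that]]
      by (cases "\<beta> \<in> B") (simp_all add: power2_eq_square)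
    have y: "smooth_fun n A UNIV y"
      unfolding y_def by (intro smooth_fun_sum smooth_fun_mult c w open_UNIV) auto
    have c': "smooth_fun n A UNIV (c' \<beta>)" for \<beta>
    proof (cases "\<beta> = \<gamma> \<or> \<beta> \<in> {1..m}")
      case True
      have 1: "smooth_fun n A UNIV (\<lambda>x. c \<gamma> x * c \<gamma> x)"
        "smooth_fun n A UNIV (\<lambda>x. (2 * c \<gamma> x * \<rho> \<gamma> x + y x) * c \<beta> x)"
        by (intro smooth_fun_mult smooth_fun_add smooth_fun_const c rho_smooth \<gamma> y open_UNIV)+
      show ?thesis
      proof (cases "\<beta> = \<gamma>")
        case True
        then have "c' \<beta> = (\<lambda>x. c \<gamma> x * c \<gamma> x)" by (simp add: c'_def fun_eq_iff)
        then show ?thesis using 1 by simp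
      next
        case False
        then have "c' \<beta> = (\<lambda>x. (2 * c \<gamma> x * \<rho> \<gamma> x + y x) * c \<beta> x)"
          using True by (simp add: c'_def fun_eq_iff)
        then show ?thesis using 1 by simp
      qed
    next
      case False
      then have "c' \<beta> = (\<lambda>_. 0)" by (auto simp: c'_def)
      then show ?thesis by (simp add: smooth_fun_const)
    qed
    have "(\<Sum>\<beta>\<in>{1..m}. c' \<beta> x * (if \<beta> \<in> insert \<gamma> B then (\<rho> \<beta> x)\<^sup>2 else \<rho> \<beta> x)) = 1" for x
    proof -
      have one: "c \<gamma> x * \<rho> \<gamma> x + y x = 1"
        using c(2)[of x] \<gamma> insert.hyps(2) sum.remove[OF _ \<gamma>, of "\<lambda>\<beta>. c \<beta> x * ?w \<beta> x"]
        by (simp add: y_def)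
      have "(\<Sum>\<beta>\<in>{1..m}. c' \<beta> x * (if \<beta> \<in> insert \<gamma> B then (\<rho> \<beta> x)\<^sup>2 else \<rho> \<beta> x)) =
        c \<gamma> x * c \<gamma> x * (\<rho> \<gamma> x)\<^sup>2 +
        (\<Sum>\<beta>\<in>{1..m} - {\<gamma>}. c' \<beta> x * (if \<beta> \<in> insert \<gamma> B then (\<rho> \<beta> x)\<^sup>2 else \<rho> \<beta> x))"
        by (subst sum.remove[OF _ \<gamma>]) (simp_all add: c'_def)
      also have "(\<Sum>\<beta>\<in>{1..m} - {\<gamma>}. c' \<beta> x * (if \<beta> \<in> insert \<gamma> B then (\<rho> \<beta> x)\<^sup>2 else \<rho> \<beta> x)) =
        (\<Sum>\<beta>\<in>{1..m} - {\<gamma>}. (2 * c \<gamma> x * \<rho> \<gamma> x + y x) * (c \<beta> x * ?w \<beta> x))"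
        by (intro sum.cong refl) (auto simp: c'_def)
      also have "\<dots> = (2 * c \<gamma> x * \<rho> \<gamma> x + y x) * y x"
        by (simp add: y_def sum_distrib_left)
      also have "c \<gamma> x * c \<gamma> x * (\<rho> \<gamma> x)\<^sup>2 + \<dots> = (c \<gamma> x * \<rho> \<gamma> x + y x)\<^sup>2"
        by (simp add: power2_eq_square algebra_simps)
      finally show ?thesis by (simp add: one)
    qed
    then show ?case using c' by blast
  qed
  from this[of "{1..m}"] obtain c where c: "\<forall>\<beta>. smooth_fun n A UNIV (c \<beta> :: 'm \<Rightarrow> real)"
    "\<forall>x. (\<Sum>\<beta>\<in>{1..m}. c \<beta> x * (if \<beta> \<in> {1..m} then (\<rho> \<beta> x)\<^sup>2 else \<rho> \<beta> x)) = 1"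
    by auto
  have "(\<Sum>\<beta>\<in>{1..m}. c \<beta> x * (\<rho> \<beta> x)\<^sup>2) =
      (\<Sum>\<beta>\<in>{1..m}. c \<beta> x * (if \<beta> \<in> {1..m} then (\<rho> \<beta> x)\<^sup>2 else \<rho> \<beta> x))" for x
    by (intro sum.cong) auto
  then show ?thesis using that[of c] c by simp
qed

text \<open>
  The composition of \<open>b \<mapsto> (v\<^sub>\<beta> \<star> b\<^sub>\<beta>)\<close> with \<open>(g\<^sub>\<beta>) \<mapsto> (\<Sum>\<^sub>\<beta> \<Phi>\<^sub>\<alpha>\<^sub>\<beta> \<star> u\<^sub>\<beta> \<star> g\<^sub>\<beta>)\<close> passes through a free module. It is the
  identity in order zero if \<open>\<Sum>\<^sub>\<beta> u\<^sub>\<beta> v\<^sub>\<beta> = 1\<close>.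
\<close>

lemma glue_cut_cut_deforms_components:
  assumes u: "cutoff u" and v: "cutoff v"
    and uv: "\<And>x. (\<Sum>\<beta>\<in>{1..m}. u \<beta> 0 x * v \<beta> 0 x) = 1"
  shows "deforms_components (\<lambda>s. glue_cut u (cut v (dc s)))"
  unfolding deforms_components_def
proof (intro conjI ballI allI impI)
  fix s assume s: "s \<in> FS"
  note ds = deforms_componentsD[OF dc_deforms_components]
  have sm: "smooth_coll (dc s)" if "s \<in> FS" for s
    by (rule compatible_smooth_coll[OF ds(1)[OF that]])
  note cs = cut_smooth_coll[OF v sm[OF s]]
  show "compatible (glue_cut u (cut v (dc s)))"
    by (rule glue_cut_compatible[OF u cs])
  show "glue_cut u (cut v (dc (s \<boxplus> t))) \<cong>\<^sub>U
      (\<lambda>\<alpha> i r x. glue_cut u (cut v (dc s)) \<alpha> i r x + glue_cut u (cut v (dc t)) \<alpha> i r x)"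
    if t: "t \<in> FS" for t
  proof (rule coll_eq_trans[OF glue_cut_cong[OF u] glue_cut_add[OF u cs]])
    show "cut v (dc (s \<boxplus> t)) \<cong>\<^sub>U (\<lambda>\<beta> l. cut v (dc s) \<beta> l \<boxplus> cut v (dc t) \<beta> l)"
      by (rule coll_eq_trans[OF cut_cong[OF v sm[OF FS_add[OF s t]] ds(2)[OF s t]]
            cut_add[OF v sm[OF s] sm[OF t]]])
  qed (intro cut_smooth_coll v sm FS_add s t)+
  show "glue_cut u (cut v (dc (formal_shift s))) \<cong>\<^sub>U (\<lambda>\<alpha> i. formal_shift (glue_cut u (cut v (dc s)) \<alpha> i))"
  proof (rule coll_eq_trans[OF glue_cut_cong[OF u] glue_cut_shift[OF u cs]])
    show "cut v (dc (formal_shift s)) \<cong>\<^sub>U (\<lambda>\<beta> l. formal_shift (cut v (dc s) \<beta> l))"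
      by (rule coll_eq_trans[OF cut_cong[OF v sm[OF FS_shift[OF s]] ds(3)[OF s]] cut_shift[OF v]])
  qed (intro cut_smooth_coll v sm FS_shift s)
  fix \<alpha> i x assume 1: "\<alpha> \<in> {1..m}" "i < k" "x \<in> U \<alpha>"
  have "glue_cut u (cut v (dc s)) \<alpha> i 0 x = (\<Sum>\<beta>\<in>{1..m}. u \<beta> 0 x * v \<beta> 0 x) * comp \<alpha> (s 0) i x"
  proof (rule glue_cut_coeff_0[OF u cs 1])
    fix \<beta> assume \<beta>: "\<beta> \<in> {1..m}" "x \<in> U \<beta>"
    have "(\<Sum>l<k. \<phi> \<alpha> \<beta> i l x * cut v (dc s) \<beta> l 0 x) = (\<Sum>l<k. v \<beta> 0 x * (\<phi> \<alpha> \<beta> i l x * comp \<beta> (s 0) l x))"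
      by (intro sum.cong refl)
         (simp add: cut_coeff_0[OF v sm[OF s] \<beta>(1) _ \<beta>(2)] ds(4)[OF s \<beta>(1) _ \<beta>(2)])
    also have "\<dots> = v \<beta> 0 x * comp \<alpha> (s 0) i x"
      by (simp add: sum_distrib_left[symmetric] FS_in[OF s]
          comp_change[OF 1(1) \<beta>(1) 1(3) \<beta>(2) _ 1(2), where s = "s 0"])
    finally show "(\<Sum>l<k. \<phi> \<alpha> \<beta> i l x * cut v (dc s) \<beta> l 0 x) = v \<beta> 0 x * comp \<alpha> (s 0) i x" .
  qed
  then show "glue_cut u (cut v (dc s)) \<alpha> i 0 x = comp \<alpha> (s 0) i x"
    by (simp only: uv mult_1)
qed

end

section \<open>Modules with a finite dual basis\<close>

context right_module
begin

lemma act_zero_scalar: "x \<in> carrier M \<Longrightarrow> smult M \<zero>\<^bsub>R\<^esub> x = \<zero>\<^bsub>M\<^esub>"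
proof -
  assume x: "x \<in> carrier M"
  let ?z = "smult M \<zero>\<^bsub>R\<^esub> x"
  have z: "?z \<in> carrier M" by (rule act_closed[OF R.zero_closed x])
  have "?z \<oplus>\<^bsub>M\<^esub> ?z = smult M (\<zero>\<^bsub>R\<^esub> \<oplus>\<^bsub>R\<^esub> \<zero>\<^bsub>R\<^esub>) x"
    by (rule act_add_scalar[OF R.zero_closed R.zero_closed x, symmetric])
  then have "?z \<oplus>\<^bsub>M\<^esub> ?z = ?z"
    by simp
  then show ?thesis using M.add.l_cancel_one[OF z z] by simp
qed

lemma act_zero_vector: "a \<in> carrier R \<Longrightarrow> smult M a \<zero>\<^bsub>M\<^esub> = \<zero>\<^bsub>M\<^esub>"
proof -
  assume a: "a \<in> carrier R"
  let ?z = "smult M a \<zero>\<^bsub>M\<^esub>"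
  have z: "?z \<in> carrier M" by (rule act_closed[OF a M.zero_closed])
  have "?z \<oplus>\<^bsub>M\<^esub> ?z = smult M a (\<zero>\<^bsub>M\<^esub> \<oplus>\<^bsub>M\<^esub> \<zero>\<^bsub>M\<^esub>)"
    by (rule act_add_vector[OF a M.zero_closed M.zero_closed, symmetric])
  then have "?z \<oplus>\<^bsub>M\<^esub> ?z = ?z"
    by simp
  then show ?thesis using M.add.l_cancel_one[OF z z] by simp
qed

lemma act_finsum_scalar:
  assumes x: "x \<in> carrier M"
  shows "finite I \<Longrightarrow> u \<in> I \<rightarrow> carrier R \<Longrightarrow>
    smult M (finsum R u I) x = finsum M (\<lambda>i. smult M (u i) x) I"
proof (induction I rule: finite_induct)
  case empty
  then show ?case using act_zero_scalar[OF x] by simp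
next
  case (insert i I)
  then have u: "u \<in> I \<rightarrow> carrier R" "u i \<in> carrier R" by auto
  have "smult M (finsum R u (insert i I)) x = smult M (u i \<oplus>\<^bsub>R\<^esub> finsum R u I) x"
    using insert.hyps u by (simp add: R.finsum_insert)
  also have "\<dots> = smult M (u i) x \<oplus>\<^bsub>M\<^esub> finsum M (\<lambda>i. smult M (u i) x) I"
    using act_add_scalar[OF u(2) R.finsum_closed[OF u(1)] x] insert.IH[OF u(1)] by simp
  also have "\<dots> = finsum M (\<lambda>i. smult M (u i) x) (insert i I)"
    using insert.hyps u x by (subst M.finsum_insert) (auto intro: act_closed)
  finally show ?case .
qed

lemma act_finsum_vector:
  assumes a: "a \<in> carrier R"
  shows "finite I \<Longrightarrow> u \<in> I \<rightarrow> carrier M \<Longrightarrow>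
    smult M a (finsum M u I) = finsum M (\<lambda>i. smult M a (u i)) I"
proof (induction I rule: finite_induct)
  case empty
  then show ?case using act_zero_vector[OF a] by simp
next
  case (insert i I)
  then have u: "u \<in> I \<rightarrow> carrier M" "u i \<in> carrier M" by auto
  have "smult M a (finsum M u (insert i I)) = smult M a (u i \<oplus>\<^bsub>M\<^esub> finsum M u I)"
    using insert.hyps u by (simp add: M.finsum_insert)
  also have "\<dots> = smult M a (u i) \<oplus>\<^bsub>M\<^esub> finsum M (\<lambda>i. smult M a (u i)) I"
    using act_add_vector[OF a u(2) M.finsum_closed[OF u(1)]] insert.IH[OF u(1)] by simp
  also have "\<dots> = finsum M (\<lambda>i. smult M a (u i)) (insert i I)"
    using insert.hyps u a by (subst M.finsum_insert) (auto intro: act_closed)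
  finally show ?case .
qed

end

lemma module_homs_finsum:
  assumes "right_module R M" "right_module R N" and f: "f \<in> module_homs R M N"
  shows "finite I \<Longrightarrow> u \<in> I \<rightarrow> carrier M \<Longrightarrow> f (finsum M u I) = finsum N (\<lambda>i. f (u i)) I"
proof (induction I rule: finite_induct)
  interpret M: right_module R M by (rule assms(1))
  interpret N: right_module R N by (rule assms(2))
  have fc: "f x \<in> carrier N" if "x \<in> carrier M" for x
    using f that by (auto simp: module_homs_def)
  have fa: "f (x \<oplus>\<^bsub>M\<^esub> y) = f x \<oplus>\<^bsub>N\<^esub> f y" if "x \<in> carrier M" "y \<in> carrier M" for x y
    using f that by (auto simp: module_homs_def)
  {
    case empty
    have z: "f \<zero>\<^bsub>M\<^esub> \<in> carrier N" by (rule fc[OF M.M.zero_closed])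
    have "f \<zero>\<^bsub>M\<^esub> \<oplus>\<^bsub>N\<^esub> f \<zero>\<^bsub>M\<^esub> = f \<zero>\<^bsub>M\<^esub>"
      using fa[OF M.M.zero_closed M.M.zero_closed] by simp
    then have "f \<zero>\<^bsub>M\<^esub> = \<zero>\<^bsub>N\<^esub>"
      using N.M.add.l_cancel_one[OF z z] by simp
    then show ?case by simp
  next
    case (insert i I)
    then have u: "u \<in> I \<rightarrow> carrier M" "u i \<in> carrier M" by auto
    have "f (finsum M u (insert i I)) = f (u i \<oplus>\<^bsub>M\<^esub> finsum M u I)"
      using insert.hyps u by (simp add: M.M.finsum_insert)
    also have "\<dots> = f (u i) \<oplus>\<^bsub>N\<^esub> finsum N (\<lambda>i. f (u i)) I"
      using fa[OF u(2) M.M.finsum_closed[OF u(1)]] insert.IH[OF u(1)] by simp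
    also have "\<dots> = finsum N (\<lambda>i. f (u i)) (insert i I)"
      using insert.hyps u fc by (subst N.M.finsum_insert) auto
    finally show ?case .
  }
qed

text \<open>
  Elements \<open>X i\<close> and right linear forms \<open>\<xi> i\<close> with \<open>x = \<Sum>\<^sub>i X i \<bullet> \<xi> i x\<close> exhibit \<open>M\<close> as a direct summand of
  a finitely generated free module.
\<close>

locale dual_basis = right_module R M
  for R :: "('a, 'r) ring_scheme" and M :: "('a, 'b, 's) module_scheme" +
  fixes I :: "'i set" and X :: "'i \<Rightarrow> 'b" and \<xi> :: "'i \<Rightarrow> 'b \<Rightarrow> 'a"
  assumes finite_I: "finite I"
    and X_closed: "i \<in> I \<Longrightarrow> X i \<in> carrier M"
    and form_closed: "i \<in> I \<Longrightarrow> x \<in> carrier M \<Longrightarrow> \<xi> i x \<in> carrier R"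
    and form_add: "i \<in> I \<Longrightarrow> x \<in> carrier M \<Longrightarrow> y \<in> carrier M \<Longrightarrow> \<xi> i (x \<oplus>\<^bsub>M\<^esub> y) = \<xi> i x \<oplus>\<^bsub>R\<^esub> \<xi> i y"
    and form_act: "i \<in> I \<Longrightarrow> x \<in> carrier M \<Longrightarrow> a \<in> carrier R \<Longrightarrow> \<xi> i (smult M a x) = \<xi> i x \<otimes>\<^bsub>R\<^esub> a"
    and expansion: "x \<in> carrier M \<Longrightarrow> x = finsum M (\<lambda>i. smult M (\<xi> i x) (X i)) I"
begin

lemma finitely_generated: "finitely_generated_module R M"
  unfolding finitely_generated_module_def
proof (intro exI conjI ballI)
  show "finite (X ` I)" "X ` I \<subseteq> carrier M"
    using finite_I X_closed by auto
  fix x assume x: "x \<in> carrier M"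
  let ?J = "\<lambda>s. {i \<in> I. X i = s}"
  \<comment> \<open>\<open>X\<close> need not be injective, hence the coefficients belonging to the same generator are added.\<close>
  define c where "c s = finsum R (\<lambda>i. \<xi> i x) (?J s)" for s
  have "x = finsum M (\<lambda>i. smult M (\<xi> i x) (X i)) (\<Union>(?J ` (X ` I)))"
  proof -
    have "(\<Union>(?J ` (X ` I))) = I" by auto
    then show ?thesis using expansion[OF x] by simp
  qed
  also have "\<dots> = finsum M (\<lambda>s. finsum M (\<lambda>i. smult M (\<xi> i x) (X i)) (?J s)) (X ` I)"
    by (rule M.add.finprod_UN_disjoint)
       (use finite_I X_closed form_closed x in \<open>auto simp: pairwise_def disjnt_def intro: act_closed\<close>)
  also have "\<dots> = finsum M (\<lambda>s. smult M (c s) s) (X ` I)"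
  proof (rule M.finsum_cong')
    show "(\<lambda>s. smult M (c s) s) \<in> X ` I \<rightarrow> carrier M"
      unfolding c_def using X_closed form_closed x by (auto intro!: act_closed R.finsum_closed)
    fix s assume s: "s \<in> X ` I"
    then have sM: "s \<in> carrier M" using X_closed by auto
    have "finsum M (\<lambda>i. smult M (\<xi> i x) (X i)) (?J s) = finsum M (\<lambda>i. smult M (\<xi> i x) s) (?J s)"
      by (rule M.finsum_cong') (use sM form_closed x in \<open>auto intro: act_closed\<close>)
    also have "\<dots> = smult M (c s) s"
      unfolding c_def
      by (rule act_finsum_scalar[OF sM, symmetric]) (use finite_I form_closed x in auto)
    finally show "finsum M (\<lambda>i. smult M (\<xi> i x) (X i)) (?J s) = smult M (c s) s" .
  qed simp
  finally have "x = finsum M (\<lambda>s. smult M (c s) s) (X ` I)" .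
  moreover have "c \<in> X ` I \<rightarrow> carrier R"
    unfolding c_def using form_closed x by (auto intro!: R.finsum_closed)
  ultimately show "\<exists>c\<in>X ` I \<rightarrow> carrier R. x = finsum M (\<lambda>s. smult M (c s) s) (X ` I)"
    by blast
qed

text \<open>A lift along \<open>g\<close> is prescribed by preimages of the values on the \<open>X i\<close>.\<close>

lemma projective: "projective_module TYPE('x) TYPE('y) R M"
  unfolding projective_module_def
proof (intro allI impI, elim conjE)
  fix N :: "('a, 'x) module" and L :: "('a, 'y) module" and g f
  assume N: "right_module R N" and L: "right_module R L" and g: "g \<in> module_homs R N L"
    and surj: "g ` carrier N = carrier L" and f: "f \<in> module_homs R M L"
  interpret N: right_module R N by (rule N)
  interpret L: right_module R L by (rule L)
  have "\<exists>y\<in>carrier N. g y = f (X i)" if "i \<in> I" for i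
  proof -
    have "f (X i) \<in> g ` carrier N"
      using f X_closed[OF that] surj by (auto simp: module_homs_def)
    then show ?thesis by auto
  qed
  then obtain y where y: "\<And>i. i \<in> I \<Longrightarrow> y i \<in> carrier N" "\<And>i. i \<in> I \<Longrightarrow> g (y i) = f (X i)"
    by metis
  define h where "h x = finsum N (\<lambda>i. smult N (\<xi> i x) (y i)) I" for x
  have t: "smult N (\<xi> i x) (y i) \<in> carrier N" if "i \<in> I" "x \<in> carrier M" for i x
    using that form_closed y by (intro N.act_closed)
  have "h \<in> module_homs R M N"
    unfolding module_homs_def
  proof (intro CollectI conjI ballI)
    show "h \<in> carrier M \<rightarrow> carrier N"
      unfolding h_def using t by (auto intro!: N.M.finsum_closed)
    show "h (x \<oplus>\<^bsub>M\<^esub> z) = h x \<oplus>\<^bsub>N\<^esub> h z" if x: "x \<in> carrier M" and z: "z \<in> carrier M" for x z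
    proof -
      have "h (x \<oplus>\<^bsub>M\<^esub> z) = finsum N (\<lambda>i. smult N (\<xi> i x) (y i) \<oplus>\<^bsub>N\<^esub> smult N (\<xi> i z) (y i)) I"
        unfolding h_def
        by (rule N.M.finsum_cong')
           (use t x z y form_closed in \<open>auto simp: form_add N.act_add_scalar\<close>)
      also have "\<dots> = h x \<oplus>\<^bsub>N\<^esub> h z"
        unfolding h_def by (rule N.M.finsum_addf) (use t x z in auto)
      finally show ?thesis .
    qed
    show "h (smult M a x) = smult N a (h x)" if a: "a \<in> carrier R" and x: "x \<in> carrier M" for a x
    proof -
      have "h (smult M a x) = finsum N (\<lambda>i. smult N a (smult N (\<xi> i x) (y i))) I"
        unfolding h_def
      proof (rule N.M.finsum_cong')
        show "(\<lambda>i. smult N a (smult N (\<xi> i x) (y i))) \<in> I \<rightarrow> carrier N"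
          using t[OF _ x] N.act_closed[OF a] by auto
        show "smult N (\<xi> i (smult M a x)) (y i) = smult N a (smult N (\<xi> i x) (y i))" if "i \<in> I" for i
          using form_act[OF that x a] N.act_assoc[OF form_closed[OF that x] a y(1)[OF that]] by simp
      qed simp
      also have "\<dots> = smult N a (h x)"
        unfolding h_def by (rule N.act_finsum_vector[OF a finite_I, symmetric]) (use t x in auto)
      finally show ?thesis .
    qed
  qed
  moreover have "g (h x) = f x" if x: "x \<in> carrier M" for x
  proof -
    have "g (h x) = finsum L (\<lambda>i. g (smult N (\<xi> i x) (y i))) I"
      unfolding h_def by (rule module_homs_finsum[OF N L g finite_I]) (use t x in auto)
    also have "\<dots> = finsum L (\<lambda>i. f (smult M (\<xi> i x) (X i))) I"
    proof (rule L.M.finsum_cong')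
      show "(\<lambda>i. f (smult M (\<xi> i x) (X i))) \<in> I \<rightarrow> carrier L"
        using f act_closed[OF form_closed[OF _ x] X_closed] by (auto simp: module_homs_def)
      show "g (smult N (\<xi> i x) (y i)) = f (smult M (\<xi> i x) (X i))" if "i \<in> I" for i
        using f g y[OF that] form_closed[OF that x] X_closed[OF that] by (auto simp: module_homs_def)
    qed simp
    also have "\<dots> = f (finsum M (\<lambda>i. smult M (\<xi> i x) (X i)) I)"
      by (rule module_homs_finsum[OF right_module_axioms L f finite_I, symmetric])
         (use act_closed[OF form_closed[OF _ x] X_closed] in auto)
    also have "\<dots> = f x" using expansion[OF x] by simp
    finally show ?thesis .
  qed
  ultimately show "\<exists>h\<in>module_homs R M N. \<forall>x\<in>carrier M. g (h x) = f x" by blast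
qed

end


section \<open>The module of sections\<close>

context star_manifold
begin

lemma star_algebra_ring: "ring (star_algebra n A C)"
proof (rule ringI)
  let ?R = "star_algebra n A C"
  show "abelian_group ?R"
  proof (rule abelian_groupI)
    show "\<exists>y\<in>carrier ?R. y \<oplus>\<^bsub>?R\<^esub> x = \<zero>\<^bsub>?R\<^esub>" if "x \<in> carrier ?R" for x
      using that formal_functions_minus[of UNIV x]
      by (intro bexI[of _ "\<lambda>r z. - x r z"]) (auto simp: star_algebra_def)
  qed (auto simp: star_algebra_def fun_eq_iff intro: formal_functions_add formal_functions_zero)
  show "monoid ?R"
  proof (rule monoidI)
    show "x \<otimes>\<^bsub>?R\<^esub> y \<otimes>\<^bsub>?R\<^esub> z = x \<otimes>\<^bsub>?R\<^esub> (y \<otimes>\<^bsub>?R\<^esub> z)"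
      if "x \<in> carrier ?R" "y \<in> carrier ?R" "z \<in> carrier ?R" for x y z
      using that star_product by (simp add: star_algebra_def star_product_def)
    show "\<one>\<^bsub>?R\<^esub> \<otimes>\<^bsub>?R\<^esub> x = x" "x \<otimes>\<^bsub>?R\<^esub> \<one>\<^bsub>?R\<^esub> = x" if "x \<in> carrier ?R" for x
      using that star_product by (simp_all add: star_algebra_def star_product_def)
  qed (auto simp: star_algebra_def intro: star_closed const_series_1)
  show "(x \<oplus>\<^bsub>?R\<^esub> y) \<otimes>\<^bsub>?R\<^esub> z = x \<otimes>\<^bsub>?R\<^esub> z \<oplus>\<^bsub>?R\<^esub> y \<otimes>\<^bsub>?R\<^esub> z"
    "z \<otimes>\<^bsub>?R\<^esub> (x \<oplus>\<^bsub>?R\<^esub> y) = z \<otimes>\<^bsub>?R\<^esub> x \<oplus>\<^bsub>?R\<^esub> z \<otimes>\<^bsub>?R\<^esub> y"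
    if "x \<in> carrier ?R" "y \<in> carrier ?R" "z \<in> carrier ?R" for x y z
    using that star_add_left[of UNIV _ x y z] star_add_right[of UNIV _ x y z]
    by (simp_all add: star_algebra_def fun_eq_iff)
qed

end

context star_bundle
begin

abbreviation act :: "(nat \<Rightarrow> 'm \<Rightarrow> 'v) \<Rightarrow> 'm fseries \<Rightarrow> nat \<Rightarrow> 'm \<Rightarrow> 'v" (infixl "\<bullet>\<bullet>" 70) where
  "s \<bullet>\<bullet> f \<equiv> bullet n A C scl E k F m U e \<Phi> \<rho> s f"

lemma dc_inj: "s \<in> FS \<Longrightarrow> t \<in> FS \<Longrightarrow> dc s \<cong>\<^sub>U dc t \<Longrightarrow> s = t"
  by (rule deforms_components_inj[OF dc_deforms_components])

lemma dc_compatible: "s \<in> FS \<Longrightarrow> compatible (dc s)"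
  by (rule deforms_componentsD(1)[OF dc_deforms_components])

lemma dc_add: "s \<in> FS \<Longrightarrow> t \<in> FS \<Longrightarrow> \<alpha> \<in> {1..m} \<Longrightarrow> i < k \<Longrightarrow> x \<in> U \<alpha> \<Longrightarrow>
    dc (s \<boxplus> t) \<alpha> i r x = dc s \<alpha> i r x + dc t \<alpha> i r x"
  by (rule coll_eqD[OF deforms_componentsD(2)[OF dc_deforms_components]])

lemma act_section:
  assumes s: "s \<in> FS" and f: "f \<in> FF UNIV"
  shows "s \<bullet>\<bullet> f \<in> FS" "dc (s \<bullet>\<bullet> f) \<cong>\<^sub>U (\<lambda>\<alpha> i. dc s \<alpha> i \<star> f)"
proof -
  let ?P = "\<lambda>t. t \<in> FS \<and> (\<forall>\<alpha>\<in>{1..m}. \<forall>i<k. \<forall>r. \<forall>x\<in>U \<alpha>. dc t \<alpha> i r x = (dc s \<alpha> i \<star> f) r x)"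
  obtain t where t: "t \<in> FS" "dc t \<cong>\<^sub>U (\<lambda>\<alpha> i. dc s \<alpha> i \<star> f)"
    by (rule deforms_components_surj[OF dc_deforms_components compatible_star[OF dc_compatible[OF s] f]])
  have "?P (THE t. ?P t)"
  proof (rule theI[of ?P t])
    show "?P t" using t by (simp add: coll_eq_def)
    show "t' = t" if "?P t'" for t'
    proof (rule dc_inj)
      have "dc t' \<cong>\<^sub>U (\<lambda>\<alpha> i. dc s \<alpha> i \<star> f)" using that unfolding coll_eq_def by (rule conjunct2)
      then show "dc t' \<cong>\<^sub>U dc t" by (rule coll_eq_trans[OF _ coll_eq_sym[OF t(2)]])
    qed (use that t in auto)
  qed
  then have "?P (s \<bullet>\<bullet> f)" unfolding bullet_def .
  then show "s \<bullet>\<bullet> f \<in> FS" "dc (s \<bullet>\<bullet> f) \<cong>\<^sub>U (\<lambda>\<alpha> i. dc s \<alpha> i \<star> f)"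
    unfolding coll_eq_def by (rule conjunct1, rule conjunct2)
qed

lemma dc_act: "s \<in> FS \<Longrightarrow> f \<in> FF UNIV \<Longrightarrow> \<alpha> \<in> {1..m} \<Longrightarrow> i < k \<Longrightarrow> x \<in> U \<alpha> \<Longrightarrow>
    dc (s \<bullet>\<bullet> f) \<alpha> i r x = (dc s \<alpha> i \<star> f) r x"
  by (rule coll_eqD[OF act_section(2)])

abbreviation "RR \<equiv> star_algebra n A C"
abbreviation "MM \<equiv> deformed_sections n A C scl E k F m U e \<Phi> \<rho>"

lemma RR_simps:
  "carrier RR = FF UNIV" "x \<oplus>\<^bsub>RR\<^esub> y = (x \<boxplus> y)" "x \<otimes>\<^bsub>RR\<^esub> y = x \<star> y"
  "\<one>\<^bsub>RR\<^esub> = const_series (\<lambda>_. 1)"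
  by (simp_all add: star_algebra_def)

lemma MM_simps:
  "carrier MM = FS" "s \<oplus>\<^bsub>MM\<^esub> t = (s \<boxplus> t)" "\<zero>\<^bsub>MM\<^esub> = (\<lambda>r x. 0)" "smult MM f s = s \<bullet>\<bullet> f"
  by (simp_all add: deformed_sections_def)

lemma sections_abelian_group: "abelian_group MM"
proof (rule abelian_groupI)
  show "\<exists>y\<in>carrier MM. y \<oplus>\<^bsub>MM\<^esub> x = \<zero>\<^bsub>MM\<^esub>" if "x \<in> carrier MM" for x
    using that FS_minus[of x] by (intro bexI[of _ "\<lambda>r z. - x r z"]) (auto simp: MM_simps)
qed (auto simp: MM_simps fun_eq_iff FS_add FS_zero)

text \<open>
  The map to collections turns \<open>\<bullet>\<close> into componentwise multiplication, for which the module laws are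
  laws of \<open>\<star>\<close>; they return to sections because this map is injective.
\<close>

lemma sections_right_module: "right_module RR MM"
proof -
  interpret R: ring RR by (rule star_algebra_ring)
  interpret M: abelian_group MM by (rule sections_abelian_group)
  note W = open_U and AS = act_section(1)
  have dF: "dc s \<alpha> i \<in> FF (U \<alpha>)" if "s \<in> FS" "\<alpha> \<in> {1..m}" "i < k" for s \<alpha> i
    by (rule compatible_FF[OF dc_compatible[OF that(1)] that(2,3)])
  have eqI: "s = t" if "s \<in> FS" "t \<in> FS"
    "\<And>\<alpha> i r z. \<alpha> \<in> {1..m} \<Longrightarrow> i < k \<Longrightarrow> z \<in> U \<alpha> \<Longrightarrow> dc s \<alpha> i r z = dc t \<alpha> i r z" for s t
    by (rule dc_inj[OF that(1,2)]) (rule coll_eqI[OF that(3)])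
  show ?thesis
  proof (unfold_locales, unfold RR_simps MM_simps)
    fix a b x y assume a: "a \<in> FF UNIV" and x: "x \<in> FS"
    show "x \<bullet>\<bullet> a \<in> FS" by (rule AS[OF x a])
    show "x \<bullet>\<bullet> (a \<boxplus> b) = (x \<bullet>\<bullet> a \<boxplus> x \<bullet>\<bullet> b)" if b: "b \<in> FF UNIV"
    proof -
      have ab: "(a \<boxplus> b) \<in> FF UNIV" by (rule formal_functions_add[OF open_UNIV a b])
      show ?thesis
      proof (rule eqI[OF AS[OF x ab] FS_add[OF AS[OF x a] AS[OF x b]]])
        fix \<alpha> i r z assume 1: "\<alpha> \<in> {1..m}" "i < k" "z \<in> U \<alpha>"
        show "dc (x \<bullet>\<bullet> (a \<boxplus> b)) \<alpha> i r z = dc (x \<bullet>\<bullet> a \<boxplus> x \<bullet>\<bullet> b) \<alpha> i r z"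
          unfolding dc_act[OF x ab 1] dc_add[OF AS[OF x a] AS[OF x b] 1] dc_act[OF x a 1] dc_act[OF x b 1]
          by (rule star_add_right[OF W[OF 1(1)] 1(3) FF_UNIV[OF a] FF_UNIV[OF b] dF[OF x 1(1,2)]])
      qed
    qed
    show "(x \<boxplus> y) \<bullet>\<bullet> a = (x \<bullet>\<bullet> a \<boxplus> y \<bullet>\<bullet> a)" if y: "y \<in> FS"
    proof -
      have xy: "(x \<boxplus> y) \<in> FS" by (rule FS_add[OF x y])
      show ?thesis
      proof (rule eqI[OF AS[OF xy a] FS_add[OF AS[OF x a] AS[OF y a]]])
        fix \<alpha> i r z assume 1: "\<alpha> \<in> {1..m}" "i < k" "z \<in> U \<alpha>"
        note Wz = W[OF 1(1)] 1(3)
        have "(dc (x \<boxplus> y) \<alpha> i \<star> a) r z = ((dc x \<alpha> i \<boxplus> dc y \<alpha> i) \<star> a) r z"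
          by (rule star_cong[OF Wz dF[OF xy 1(1,2)] FF_UNIV[OF a] dc_add[OF x y 1(1,2)] refl])
        also have "\<dots> = (dc x \<alpha> i \<star> a) r z + (dc y \<alpha> i \<star> a) r z"
          by (rule star_add_left[OF Wz dF[OF x 1(1,2)] dF[OF y 1(1,2)] FF_UNIV[OF a]])
        finally show "dc ((x \<boxplus> y) \<bullet>\<bullet> a) \<alpha> i r z = dc (x \<bullet>\<bullet> a \<boxplus> y \<bullet>\<bullet> a) \<alpha> i r z"
          unfolding dc_act[OF xy a 1] dc_add[OF AS[OF x a] AS[OF y a] 1] dc_act[OF x a 1] dc_act[OF y a 1] .
      qed
    qed
    show "x \<bullet>\<bullet> a \<bullet>\<bullet> b = x \<bullet>\<bullet> (a \<star> b)" if b: "b \<in> FF UNIV"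
    proof -
      have ab: "a \<star> b \<in> FF UNIV" by (rule star_closed[OF open_UNIV a b])
      show ?thesis
      proof (rule eqI[OF AS[OF AS[OF x a] b] AS[OF x ab]])
        fix \<alpha> i r z assume 1: "\<alpha> \<in> {1..m}" "i < k" "z \<in> U \<alpha>"
        note Wz = W[OF 1(1)] 1(3)
        have "(dc (x \<bullet>\<bullet> a) \<alpha> i \<star> b) r z = (dc x \<alpha> i \<star> a \<star> b) r z"
          by (rule star_cong[OF Wz dF[OF AS[OF x a] 1(1,2)] FF_UNIV[OF b] dc_act[OF x a 1(1,2)] refl])
        also have "\<dots> = (dc x \<alpha> i \<star> (a \<star> b)) r z"
          by (rule star_assoc[OF Wz dF[OF x 1(1,2)] FF_UNIV[OF a] FF_UNIV[OF b]])
        finally show "dc (x \<bullet>\<bullet> a \<bullet>\<bullet> b) \<alpha> i r z = dc (x \<bullet>\<bullet> (a \<star> b)) \<alpha> i r z"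
          unfolding dc_act[OF AS[OF x a] b 1] dc_act[OF x ab 1] .
      qed
    qed
  next
    fix x assume x: "x \<in> FS"
    have one: "const_series (\<lambda>_. 1) \<in> FF UNIV" by (rule const_series_1[OF open_UNIV])
    show "x \<bullet>\<bullet> const_series (\<lambda>_. 1) = x"
    proof (rule eqI[OF AS[OF x one] x])
      fix \<alpha> i r z assume 1: "\<alpha> \<in> {1..m}" "i < k" "z \<in> U \<alpha>"
      show "dc (x \<bullet>\<bullet> const_series (\<lambda>_. 1)) \<alpha> i r z = dc x \<alpha> i r z"
        unfolding dc_act[OF x one 1]
        by (rule star_one_right[OF W[OF 1(1)] 1(3) dF[OF x 1(1,2)]])
    qed
  qed
qed

lemma dc_finsum:
  assumes "finite J" "s \<in> J \<rightarrow> FS" "\<alpha> \<in> {1..m}" "i < k" "x \<in> U \<alpha>"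
  shows "dc (finsum MM s J) \<alpha> i r x = (\<Sum>j\<in>J. dc (s j) \<alpha> i r x)"
  using assms(1,2)
proof (induction J rule: finite_induct)
  interpret M: abelian_group MM by (rule sections_abelian_group)
  {
    case empty
    show ?case
      using dc_add[OF FS_zero FS_zero assms(3-5), of r] by (simp add: M.finsum_empty MM_simps)
  next
    case (insert j J)
    then have s: "s \<in> J \<rightarrow> carrier MM" "s j \<in> carrier MM" by (auto simp: MM_simps)
    have "dc (finsum MM s (insert j J)) \<alpha> i r x = dc (s j \<boxplus> finsum MM s J) \<alpha> i r x"
      using insert.hyps s by (simp add: M.finsum_insert MM_simps(2))
    also have "\<dots> = dc (s j) \<alpha> i r x + dc (finsum MM s J) \<alpha> i r x"
      by (rule dc_add) (use s M.finsum_closed[OF s(1)] assms(3-5) in \<open>auto simp: MM_simps(1)\<close>)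
    finally show ?case using insert by simp
  }
qed

lemma glue_sum:
  assumes g: "\<And>j. j \<in> J \<Longrightarrow> supported (g j)"
  shows "glue (\<lambda>\<beta> l r x. \<Sum>j\<in>J. g j \<beta> l r x) \<cong>\<^sub>U (\<lambda>\<alpha> i r x. \<Sum>j\<in>J. glue (g j) \<alpha> i r x)"
proof (rule coll_eqI)
  fix \<alpha> i r x assume 1: "\<alpha> \<in> {1..m}" "i < k" "x \<in> U \<alpha>"
  have "glue (\<lambda>\<beta> l r x. \<Sum>j\<in>J. g j \<beta> l r x) \<alpha> i r x =
      (\<Sum>\<beta>\<in>{\<beta>\<in>{1..m}. x \<in> U \<beta>}. \<Sum>j\<in>J. mv (\<Phi> \<alpha> \<beta>) (g j \<beta>) i r x)"
    unfolding glue_def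
  proof (intro sum.cong refl)
    fix \<beta> assume "\<beta> \<in> {\<gamma>\<in>{1..m}. x \<in> U \<gamma>}"
    then have \<beta>: "\<beta> \<in> {1..m}" "x \<in> U \<beta>" by auto
    show "mv (\<Phi> \<alpha> \<beta>) (\<lambda>l r x. \<Sum>j\<in>J. g j \<beta> l r x) i r x = (\<Sum>j\<in>J. mv (\<Phi> \<alpha> \<beta>) (g j \<beta>) i r x)"
      by (rule mat_vec_star_sum[OF overlap(1)[OF 1(1) \<beta>(1)]])
         (use 1 \<beta> overlap in \<open>auto intro: formal_functions_subset[OF supportedD(1)[OF g \<beta>(1)]]\<close>)
  qed
  then show "glue (\<lambda>\<beta> l r x. \<Sum>j\<in>J. g j \<beta> l r x) \<alpha> i r x = (\<Sum>j\<in>J. glue (g j) \<alpha> i r x)"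
    unfolding glue_def by (simp only: sum.swap[of _ J])
qed

text \<open>
  Let \<open>u\<^sub>\<beta>\<close>, \<open>v\<^sub>\<beta>\<close> be supported in \<open>U \<beta>\<close> with \<open>\<Sum>\<^sub>\<beta> u\<^sub>\<beta> v\<^sub>\<beta> = 1\<close>. The right linear map which sends a section \<open>y\<close> with
  deformed components \<open>b\<close> to the collection \<open>\<Sum>\<^sub>\<beta> \<Phi>\<^sub>\<alpha>\<^sub>\<beta> \<star> u\<^sub>\<beta> \<star> v\<^sub>\<beta> \<star> b\<^sub>\<beta>\<close> is bijective. Applied to the preimage \<open>y\<close> of the
  collection of \<open>x\<close>, this formula expands \<open>x\<close> in the columns of the \<open>\<Phi>\<^sub>\<alpha>\<^sub>\<beta> \<star> u\<^sub>\<beta>\<close> with coefficients \<open>v\<^sub>\<beta> \<star> b\<^sub>\<beta>\<close>,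
  extended by zero to the manifold.
\<close>

lemma sections_dual_basis:
  "\<exists>(X :: nat \<times> nat \<Rightarrow> _) \<xi>. dual_basis RR MM ({1..m} \<times> {..<k}) X \<xi>"
proof -
  interpret M: right_module RR MM by (rule sections_right_module)
  let ?I = "{1..m} \<times> {..<k}"
  obtain c where c: "\<And>\<beta>. smooth_fun n A UNIV (c \<beta> :: 'm \<Rightarrow> real)"
    "\<And>x. (\<Sum>\<beta>\<in>{1..m}. c \<beta> x * (\<rho> \<beta> x)\<^sup>2) = 1"
    by (rule rho_squares) blast
  define u where "u \<beta> = real_series (\<lambda>x. c \<beta> x * \<rho> \<beta> x)" for \<beta>
  define v where "v \<beta> = real_series (\<rho> \<beta>)" for \<beta>
  have v: "cutoff v" unfolding v_def by (rule cutoff_rho)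
  have u: "cutoff u"
    unfolding u_def
    by (rule cutoff_real_series)
       (simp_all add: smooth_fun_mult[OF open_UNIV] c rho_smooth rho_0 del: One_nat_def)
  have uv: "(\<Sum>\<beta>\<in>{1..m}. u \<beta> 0 x * v \<beta> 0 x) = 1" for x
  proof -
    have "(\<Sum>\<beta>\<in>{1..m}. u \<beta> 0 x * v \<beta> 0 x) = complex_of_real (\<Sum>\<beta>\<in>{1..m}. c \<beta> x * (\<rho> \<beta> x)\<^sup>2)"
      by (simp add: u_def v_def const_series_def power2_eq_square mult.assoc)
    then show ?thesis by (simp only: c(2) of_real_1)
  qed
  define L where "L s = glue_cut u (cut v (dc s))" for s
  have L: "deforms_components L"
    unfolding L_def by (rule glue_cut_cut_deforms_components[OF u v uv])
  note L_inj = deforms_components_inj[OF L] and LD = deforms_componentsD[OF L]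
  have sm: "smooth_coll (dc s)" "smooth_coll (cut v (dc s))" if "s \<in> FS" for s
    using compatible_smooth_coll[OF dc_compatible[OF that]] cut_smooth_coll[OF v] by auto
  have cut_act: "cut v (dc (s \<bullet>\<bullet> a)) \<cong>\<^sub>U (\<lambda>\<beta> l. cut v (dc s) \<beta> l \<star> a)" if s: "s \<in> FS" and a: "a \<in> FF UNIV" for s a
    by (rule coll_eq_trans[OF cut_cong[OF v sm(1)[OF act_section(1)[OF s a]] act_section(2)[OF s a]]
          cut_star[OF v sm(1)[OF s] a]])
  have L_act: "L (s \<bullet>\<bullet> a) \<cong>\<^sub>U (\<lambda>\<alpha> i. L s \<alpha> i \<star> a)" if s: "s \<in> FS" and a: "a \<in> FF UNIV" for s a
    unfolding L_def
    by (rule coll_eq_trans[OF glue_cut_cong[OF u sm(2)[OF act_section(1)[OF s a]] cut_act[OF s a]]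
          glue_cut_star[OF u sm(2)[OF s] a]])
  note FU = FF_UNIV
  have star_coll_cong: "(\<lambda>\<alpha> i. b \<alpha> i \<star> a) \<cong>\<^sub>U (\<lambda>\<alpha> i. b' \<alpha> i \<star> a)"
    if "compatible b" "b \<cong>\<^sub>U b'" "a \<in> FF UNIV" for b b' a
    by (intro coll_eqI star_cong[OF open_U _ compatible_FF[OF that(1)] FU[OF that(3)] coll_eqD[OF that(2)] refl])

  have "\<exists>y. y \<in> FS \<and> L y \<cong>\<^sub>U dc x" if "x \<in> FS" for x
    using deforms_components_surj[OF L dc_compatible[OF that]] by blast
  then obtain y where y: "\<And>x. x \<in> FS \<Longrightarrow> y x \<in> FS" "\<And>x. x \<in> FS \<Longrightarrow> L (y x) \<cong>\<^sub>U dc x"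
    by metis
  have y_add: "y (s \<boxplus> t) = (y s \<boxplus> y t)" if s: "s \<in> FS" and t: "t \<in> FS" for s t
  proof (rule L_inj)
    show "L (y (s \<boxplus> t)) \<cong>\<^sub>U L (y s \<boxplus> y t)"
    proof (rule coll_eqI)
      fix \<alpha> i r x assume 1: "\<alpha> \<in> {1..m}" "i < k" "x \<in> U \<alpha>"
      show "L (y (s \<boxplus> t)) \<alpha> i r x = L (y s \<boxplus> y t) \<alpha> i r x"
        using coll_eqD[OF y(2)[OF FS_add[OF s t]] 1, of r] dc_add[OF s t 1, of r]
          coll_eqD[OF y(2)[OF s] 1, of r] coll_eqD[OF y(2)[OF t] 1, of r]
          coll_eqD[OF LD(2)[OF y(1)[OF s] y(1)[OF t]] 1, of r] by simp
    qed
  qed (intro y(1) FS_add s t)+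
  have y_act: "y (s \<bullet>\<bullet> a) = y s \<bullet>\<bullet> a" if s: "s \<in> FS" and a: "a \<in> FF UNIV" for s a
  proof (rule L_inj)
    show "L (y (s \<bullet>\<bullet> a)) \<cong>\<^sub>U L (y s \<bullet>\<bullet> a)"
      by (rule coll_eq_trans[OF coll_eq_trans[OF y(2)[OF act_section(1)[OF s a]] act_section(2)[OF s a]]
            coll_eq_sym[OF coll_eq_trans[OF L_act[OF y(1)[OF s] a]
              star_coll_cong[OF LD(1)[OF y(1)[OF s]] y(2)[OF s] a]]]])
  qed (intro y(1) act_section(1) s a)+

  \<comment> \<open>Elements of the algebra are functions on all of the manifold, whence the extension by zero.\<close>
  define \<xi> where "\<xi> j x = (\<lambda>r z. if z \<in> U (fst j) then cut v (dc (y x)) (fst j) (snd j) r z else 0)" for j x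
  have \<xi>_U: "\<xi> (\<beta>, l) x r z = cut v (dc (y x)) \<beta> l r z" if "z \<in> U \<beta>" for \<beta> l x r z
    using that by (simp add: \<xi>_def)
  have \<xi>_0: "\<xi> (\<beta>, l) x r z = 0" if "x \<in> FS" "\<beta> \<in> {1..m}" "l < k" "z \<notin> supp \<beta>" for \<beta> l x r z
    using cut_FF(2)[where b = "dc (y x)" and \<beta> = \<beta> and l = l,
        OF v smooth_collD[OF sm(1)[OF y(1)[OF that(1)]] that(2,3)] that(2) open_U[OF that(2)] _ that(4)]
    by (simp add: \<xi>_def)
  have \<xi>_FF: "\<xi> (\<beta>, l) x \<in> FF UNIV" if x: "x \<in> FS" and \<beta>: "\<beta> \<in> {1..m}" and l: "l < k" for \<beta> l x
  proof (rule formal_functions_local)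
    fix z
    show "\<exists>V. open V \<and> z \<in> V \<and> V \<subseteq> UNIV \<and> \<xi> (\<beta>, l) x \<in> FF V"
    proof (cases "z \<in> U \<beta>")
      case True
      have "\<xi> (\<beta>, l) x \<in> FF (U \<beta>)"
        by (rule formal_functions_cong[OF open_U[OF \<beta>] smooth_collD[OF sm(2)[OF y(1)[OF x]] \<beta> l]])
           (rule \<xi>_U[symmetric])
      then show ?thesis using True open_U[OF \<beta>] by blast
    next
      case False
      have o: "open (- supp \<beta>)" using supp_closed by auto
      have "\<xi> (\<beta>, l) x \<in> FF (- supp \<beta>)"
        by (rule formal_functions_cong[OF o formal_functions_zero[OF o]]) (use \<xi>_0[OF x \<beta> l] in auto)
      then show ?thesis using False supp_subset[OF \<beta>] o by blast
    qed
  qed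

  \<comment> \<open>\<open>glue (gen (\<beta>, l))\<close> is the \<open>l\<close>-th column of \<open>\<Phi>\<^sub>\<alpha>\<^sub>\<beta> \<star> u\<^sub>\<beta>\<close>.\<close>
  define gen where "gen j = (\<lambda>\<beta> l. if (\<beta>, l) = j then u \<beta> else (\<lambda>_ _. 0))" for j :: "nat \<times> nat"
  have gen: "supported (gen j)" for j
    unfolding supported_def gen_def
    using cutoffD[OF u] formal_functions_zero[OF open_U] by auto
  have "\<exists>X. X \<in> FS \<and> dc X \<cong>\<^sub>U glue (gen j)" for j
    using deforms_components_surj[OF dc_deforms_components glue_compatible[OF gen]] by blast
  then obtain X where X: "\<And>j. X j \<in> FS" "\<And>j. dc (X j) \<cong>\<^sub>U glue (gen j)"
    by metis

  have expansion: "x = finsum MM (\<lambda>j. X j \<bullet>\<bullet> \<xi> j x) ?I" if x: "x \<in> FS" for x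
  proof (rule dc_inj[OF x])
    have XI: "X j \<bullet>\<bullet> \<xi> j x \<in> FS" if "j \<in> ?I" for j
      using that X(1) \<xi>_FF[OF x] by (intro act_section(1)) auto
    then show "finsum MM (\<lambda>j. X j \<bullet>\<bullet> \<xi> j x) ?I \<in> FS"
      using M.M.finsum_closed[of "\<lambda>j. X j \<bullet>\<bullet> \<xi> j x" ?I] by (auto simp: MM_simps(1))
    let ?b = "\<lambda>\<beta> l r z. \<Sum>j\<in>?I. (gen j \<beta> l \<star> \<xi> j x) r z"
    have sup: "supported (\<lambda>\<beta> l. gen j \<beta> l \<star> \<xi> j x)" if "j \<in> ?I" for j
      unfolding supported_def
    proof (intro ballI allI impI conjI)
      have \<xi>: "\<xi> j x \<in> FF UNIV" using that \<xi>_FF[OF x] by auto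
      fix \<beta> l assume \<beta>: "\<beta> \<in> {1..m}" and l: "l < k"
      show "gen j \<beta> l \<star> \<xi> j x \<in> FF (U \<beta>)"
        by (rule star_closed[OF open_U[OF \<beta>] supportedD(1)[OF gen \<beta> l] FU[OF \<xi>]])
      fix r z assume z: "z \<in> U \<beta> - supp \<beta>"
      have o: "open (U \<beta> - supp \<beta>)" using open_U[OF \<beta>] supp_closed by auto
      have "(gen j \<beta> l \<star> \<xi> j x) r z = ((\<lambda>_ _. 0) \<star> \<xi> j x) r z"
        by (rule star_cong[OF o z formal_functions_subset[OF supportedD(1)[OF gen \<beta> l]] FU[OF \<xi>]])
           (use supportedD(2)[OF gen \<beta> l] in auto)
      then show "(gen j \<beta> l \<star> \<xi> j x) r z = 0"
        using star_zero_left[OF o z FU[OF \<xi>]] by simp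
    qed
    have b: "cut u (cut v (dc (y x))) \<cong>\<^sub>U ?b"
    proof (rule coll_eqI)
      fix \<beta> l r z assume 1: "\<beta> \<in> {1..m}" "l < k" "z \<in> U \<beta>"
      note W = open_U[OF 1(1)] 1(3)
      have "(gen j \<beta> l \<star> \<xi> j x) r z = (if j = (\<beta>, l) then (u \<beta> \<star> \<xi> (\<beta>, l) x) r z else 0)" if "j \<in> ?I" for j
        using that star_zero_left[OF W FU[of "\<xi> j x"]] \<xi>_FF[OF x] by (auto simp: gen_def)
      then have "?b \<beta> l r z = (u \<beta> \<star> \<xi> (\<beta>, l) x) r z"
        using 1 by (simp del: One_nat_def)
      also have "\<dots> = (u \<beta> \<star> cut v (dc (y x)) \<beta> l) r z"
        by (rule star_cong[OF W cutoffD(1)[OF u 1(1)] FU[OF \<xi>_FF[OF x 1(1,2)]] refl \<xi>_U])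
      finally show "cut u (cut v (dc (y x))) \<beta> l r z = ?b \<beta> l r z"
        by (simp add: cut_def[of u])
    qed
    show "dc x \<cong>\<^sub>U dc (finsum MM (\<lambda>j. X j \<bullet>\<bullet> \<xi> j x) ?I)"
    proof (rule coll_eqI)
      fix \<alpha> i r z assume 1: "\<alpha> \<in> {1..m}" "i < k" "z \<in> U \<alpha>"
      have "dc x \<alpha> i r z = L (y x) \<alpha> i r z"
        using coll_eqD[OF y(2)[OF x] 1] by simp
      also have "\<dots> = glue ?b \<alpha> i r z"
        unfolding L_def glue_cut_def
        by (rule coll_eqD[OF glue_cong[OF cut_supported[OF u sm(2)[OF y(1)[OF x]]] b] 1])
      also have "\<dots> = (\<Sum>j\<in>?I. glue (\<lambda>\<beta> l. gen j \<beta> l \<star> \<xi> j x) \<alpha> i r z)"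
        by (rule coll_eqD[OF glue_sum[OF sup] 1])
      also have "\<dots> = (\<Sum>j\<in>?I. dc (X j \<bullet>\<bullet> \<xi> j x) \<alpha> i r z)"
      proof (intro sum.cong refl)
        fix j assume j: "j \<in> ?I"
        then have \<xi>: "\<xi> j x \<in> FF UNIV" using \<xi>_FF[OF x] by auto
        have "glue (\<lambda>\<beta> l. gen j \<beta> l \<star> \<xi> j x) \<alpha> i r z = (glue (gen j) \<alpha> i \<star> \<xi> j x) r z"
          by (rule coll_eqD[OF glue_star[OF gen \<xi>] 1])
        also have "\<dots> = (dc (X j) \<alpha> i \<star> \<xi> j x) r z"
          by (rule coll_eqD[OF star_coll_cong[OF glue_compatible[OF gen] coll_eq_sym[OF X(2)] \<xi>] 1])
        also have "\<dots> = dc (X j \<bullet>\<bullet> \<xi> j x) \<alpha> i r z"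
          by (rule dc_act[OF X(1) \<xi> 1, symmetric])
        finally show "glue (\<lambda>\<beta> l. gen j \<beta> l \<star> \<xi> j x) \<alpha> i r z = dc (X j \<bullet>\<bullet> \<xi> j x) \<alpha> i r z" .
      qed
      also have "\<dots> = dc (finsum MM (\<lambda>j. X j \<bullet>\<bullet> \<xi> j x) ?I) \<alpha> i r z"
        by (rule dc_finsum[OF _ _ 1, symmetric]) (use XI in auto)
      finally show "dc x \<alpha> i r z = dc (finsum MM (\<lambda>j. X j \<bullet>\<bullet> \<xi> j x) ?I) \<alpha> i r z" .
    qed
  qed

  have "dual_basis RR MM ?I X \<xi>"
  proof (unfold_locales, unfold RR_simps MM_simps)
    show "finite ?I" by simp
    show "X j \<in> FS" for j by (rule X(1))
    fix j x assume "j \<in> ?I" and x: "x \<in> FS"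
    then obtain \<beta> l where j: "j = (\<beta>, l)" "\<beta> \<in> {1..m}" "l < k" by auto
    show "\<xi> j x \<in> FF UNIV" unfolding j(1) by (rule \<xi>_FF[OF x j(2,3)])
    show "\<xi> j (x \<boxplus> x') = (\<xi> j x \<boxplus> \<xi> j x')" if x': "x' \<in> FS" for x'
    proof (intro ext)
      fix r z
      note add = coll_eq_trans[OF cut_cong[OF v sm(1)[OF FS_add[OF y(1)[OF x] y(1)[OF x']]]
          deforms_componentsD(2)[OF dc_deforms_components y(1)[OF x] y(1)[OF x']]]
          cut_add[OF v sm(1)[OF y(1)[OF x]] sm(1)[OF y(1)[OF x']]]]
      show "\<xi> j (x \<boxplus> x') r z = \<xi> j x r z + \<xi> j x' r z"
        using coll_eqD[OF add j(2,3), of z r] by (simp add: \<xi>_def y_add[OF x x'] j(1))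
    qed
    show "\<xi> j (x \<bullet>\<bullet> a) = \<xi> j x \<star> a" if a: "a \<in> FF UNIV" for a
    proof (intro ext)
      fix r z
      show "\<xi> j (x \<bullet>\<bullet> a) r z = (\<xi> j x \<star> a) r z"
      proof (cases "z \<in> U \<beta>")
        case True
        have "\<xi> j (x \<bullet>\<bullet> a) r z = (cut v (dc (y x)) \<beta> l \<star> a) r z"
          using coll_eqD[OF cut_act[OF y(1)[OF x] a] j(2,3) True, of r] True
          by (simp add: j(1) \<xi>_U y_act[OF x a])
        also have "\<dots> = (\<xi> j x \<star> a) r z"
          unfolding j(1)
          by (rule star_cong[OF open_U[OF j(2)] True smooth_collD[OF sm(2)[OF y(1)[OF x]] j(2,3)] FU[OF a]
                \<xi>_U[symmetric] refl])
        finally show ?thesis .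
      next
        case False
        have o: "open (- supp \<beta>)" "z \<in> - supp \<beta>"
          using supp_closed supp_subset[OF j(2)] False by auto
        have "(\<xi> j x \<star> a) r z = ((\<lambda>_ _. 0) \<star> a) r z"
          unfolding j(1)
          by (rule star_cong[OF o FU[OF \<xi>_FF[OF x j(2,3)]] FU[OF a] _ refl]) (use \<xi>_0[OF x j(2,3)] in auto)
        also have "\<dots> = 0" by (rule star_zero_left[OF o FU[OF a]])
        finally show ?thesis using False by (simp add: \<xi>_def j(1))
      qed
    qed
  next
    fix x assume "x \<in> FS"
    then show "x = finsum MM (\<lambda>j. X j \<bullet>\<bullet> \<xi> j x) ?I" by (rule expansion)
  qed
  then show ?thesis by blast
qed

end

theorem mainTheorem3:
  fixes n :: nat
    and A :: "'m::{t2_space, second_countable_topology} chart set"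
    and P :: "('m \<Rightarrow> complex) \<Rightarrow> ('m \<Rightarrow> complex) \<Rightarrow> 'm \<Rightarrow> complex"
    and C :: "nat \<Rightarrow> ('m \<Rightarrow> complex) \<Rightarrow> ('m \<Rightarrow> complex) \<Rightarrow> 'm \<Rightarrow> complex"
    and scl :: "complex \<Rightarrow> 'v::ab_group_add \<Rightarrow> 'v"
    and E :: "'m \<Rightarrow> 'v set"
    and k :: nat
    and F :: "('m set \<times> (nat \<Rightarrow> 'm \<Rightarrow> 'v)) set"
    and h :: "'m \<Rightarrow> 'v \<Rightarrow> 'v \<Rightarrow> complex"
    and m :: nat
    and U :: "nat \<Rightarrow> 'm set"
    and e :: "nat \<Rightarrow> nat \<Rightarrow> 'm \<Rightarrow> 'v"
    and \<phi> :: "nat \<Rightarrow> nat \<Rightarrow> nat \<Rightarrow> nat \<Rightarrow> 'm \<Rightarrow> complex"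
    and \<Phi> :: "nat \<Rightarrow> nat \<Rightarrow> nat \<Rightarrow> nat \<Rightarrow> 'm fseries"
    and \<rho> :: "nat \<Rightarrow> 'm \<Rightarrow> real"
  assumes "smooth_atlas n A"
    and "poisson_bracket n A P"
    and "hermitian_star_product n A P C"
    and "vector_bundle n A scl E k F"
    and "hermitian_metric n A scl E k F h"
    and "\<And>\<alpha>. \<alpha> \<in> {1..m} \<Longrightarrow> open (U \<alpha>)"
    and "(\<Union>\<alpha>\<in>{1..m}. U \<alpha>) = UNIV"
    and "\<And>\<alpha>. \<alpha> \<in> {1..m} \<Longrightarrow> smooth_frame n A scl E k F (U \<alpha>) (e \<alpha>)"
    and "transition_matrices scl k m U e \<phi>"
    and "deformed_transition_matrices n A C k m U \<phi> \<Phi>"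
    and "smooth_partition_of_unity n A m U \<rho>"
  shows "right_module (star_algebra n A C) (deformed_sections n A C scl E k F m U e \<Phi> \<rho>)
    \<and> finitely_generated_module (star_algebra n A C) (deformed_sections n A C scl E k F m U e \<Phi> \<rho>)
    \<and> projective_module TYPE('x) TYPE('y) (star_algebra n A C)
        (deformed_sections n A C scl E k F m U e \<Phi> \<rho>)"
proof -
  have star: "star_product n A P C"
    using assms(3) by (simp add: hermitian_star_product_def)
  interpret star_bundle n A P C scl E k F m U e \<phi> \<Phi> \<rho>
    by unfold_locales (fact assms star)+
  obtain X :: "nat \<times> nat \<Rightarrow> _" and \<xi> where
    "dual_basis (star_algebra n A C) (deformed_sections n A C scl E k F m U e \<Phi> \<rho>)
       ({1..m} \<times> {..<k}) X \<xi>"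
    using sections_dual_basis by blast
  then show ?thesis
    by (intro conjI sections_right_module dual_basis.finitely_generated dual_basis.projective)
qed

end
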